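(* Let $\epsilon>0$ and let $I:M_\lambda\to\mathbb{R}^3$ be a paper Moebius band with image $\Omega=I(M_\lambda)$ and $\lambda<\sqrt3+\epsilon$. If $\epsilon<1/4$, then there is a solid equilateral triangle $\bigtriangledown_0\subset\mathbb{R}^3$ of perimeter $2\sqrt3$ such that every point of $\Omega$ is within distance $6\sqrt\epsilon$ of $\bigtriangledown_0$. If moreover $\epsilon<1/384$, then (for this $\bigtriangledown_0$) every point of $\bigtriangledown_0$ is within distance $18\sqrt\epsilon$ of $\Omega$.
   Context: For $\lambda>0$, $M_\lambda$ is the flat Moebius band obtained from a $1\times\lambda$ rectangle by identifying its length-$1$ sides with a flip; equivalently, the quotient of the strip $\mathbb{R}\times[0,1]$ by the group generated by $(x,y)\mapsto(x+\lambda,1-y)$. A paper Moebius band (short for smooth embedded paper Moebius band) of aspect ratio $\lambda$ is an infinitely differentiable isometric embedding $I:M_\lambda\to\mathbb{R}^3$ (isometric in the Riemannian sense). A solid triangle is the (planar) convex hull of its three vertices. *)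

theory Defs
  imports "HOL-Analysis.Analysis"
begin

section \<open>Smooth maps\<close>

text \<open>Meaningful for open \<open>U\<close> (and finite-dimensional domain): \<open>f\<close> is \<open>n\<close> times continuously
  differentiable on \<open>U\<close>.\<close>

primrec Ck_on_open ::
    "nat \<Rightarrow> ('a::real_normed_vector \<Rightarrow> 'b::real_normed_vector) \<Rightarrow> 'a set \<Rightarrow> bool" where
  "Ck_on_open 0 f U \<longleftrightarrow> continuous_on U f"
| "Ck_on_open (Suc n) f U \<longleftrightarrow>
     (\<forall>x\<in>U. f differentiable (at x)) \<and>
     (\<forall>v. Ck_on_open n (\<lambda>x. frechet_derivative f (at x) v) U)"

text \<open>Smoothness on an arbitrary set is the existence of local smooth extensions, as is usual for
  manifolds with boundary.\<close>

definition smooth_map_on ::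
    "('a::real_normed_vector \<Rightarrow> 'b::real_normed_vector) \<Rightarrow> 'a set \<Rightarrow> bool" where
  "smooth_map_on f S \<longleftrightarrow>
     (\<forall>p\<in>S. \<exists>U g. open U \<and> p \<in> U \<and> (\<forall>n. Ck_on_open n g U) \<and> (\<forall>q\<in>S \<inter> U. g q = f q))"


section \<open>The flat Moebius band\<close>

definition strip :: "(real \<times> real) set" where
  "strip = UNIV \<times> {0..1}"

definition glide :: "real \<Rightarrow> real \<times> real \<Rightarrow> real \<times> real" where
  "glide lam = (\<lambda>(x, y). (x + lam, 1 - y))"

text \<open>Being in the same orbit of the group generated by \<open>glide lam\<close>; the two disjuncts account for
  the nonnegative and the nonpositive powers.\<close>

definition glide_rel :: "real \<Rightarrow> ((real \<times> real) \<times> (real \<times> real)) set" where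
  "glide_rel lam = {(p, q). p \<in> strip \<and> q \<in> strip \<and>
      (\<exists>n. q = (glide lam ^^ n) p \<or> p = (glide lam ^^ n) q)}"

definition moebius_band :: "real \<Rightarrow> (real \<times> real) set set" where
  "moebius_band lam = strip // glide_rel lam"

definition moebius_proj :: "real \<Rightarrow> real \<times> real \<Rightarrow> (real \<times> real) set" where
  "moebius_proj lam p = glide_rel lam `` {p}"

definition moebius_topology :: "real \<Rightarrow> (real \<times> real) set topology" where
  "moebius_topology lam = topology (\<lambda>U. U \<subseteq> moebius_band lam \<and>
      openin (top_of_set strip) {p \<in> strip. moebius_proj lam p \<in> U})"

lemma equiv_glide_rel: "equiv strip (glide_rel lam)"
proof (rule equivI)
  show "refl_on strip (glide_rel lam)"
    unfolding refl_on_def glide_rel_def by (auto intro: exI[of _ 0])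
  show "glide_rel lam \<subseteq> strip \<times> strip"
    by (auto simp: glide_rel_def)
  show "sym (glide_rel lam)"
    unfolding sym_def glide_rel_def by blast
  have inj: "inj (glide lam ^^ n)" for n
  proof -
    have "inj (glide lam)" by (auto simp: inj_def glide_def)
    then show ?thesis by (rule inj_fn)
  qed
  have cancel: "\<exists>k. r = (glide lam ^^ k) p \<or> p = (glide lam ^^ k) r"
    if "(glide lam ^^ n) p = (glide lam ^^ m) r" for n m p r
  proof (cases "n \<le> m")
    case True
    then have "(glide lam ^^ m) r = (glide lam ^^ n) ((glide lam ^^ (m - n)) r)"
      by (metis comp_apply funpow_add le_add_diff_inverse)
    with that have "p = (glide lam ^^ (m - n)) r" by (metis inj injD)
    then show ?thesis by blast
  next
    case False
    then have "(glide lam ^^ n) p = (glide lam ^^ m) ((glide lam ^^ (n - m)) p)"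
      by (metis comp_apply funpow_add le_add_diff_inverse nat_le_linear)
    with that have "r = (glide lam ^^ (n - m)) p" by (metis inj injD)
    then show ?thesis by blast
  qed
  have add: "(glide lam ^^ m) ((glide lam ^^ n) p) = (glide lam ^^ (m + n)) p" for m n p
    by (simp add: funpow_add)
  have comm: "(glide lam ^^ m) ((glide lam ^^ n) p) = (glide lam ^^ n) ((glide lam ^^ m) p)" for m n p
    by (simp add: add add.commute)
  have cancel': "\<exists>k. r = (glide lam ^^ k) p \<or> p = (glide lam ^^ k) r"
    if "p = (glide lam ^^ n) q" "r = (glide lam ^^ m) q" for n m p q r
  proof -
    have "(glide lam ^^ m) p = (glide lam ^^ n) r"
      using that comm by metis
    then show ?thesis by (rule cancel)
  qed
  show "trans (glide_rel lam)"
  proof (rule transI)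
    fix p q r assume "(p, q) \<in> glide_rel lam" "(q, r) \<in> glide_rel lam"
    then obtain n m where "p \<in> strip" "r \<in> strip"
      and n: "q = (glide lam ^^ n) p \<or> p = (glide lam ^^ n) q"
      and m: "r = (glide lam ^^ m) q \<or> q = (glide lam ^^ m) r"
      by (auto simp: glide_rel_def)
    have "\<exists>k. r = (glide lam ^^ k) p \<or> p = (glide lam ^^ k) r"
      using n m by (metis add cancel cancel')
    with \<open>p \<in> strip\<close> \<open>r \<in> strip\<close> show "(p, r) \<in> glide_rel lam"
      by (simp add: glide_rel_def)
  qed
qed

lemma moebius_proj_in [simp]: "p \<in> strip \<Longrightarrow> moebius_proj lam p \<in> moebius_band lam"
  by (simp add: moebius_band_def moebius_proj_def quotientI)

lemma moebius_proj_image: "moebius_proj lam ` strip = moebius_band lam"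
  by (auto simp: moebius_band_def moebius_proj_def quotient_def)

lemma openin_moebius_topology:
  "openin (moebius_topology lam) U \<longleftrightarrow>
     U \<subseteq> moebius_band lam \<and> openin (top_of_set strip) {p \<in> strip. moebius_proj lam p \<in> U}"
proof -
  have "istopology (\<lambda>U. U \<subseteq> moebius_band lam \<and>
      openin (top_of_set strip) {p \<in> strip. moebius_proj lam p \<in> U})"
    unfolding istopology_def
  proof (rule conjI; intro allI impI conjI)
    fix S T assume *: "S \<subseteq> moebius_band lam \<and> openin (top_of_set strip) {p \<in> strip. moebius_proj lam p \<in> S}"
      "T \<subseteq> moebius_band lam \<and> openin (top_of_set strip) {p \<in> strip. moebius_proj lam p \<in> T}"
    then show "S \<inter> T \<subseteq> moebius_band lam" by blast
    have "{p \<in> strip. moebius_proj lam p \<in> S \<inter> T} =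
       {p \<in> strip. moebius_proj lam p \<in> S} \<inter> {p \<in> strip. moebius_proj lam p \<in> T}" by blast
    with * show "openin (top_of_set strip) {p \<in> strip. moebius_proj lam p \<in> S \<inter> T}"
      by (simp add: openin_Int)
  next
    fix \<K> assume *: "\<forall>K\<in>\<K>. K \<subseteq> moebius_band lam \<and> openin (top_of_set strip) {p \<in> strip. moebius_proj lam p \<in> K}"
    then show "\<Union> \<K> \<subseteq> moebius_band lam" by blast
    have "{p \<in> strip. moebius_proj lam p \<in> \<Union> \<K>} = (\<Union>K\<in>\<K>. {p \<in> strip. moebius_proj lam p \<in> K})" by blast
    moreover have "openin (top_of_set strip) (\<Union>K\<in>\<K>. {p \<in> strip. moebius_proj lam p \<in> K})"
      using * by (intro openin_Union) blast
    ultimately show "openin (top_of_set strip) {p \<in> strip. moebius_proj lam p \<in> \<Union> \<K>}" by simp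
  qed
  then show ?thesis
    by (simp add: moebius_topology_def)
qed

lemma topspace_moebius_topology [simp]: "topspace (moebius_topology lam) = moebius_band lam"
proof -
  have "{p \<in> strip. moebius_proj lam p \<in> moebius_band lam} = strip" by auto
  then have "openin (moebius_topology lam) (moebius_band lam)"
    by (simp add: openin_moebius_topology)
  then show ?thesis
    by (meson openin_moebius_topology openin_subset openin_topspace subset_antisym)
qed

lemma quotient_map_moebius_proj:
  "quotient_map (top_of_set strip) (moebius_topology lam) (moebius_proj lam)"
  by (auto simp: quotient_map_def moebius_proj_image openin_moebius_topology)


section \<open>Paper Moebius bands\<close>

text \<open>The smooth structure and the flat metric of the quotient are the ones for which
  \<open>moebius_proj lam\<close> is a local isometry. Hence smoothness of \<open>I\<close> and the condition that \<open>I\<close> pulls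
  back the Euclidean metric to the flat one are conditions on the lift to the strip. One-sided
  derivatives are used at boundary points; they are unique. The isometry condition also makes \<open>I\<close> an
  immersion.\<close>

definition paper_moebius_band :: "real \<Rightarrow> ((real \<times> real) set \<Rightarrow> real ^ 3) \<Rightarrow> bool" where
  "paper_moebius_band lam I \<longleftrightarrow>
     embedding_map (moebius_topology lam) euclidean I \<and>
     smooth_map_on (I \<circ> moebius_proj lam) strip \<and>
     (\<forall>p\<in>strip. \<exists>D. ((I \<circ> moebius_proj lam) has_derivative D) (at p within strip) \<and>
        (\<forall>u v. D u \<bullet> D v = u \<bullet> v))"


section \<open>Triangles\<close>

definition solid_equilateral_triangle :: "real \<Rightarrow> (real ^ 3) set \<Rightarrow> bool" where
  "solid_equilateral_triangle perim T \<longleftrightarrow>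
     (\<exists>a b c. dist a b = dist b c \<and> dist b c = dist c a \<and>
        dist a b + dist b c + dist c a = perim \<and> T = convex hull {a, b, c})"

end

theory Submission
  imports Defs
begin

text \<open>Let \<open>X\<close> be the lift of the embedding to the strip. It is smooth, locally isometric and invariant under the
glide reflection. Call a segment that crosses the strip from the lower to the upper edge a bend if
\<open>X\<close> maps it isometrically onto a segment of space.

Bends. Let \<open>L\<close> be the coefficient of the second fundamental form in the direction along the strip. Where
it is nonzero the form has rank one and its null direction is transversal to the strip. The Gauss and
Codazzi equations show that this direction does not change along the line that it determines, and that
\<open>1 / L\<close> is affine along this line. So \<open>L\<close> cannot become zero before the line reaches both edges, and
the line is a bend (\<open>bend_through_curved_point\<close>). In a gap between bends \<open>L\<close> vanishes, and then \<open>X\<close> is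
affine on the gap because it is so along its border; hence a bend passes through every point of the centre
line (\<open>bend_through_midpoint\<close>). If two bends meet, \<open>X\<close> is an affine isometry on their convex hull
(\<open>crossing_bends_span_flat_piece\<close>). For this reason the mean of the two extreme bends through a centre
point is a bend as well, and it depends continuously and monotonically on the centre point. The means
form a family that covers the strip and is invariant under the glide reflection.

The T-pattern. One turn around the band reverses the direction of a bend. A Borsuk-Ulam argument
(\<open>odd_map_on_ordered_pairs_has_zero\<close>) yields two bends whose images are perpendicular and coplanar.
As \<open>X\<close> comes from an embedding, no point is interior to both images, and so one of them, from \<open>a\<close> to
\<open>b\<close>, does not cross the line through the other one, from \<open>p\<close> to \<open>q\<close>; let \<open>b\<close> be its farther end
(\<open>ex_T_pattern\<close>).

The triangle. The points \<open>a\<close>, \<open>p\<close>, \<open>b\<close>, \<open>q\<close> cut the boundary of the band into four arcs. If \<open>x\<close> is the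
horizontal displacement of the bend \<open>p q\<close> in the strip, the two arcs at \<open>a\<close> have total length
\<open>lam - x\<close> and the two arcs at \<open>b\<close> have total length \<open>lam + x\<close>. The first path joins \<open>p\<close> to \<open>q\<close>, at
distance \<open>sqrt (1 + x\<^sup>2)\<close>; the second one does so through a point at distance at least 1 from the line
\<open>p q\<close>. This gives \<open>1 + x\<^sup>2 \<le> (lam - x)\<^sup>2\<close> and \<open>5 + x\<^sup>2 \<le> (lam + x)\<^sup>2\<close>, and the sum of the two is
\<open>lam\<^sup>2 \<ge> 3\<close>. If \<open>lam\<close> exceeds \<open>sqrt 3\<close> by less than \<open>\<epsilon>\<close>, both inequalities are equalities up to
\<open>O(\<epsilon>)\<close>. Then \<open>p\<close>, \<open>q\<close>, \<open>b\<close> are within \<open>O(sqrt \<epsilon>)\<close> of the vertices of an equilateral triangle of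
perimeter \<open>2 * sqrt 3\<close>, and every arc is within \<open>O(sqrt \<epsilon>)\<close> of a side of the triangle \<open>p q b\<close>
(\<open>near_equilateral_triangle\<close>, \<open>point_near_segment\<close>). Convexity extends the estimate from the boundary to
the bends, which fill the band. Conversely, while a bend moves from \<open>p q\<close> to \<open>a b\<close> in one of the two
possible directions, it sweeps over one of the two parts into which \<open>a\<close> and \<open>b\<close> divide the triangle
(\<open>moving_segment_sweeps_triangle\<close>).\<close>

section \<open>Smooth functions on open sets\<close>

lemma Ck_on_open_cong:
  assumes "open U" "\<And>x. x \<in> U \<Longrightarrow> f x = g x" "Ck_on_open n f U"
  shows "Ck_on_open n g U"
  using assms(2,3)
proof (induction n arbitrary: f g)
  case 0
  then show ?case by (metis Ck_on_open.simps(1) continuous_on_cong)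
next
  case (Suc n)
  have d: "f differentiable (at x)" if "x \<in> U" for x
    using Suc.prems that by simp
  have eq: "frechet_derivative f (at x) = frechet_derivative g (at x)" if "x \<in> U" for x
    by (rule frechet_derivative_transform_within_open[OF d[OF that] assms(1) that Suc.prems(1)])
  have "g differentiable (at x)" if "x \<in> U" for x
    using d[OF that] has_derivative_transform_within_open[of f _ x UNIV U g] assms(1) that Suc.prems(1)
    unfolding differentiable_def by blast
  moreover have "Ck_on_open n (\<lambda>x. frechet_derivative g (at x) v) U" for v
    using Suc.IH[of "\<lambda>x. frechet_derivative f (at x) v"] Suc.prems(2) eq by simp
  ultimately show ?case by simp
qed

lemma Ck_on_open_subset: "Ck_on_open n f U \<Longrightarrow> V \<subseteq> U \<Longrightarrow> Ck_on_open n f V"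
  by (induction n arbitrary: f) (auto intro: continuous_on_subset)

lemma Ck_on_open_local:
  assumes "\<And>x. x \<in> U \<Longrightarrow> \<exists>V. open V \<and> x \<in> V \<and> Ck_on_open n f V"
  shows "Ck_on_open n f U"
  using assms
proof (induction n arbitrary: f)
  case 0
  have "isCont f x" if "x \<in> U" for x
    using 0[OF that] by (auto simp: continuous_on_eq_continuous_at)
  then show ?case by (simp add: continuous_at_imp_continuous_on)
next
  case (Suc n)
  have "f differentiable (at x)" if "x \<in> U" for x
    using Suc.prems[OF that] by auto
  moreover have "Ck_on_open n (\<lambda>x. frechet_derivative f (at x) v) U" for v
  proof (rule Suc.IH)
    fix x assume "x \<in> U"
    from Suc.prems[OF this] show "\<exists>V. open V \<and> x \<in> V \<and> Ck_on_open n (\<lambda>x. frechet_derivative f (at x) v) V"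
      by auto
  qed
  ultimately show ?case by simp
qed

lemma Ck_on_open_Suc_imp: "Ck_on_open (Suc n) f U \<Longrightarrow> Ck_on_open n f U"
proof (induction n arbitrary: f)
  case 0
  then show ?case
    by (auto intro!: continuous_at_imp_continuous_on differentiable_imp_continuous_within)
next
  case (Suc n)
  have "Ck_on_open n (\<lambda>x. frechet_derivative f (at x) v) U" for v
    using Suc.prems by (intro Suc.IH) simp
  then show ?case using Suc.prems by simp
qed

lemma Ck_on_open_add:
  assumes "open U" "Ck_on_open n f U" "Ck_on_open n g U"
  shows "Ck_on_open n (\<lambda>x. f x + g x) U"
  using assms(2,3)
proof (induction n arbitrary: f g)
  case 0
  then show ?case by (simp add: continuous_on_add)
next
  case (Suc n)
  have hd: "((\<lambda>x. f x + g x) has_derivative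
      (\<lambda>v. frechet_derivative f (at x) v + frechet_derivative g (at x) v)) (at x)" if "x \<in> U" for x
    using Suc.prems that by (intro has_derivative_add) (simp_all add: frechet_derivative_works[symmetric])
  have "Ck_on_open n (\<lambda>x. frechet_derivative (\<lambda>x. f x + g x) (at x) v) U" for v
  proof -
    have "Ck_on_open n (\<lambda>x. frechet_derivative f (at x) v + frechet_derivative g (at x) v) U"
      using Suc.prems by (intro Suc.IH) auto
    then show ?thesis
      by (rule Ck_on_open_cong[OF assms(1), rotated]) (simp add: frechet_derivative_at[OF hd, symmetric])
  qed
  then show ?case using hd unfolding Ck_on_open.simps differentiable_def by blast
qed

lemma Ck_on_open_bilinear:
  assumes "bounded_bilinear P" "open U" "Ck_on_open n f U" "Ck_on_open n g U"
  shows "Ck_on_open n (\<lambda>x. P (f x) (g x)) U"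
  using assms(3,4)
proof (induction n arbitrary: f g)
  case 0
  then show ?case by (auto intro: bounded_bilinear.continuous_on[OF assms(1)])
next
  case (Suc n)
  have hd: "((\<lambda>x. P (f x) (g x)) has_derivative
      (\<lambda>v. P (f x) (frechet_derivative g (at x) v) + P (frechet_derivative f (at x) v) (g x))) (at x)"
    if "x \<in> U" for x
    using Suc.prems that
    by (intro bounded_bilinear.FDERIV[OF assms(1)]) (simp_all add: frechet_derivative_works[symmetric])
  have "Ck_on_open n (\<lambda>x. frechet_derivative (\<lambda>x. P (f x) (g x)) (at x) v) U" for v
  proof -
    have "Ck_on_open n (\<lambda>x. P (f x) (frechet_derivative g (at x) v)
        + P (frechet_derivative f (at x) v) (g x)) U"
      using Suc.prems Suc.prems[THEN Ck_on_open_Suc_imp]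
      by (intro Ck_on_open_add[OF assms(2)] Suc.IH) simp_all
    then show ?thesis
      by (rule Ck_on_open_cong[OF assms(2), rotated]) (simp add: frechet_derivative_at[OF hd, symmetric])
  qed
  then show ?case using hd unfolding Ck_on_open.simps differentiable_def by blast
qed

definition smooth_on_open :: "('a::real_normed_vector \<Rightarrow> 'b::real_normed_vector) \<Rightarrow> 'a set \<Rightarrow> bool"
  where "smooth_on_open f U \<longleftrightarrow> (\<forall>n. Ck_on_open n f U)"

lemma smooth_map_on_imp_smooth_on_open:
  assumes "smooth_map_on f S" "open U" "U \<subseteq> S"
  shows "smooth_on_open f U"
  unfolding smooth_on_open_def
proof (intro allI Ck_on_open_local)
  fix n p assume p: "p \<in> U"
  then have "p \<in> S" using assms(3) by blast
  with assms(1) have "\<exists>V g. open V \<and> p \<in> V \<and> (\<forall>n. Ck_on_open n g V) \<and> (\<forall>q\<in>S \<inter> V. g q = f q)"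
    unfolding smooth_map_on_def by (rule bspec)
  then obtain V g where V: "open V" "p \<in> V" "\<forall>n. Ck_on_open n g V" "\<forall>q\<in>S \<inter> V. g q = f q"
    by (elim exE conjE)
  have "Ck_on_open n f (U \<inter> V)"
  proof (rule Ck_on_open_cong[of _ g])
    show "Ck_on_open n g (U \<inter> V)"
      using V(3) by (metis Ck_on_open_subset inf_le2)
  qed (use V assms in auto)
  then show "\<exists>W. open W \<and> p \<in> W \<and> Ck_on_open n f W"
    using V p assms by blast
qed

lemma smooth_on_open_bilinear:
  assumes "bounded_bilinear P" "open U" "smooth_on_open f U" "smooth_on_open g U"
  shows "smooth_on_open (\<lambda>x. P (f x) (g x)) U"
  unfolding smooth_on_open_def
  by (intro allI Ck_on_open_bilinear[OF assms(1,2)]) (use assms(3,4) in \<open>simp_all add: smooth_on_open_def\<close>)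

section \<open>Partial derivatives in the plane\<close>

definition pdx :: "(real \<times> real \<Rightarrow> 'b::real_normed_vector) \<Rightarrow> real \<times> real \<Rightarrow> 'b"
  where "pdx f z = frechet_derivative f (at z) (1, 0)"

definition pdy :: "(real \<times> real \<Rightarrow> 'b::real_normed_vector) \<Rightarrow> real \<times> real \<Rightarrow> 'b"
  where "pdy f z = frechet_derivative f (at z) (0, 1)"

lemma smooth_on_open_pdx:
  assumes "smooth_on_open f U"
  shows "smooth_on_open (pdx f) U"
  unfolding smooth_on_open_def
proof
  fix n
  have "Ck_on_open (Suc n) f U"
    using assms by (simp only: smooth_on_open_def)
  then show "Ck_on_open n (pdx f) U"
    by (simp add: pdx_def[abs_def])
qed

lemma smooth_on_open_pdy:
  assumes "smooth_on_open f U"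
  shows "smooth_on_open (pdy f) U"
  unfolding smooth_on_open_def
proof
  fix n
  have "Ck_on_open (Suc n) f U"
    using assms by (simp only: smooth_on_open_def)
  then show "Ck_on_open n (pdy f) U"
    by (simp add: pdy_def[abs_def])
qed

lemma smooth_on_open_continuous: "smooth_on_open f U \<Longrightarrow> continuous_on U f"
  using Ck_on_open.simps(1) unfolding smooth_on_open_def by blast

lemma smooth_on_open_has_derivative:
  assumes "smooth_on_open f U" "z \<in> U"
  shows "(f has_derivative (\<lambda>v. fst v *\<^sub>R pdx f z + snd v *\<^sub>R pdy f z)) (at z)"
proof -
  have "Ck_on_open (Suc 0) f U"
    using assms(1) unfolding smooth_on_open_def by blast
  then have *: "(f has_derivative frechet_derivative f (at z)) (at z)"
    using assms(2) by (auto simp: frechet_derivative_works[symmetric])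
  then interpret linear "frechet_derivative f (at z)"
    by (rule has_derivative_linear)
  have "frechet_derivative f (at z) v = fst v *\<^sub>R pdx f z + snd v *\<^sub>R pdy f z" for v
    unfolding pdx_def pdy_def
    using add[of "fst v *\<^sub>R (1, 0)" "snd v *\<^sub>R (0, 1)"] scale[of "fst v" "(1, 0)"] scale[of "snd v" "(0, 1)"]
    by simp
  then show ?thesis using * by presburger
qed

lemma has_derivative_partials:
  assumes "(f has_derivative D) (at z)"
  shows "pdx f z = D (1, 0)" "pdy f z = D (0, 1)"
  unfolding pdx_def pdy_def using frechet_derivative_at[OF assms] by simp_all

lemma smooth_on_open_line_derivative:
  fixes f :: "real \<times> real \<Rightarrow> 'b::real_normed_vector"
  assumes "smooth_on_open f U" "(x t, y t) \<in> U"
    and "(x has_real_derivative x') (at t)" "(y has_real_derivative y') (at t)"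
  shows "((\<lambda>t. f (x t, y t)) has_vector_derivative (x' *\<^sub>R pdx f (x t, y t) + y' *\<^sub>R pdy f (x t, y t))) (at t)"
proof -
  have "((\<lambda>t. (x t, y t)) has_derivative (\<lambda>h. (h *\<^sub>R x', h *\<^sub>R y'))) (at t)"
    using assms(3,4) by (intro has_derivative_Pair)
      (auto simp: has_field_derivative_def mult.commute[of _ x'] mult.commute[of _ y'])
  from has_derivative_compose[OF this smooth_on_open_has_derivative[OF assms(1,2)]]
  show ?thesis by (simp add: has_vector_derivative_def scaleR_add_right)
qed

text \<open>By the mean value theorem the second difference of \<open>f\<close> over a square of side \<open>h\<close> is \<open>h\<^sup>2\<close> times the value
of either mixed derivative at some point of the square. Both derivatives are continuous, so they agree
in the limit.\<close>

lemma mixed_partials_real: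
  fixes f :: "real \<times> real \<Rightarrow> real"
  assumes sm: "smooth_on_open f U" and U: "open U" "(a, b) \<in> U"
  shows "pdy (pdx f) (a, b) = pdx (pdy f) (a, b)"
proof (rule ccontr)
  let ?F = "pdy (pdx f)" and ?G = "pdx (pdy f)"
  assume ne: "?F (a, b) \<noteq> ?G (a, b)"
  define e where "e = \<bar>?F (a, b) - ?G (a, b)\<bar> / 2"
  have e: "e > 0" using ne by (simp add: e_def)
  have cF: "isCont ?F (a, b)" and cG: "isCont ?G (a, b)"
    using U smooth_on_open_continuous[OF smooth_on_open_pdy[OF smooth_on_open_pdx[OF sm]]]
      smooth_on_open_continuous[OF smooth_on_open_pdx[OF smooth_on_open_pdy[OF sm]]]
    by (auto simp: continuous_on_eq_continuous_at)
  obtain d1 where d1: "d1 > 0" "\<And>z. dist z (a, b) < d1 \<Longrightarrow> dist (?F z) (?F (a, b)) < e"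
    using cF e unfolding continuous_at_eps_delta by (metis dist_commute)
  obtain d2 where d2: "d2 > 0" "\<And>z. dist z (a, b) < d2 \<Longrightarrow> dist (?G z) (?G (a, b)) < e"
    using cG e unfolding continuous_at_eps_delta by (metis dist_commute)
  obtain d3 where d3: "d3 > 0" "ball (a, b) d3 \<subseteq> U"
    using U openE by blast
  define h where "h = Min {d1, d2, d3} / 3"
  have h: "h > 0" "h + h < d1" "h + h < d2" "h + h < d3"
    using d1 d2 d3 by (auto simp: h_def min_def)
  have close: "dist (x, y) (a, b) \<le> h + h" if "x \<in> {a..a+h}" "y \<in> {b..b+h}" for x y
  proof -
    have "dist (x, y) (a, b) \<le> \<bar>x - a\<bar> + \<bar>y - b\<bar>"
      by (simp add: dist_prod_def dist_real_def sqrt_sum_squares_le_sum_abs)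
    then show ?thesis using that by auto
  qed
  have inU: "(x, y) \<in> U" if "x \<in> {a..a+h}" "y \<in> {b..b+h}" for x y
    using close[OF that] h d3 by (auto simp: dist_commute subset_iff)
  have dx: "((\<lambda>x. g (x, y)) has_real_derivative pdx g (x, y)) (at x)"
    if "smooth_on_open g U" "(x, y) \<in> U" for g :: "real \<times> real \<Rightarrow> real" and x y
    using smooth_on_open_line_derivative[of g U "\<lambda>t. t" x "\<lambda>t. y" 1 0] that
    by (auto simp: has_real_derivative_iff_has_vector_derivative)
  have dy: "((\<lambda>y. g (x, y)) has_real_derivative pdy g (x, y)) (at y)"
    if "smooth_on_open g U" "(x, y) \<in> U" for g :: "real \<times> real \<Rightarrow> real" and x y
    using smooth_on_open_line_derivative[of g U "\<lambda>t. x" y "\<lambda>t. t" 0 1] that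
    by (auto simp: has_real_derivative_iff_has_vector_derivative)
  define \<Delta> where "\<Delta> = f (a+h, b+h) - f (a+h, b) - f (a, b+h) + f (a, b)"
  have "\<exists>x y. a < x \<and> x < a+h \<and> b < y \<and> y < b+h \<and> \<Delta> = h * h * ?F (x, y)"
  proof -
    have "\<exists>x. x > a \<and> x < a+h \<and> (\<lambda>x. f (x, b+h) - f (x, b)) (a+h) - (\<lambda>x. f (x, b+h) - f (x, b)) a
        = (a+h - a) * (pdx f (x, b+h) - pdx f (x, b))"
      using h by (intro MVT2) (auto intro!: DERIV_diff dx sm inU)
    then obtain x where x: "x > a" "x < a+h" "\<Delta> = h * (pdx f (x, b+h) - pdx f (x, b))"
      by (auto simp: \<Delta>_def algebra_simps)
    have "\<exists>y. y > b \<and> y < b+h \<and> pdx f (x, b+h) - pdx f (x, b) = (b+h - b) * ?F (x, y)"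
      using h x by (intro MVT2) (auto intro!: dy smooth_on_open_pdx sm inU)
    then show ?thesis using x by auto
  qed
  then obtain x y where xy: "a < x" "x < a+h" "b < y" "y < b+h" "\<Delta> = h * h * ?F (x, y)" by blast
  have "\<exists>x y. a < x \<and> x < a+h \<and> b < y \<and> y < b+h \<and> \<Delta> = h * h * ?G (x, y)"
  proof -
    have "\<exists>y. y > b \<and> y < b+h \<and> (\<lambda>y. f (a+h, y) - f (a, y)) (b+h) - (\<lambda>y. f (a+h, y) - f (a, y)) b
        = (b+h - b) * (pdy f (a+h, y) - pdy f (a, y))"
      using h by (intro MVT2) (auto intro!: DERIV_diff dy sm inU)
    then obtain y where y: "y > b" "y < b+h" "\<Delta> = h * (pdy f (a+h, y) - pdy f (a, y))"
      by (auto simp: \<Delta>_def algebra_simps)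
    have "\<exists>x. x > a \<and> x < a+h \<and> pdy f (a+h, y) - pdy f (a, y) = (a+h - a) * ?G (x, y)"
      using h y by (intro MVT2) (auto intro!: dx smooth_on_open_pdy sm inU)
    then show ?thesis using y by auto
  qed
  then obtain x' y' where xy': "a < x'" "x' < a+h" "b < y'" "y' < b+h" "\<Delta> = h * h * ?G (x', y')" by blast
  have "?F (x, y) = ?G (x', y')" using xy xy' h by auto
  moreover have "dist (?F (x, y)) (?F (a, b)) < e"
    using close[of x y] xy h by (intro d1) auto
  moreover have "dist (?G (x', y')) (?G (a, b)) < e"
    using close[of x' y'] xy' h by (intro d2) auto
  moreover have "\<bar>?F (a, b) - ?G (a, b)\<bar>
      \<le> \<bar>?F (x, y) - ?F (a, b)\<bar> + \<bar>?G (x', y') - ?G (a, b)\<bar>" if "?F (x, y) = ?G (x', y')"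
    using that by arith
  ultimately show False unfolding e_def dist_real_def by fastforce
qed

lemma pdx_inner_const:
  assumes "smooth_on_open f U" "z \<in> U"
  shows "pdx (\<lambda>z. f z \<bullet> c) z = pdx f z \<bullet> c" "pdy (\<lambda>z. f z \<bullet> c) z = pdy f z \<bullet> c"
proof -
  have "((\<lambda>z. f z \<bullet> c) has_derivative (\<lambda>v. (fst v *\<^sub>R pdx f z + snd v *\<^sub>R pdy f z) \<bullet> c)) (at z)"
    by (intro has_derivative_inner_left smooth_on_open_has_derivative[OF assms])
  from has_derivative_partials[OF this]
  show "pdx (\<lambda>z. f z \<bullet> c) z = pdx f z \<bullet> c" "pdy (\<lambda>z. f z \<bullet> c) z = pdy f z \<bullet> c" by simp_all
qed

lemma smooth_on_open_const: "smooth_on_open (\<lambda>_. c) U"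
proof -
  have "Ck_on_open n (\<lambda>_. c) U" for n
    by (induction n arbitrary: c) (auto simp: frechet_derivative_const)
  then show ?thesis by (simp add: smooth_on_open_def)
qed

lemma partials_cong:
  assumes "open U" "z \<in> U" "\<And>z. z \<in> U \<Longrightarrow> f z = g z" "smooth_on_open f U"
  shows "pdx f z = pdx g z" "pdy f z = pdy g z"
proof -
  have "(f has_derivative (\<lambda>v. fst v *\<^sub>R pdx f z + snd v *\<^sub>R pdy f z)) (at z)"
    by (rule smooth_on_open_has_derivative[OF assms(4,2)])
  then have "(g has_derivative (\<lambda>v. fst v *\<^sub>R pdx f z + snd v *\<^sub>R pdy f z)) (at z)"
    by (rule has_derivative_transform_within_open[OF _ assms(1-3)])
  from has_derivative_partials[OF this]
  show "pdx f z = pdx g z" "pdy f z = pdy g z" by simp_all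
qed

lemma mixed_partials:
  fixes f :: "real \<times> real \<Rightarrow> 'b::real_inner"
  assumes sm: "smooth_on_open f U" and U: "open U" "z \<in> U"
  shows "pdy (pdx f) z = pdx (pdy f) z"
proof -
  have "pdy (pdx f) z \<bullet> c = pdx (pdy f) z \<bullet> c" for c
  proof -
    let ?g = "\<lambda>z. f z \<bullet> c"
    have g: "smooth_on_open ?g U"
      by (rule smooth_on_open_bilinear[OF bounded_bilinear_inner U(1) sm smooth_on_open_const])
    have "pdy (pdx f) z \<bullet> c = pdy (\<lambda>z. pdx f z \<bullet> c) z"
      using pdx_inner_const(2)[OF smooth_on_open_pdx[OF sm] U(2)] by simp
    also have "\<dots> = pdy (pdx ?g) z"
      by (rule partials_cong(2)[OF U, symmetric])
        (auto simp: pdx_inner_const[OF sm] intro: smooth_on_open_pdx g)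
    also have "\<dots> = pdx (pdy ?g) z"
      using mixed_partials_real[OF g U(1)] U(2) by (cases z) auto
    also have "\<dots> = pdx (\<lambda>z. pdy f z \<bullet> c) z"
      by (rule partials_cong(1)[OF U])
        (auto simp: pdx_inner_const[OF sm] intro: smooth_on_open_pdy g)
    also have "\<dots> = pdx (pdy f) z \<bullet> c"
      using pdx_inner_const(1)[OF smooth_on_open_pdy[OF sm] U(2)] by simp
    finally show ?thesis .
  qed
  then show ?thesis
    by (metis inner_eq_zero_iff inner_diff_left right_minus_eq)
qed

lemma partials_bilinear:
  assumes "bounded_bilinear P" "smooth_on_open f U" "smooth_on_open g U" "z \<in> U"
  shows "pdx (\<lambda>z. P (f z) (g z)) z = P (f z) (pdx g z) + P (pdx f z) (g z)"
    and "pdy (\<lambda>z. P (f z) (g z)) z = P (f z) (pdy g z) + P (pdy f z) (g z)"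
proof -
  note hd = bounded_bilinear.FDERIV[OF assms(1) smooth_on_open_has_derivative[OF assms(2,4)]
      smooth_on_open_has_derivative[OF assms(3,4)]]
  show "pdx (\<lambda>z. P (f z) (g z)) z = P (f z) (pdx g z) + P (pdx f z) (g z)"
    and "pdy (\<lambda>z. P (f z) (g z)) z = P (f z) (pdy g z) + P (pdy f z) (g z)"
    using has_derivative_partials[OF hd] by simp_all
qed

section \<open>A rank-one form along its null line\<close>

text \<open>If \<open>C\<close> bounds the coefficient, \<open>(f t)\<^sup>2 * exp (- 2 * C * t)\<close> does not increase.\<close>

lemma linear_ode_zero:
  fixes f :: "real \<Rightarrow> real"
  assumes der: "\<And>t. t \<in> {a..b} \<Longrightarrow> (f has_real_derivative c t * f t) (at t)"
    and c: "continuous_on {a..b} c" and f0: "f a = 0" and t: "t \<in> {a..b}"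
  shows "f t = 0"
proof -
  have "compact (c ` {a..b})" by (intro compact_continuous_image c compact_Icc)
  then obtain C where C: "\<And>t. t \<in> {a..b} \<Longrightarrow> \<bar>c t\<bar> \<le> C"
    using compact_imp_bounded[of "c ` {a..b}"] unfolding bounded_iff real_norm_def by blast
  define g where "g = (\<lambda>t. (f t)\<^sup>2 * exp (- 2 * C * t))"
  have "g t \<le> g a"
  proof (rule DERIV_nonpos_imp_nonincreasing[of a t g])
    show "a \<le> t" using t by simp
    fix s assume s: "a \<le> s" "s \<le> t"
    then have s': "s \<in> {a..b}" using t by simp
    have "(g has_real_derivative (c s - C) * (2 * (f s)\<^sup>2 * exp (- 2 * C * s))) (at s)"
      unfolding g_def by (auto intro!: derivative_eq_intros der[OF s'] simp: power2_eq_square algebra_simps)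
    moreover have "(c s - C) * (2 * (f s)\<^sup>2 * exp (- 2 * C * s)) \<le> 0"
      using C[OF s'] by (intro mult_nonpos_nonneg) (auto simp: abs_le_iff)
    ultimately show "\<exists>y. (g has_real_derivative y) (at s) \<and> y \<le> 0" by blast
  qed
  then have "(f t)\<^sup>2 * exp (- 2 * C * t) \<le> 0" by (simp add: g_def f0)
  then show ?thesis by (simp add: mult_le_0_iff not_le[symmetric])
qed

text \<open>Let \<open>(L, M, N)\<close> be a symmetric form field in the plane with \<open>L * N = M\<^sup>2\<close> that satisfies the Codazzi
equations, fix a slope \<open>m\<close>, and put \<open>f = M - m * L\<close> and \<open>kap = N - 2 * m * M + m\<^sup>2 * L\<close>. The lemma concerns
the values of these functions along a line in direction \<open>(- m, 1)\<close>. Here \<open>h\<close> and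
\<open>k1\<close> are the \<open>x\<close>-derivatives of \<open>f\<close> and \<open>kap\<close>, and \<open>k2\<close> is the second \<open>x\<close>-derivative of \<open>kap\<close>; by the
Codazzi equations \<open>h\<close>, \<open>k1\<close>, \<open>k2\<close> are at the same time the derivatives of \<open>L\<close>, \<open>f\<close>, \<open>h\<close> along the line. The equation \<open>L * kap = f\<^sup>2\<close>, differentiated zero, one and two
times with respect to \<open>x\<close>, is \<open>e0\<close>, \<open>e1\<close>, \<open>e2\<close>.

As long as \<open>L\<close> is nonzero, \<open>e0\<close> and \<open>e1\<close> turn \<open>f' = k1\<close> into a linear equation, so \<open>f\<close> stays zero; this says
that the line keeps the null direction. After that \<open>e2\<close> says that the second derivative of \<open>1 / L\<close>
vanishes. So \<open>L\<close> is the reciprocal of an affine function and cannot become zero at a finite time.\<close>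

lemma rank_one_along_null_line_forward:
  fixes L f h kap k1 k2 Lx Lxx fxx :: "real \<Rightarrow> real"
  assumes dL: "\<And>t. t \<in> {a..b} \<Longrightarrow> (L has_real_derivative h t) (at t)"
    and df: "\<And>t. t \<in> {a..b} \<Longrightarrow> (f has_real_derivative k1 t) (at t)"
    and dh: "\<And>t. t \<in> {a..b} \<Longrightarrow> (h has_real_derivative k2 t) (at t)"
    and cLx: "continuous_on {a..b} Lx"
    and e0: "\<And>t. t \<in> {a..b} \<Longrightarrow> L t * kap t = (f t)\<^sup>2"
    and e1: "\<And>t. t \<in> {a..b} \<Longrightarrow> Lx t * kap t + L t * k1 t = 2 * f t * h t"
    and e2: "\<And>t. t \<in> {a..b} \<Longrightarrow>
      Lxx t * kap t + 2 * Lx t * k1 t + L t * k2 t = 2 * (h t)\<^sup>2 + 2 * f t * fxx t"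
    and fa: "f a = 0" and La: "L a \<noteq> 0" and t: "t \<in> {a..b}"
  shows "f t = 0 \<and> L t \<noteq> 0"
proof -
  have cL: "continuous_on {a..b} L" and cf: "continuous_on {a..b} f" and ch: "continuous_on {a..b} h"
    using DERIV_isCont[OF dL] DERIV_isCont[OF df] DERIV_isCont[OF dh]
    by (blast intro: continuous_at_imp_continuous_on)+
  have f_zero: "f t = 0" if nz: "\<And>s. s \<in> {a..t} \<Longrightarrow> L s \<noteq> 0" and "t \<in> {a..b}" for t
  proof (rule linear_ode_zero[of a t f "\<lambda>s. 2 * h s / L s - Lx s * f s / (L s)\<^sup>2"])
    have sub: "{a..t} \<subseteq> {a..b}" using that by auto
    note [continuous_intros] = continuous_on_subset[OF cL sub] continuous_on_subset[OF cf sub]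
      continuous_on_subset[OF ch sub] continuous_on_subset[OF cLx sub]
    show "continuous_on {a..t} (\<lambda>s. 2 * h s / L s - Lx s * f s / (L s)\<^sup>2)"
      using nz by (intro continuous_intros) auto
    fix s assume s: "s \<in> {a..t}"
    then have s': "s \<in> {a..b}" using sub by blast
    have L: "L s \<noteq> 0" using nz s by blast
    have kap: "kap s = (f s)\<^sup>2 / L s" using e0[OF s'] L by (simp add: field_simps)
    have "k1 s = (2 * h s / L s - Lx s * f s / (L s)\<^sup>2) * f s"
      using e1[OF s'] L unfolding kap by (simp add: field_simps power2_eq_square)
    then show "(f has_real_derivative (2 * h s / L s - Lx s * f s / (L s)\<^sup>2) * f s) (at s)"
      using df[OF s'] by simp
  qed (use fa that in auto)
  have L_nonzero: "L t \<noteq> 0" if t: "t \<in> {a..b}" for t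
  proof
    assume Lt: "L t = 0"
    define Z where "Z = {s \<in> {a..b}. L s = 0}"
    \<comment> \<open>the first zero \<open>z\<close> of \<open>L\<close>, which will contradict \<open>affine\<close> below\<close>
    have "compact Z"
      unfolding Z_def using continuous_closed_preimage_constant[OF cL, of 0]
      by (auto simp: compact_eq_bounded_closed intro: bounded_subset[of "{a..b}"])
    then obtain z where z: "z \<in> Z" "\<And>s. s \<in> Z \<Longrightarrow> z \<le> s"
      using compact_attains_inf[of Z] Lt t by (auto simp: Z_def)
    have zab: "z \<in> {a..b}" and Lz: "L z = 0" using z(1) by (auto simp: Z_def)
    have az: "a < z" using La Lz zab by (cases "a = z") auto
    have nz: "L s \<noteq> 0" if "s \<in> {a..<z}" for s
      using z(2)[of s] that zab by (fastforce simp: Z_def)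
    have fz: "f s = 0" if "s \<in> {a..<z}" for s
      using that zab by (intro f_zero nz) auto
    have const: "h s / (L s)\<^sup>2 = h a / (L a)\<^sup>2" if s: "s \<in> {a..<z}" for s
    proof (cases "s = a")
      case False
      show ?thesis
      proof (rule DERIV_isconst2[of a s "\<lambda>s. h s / (L s)\<^sup>2"])
        have sub: "{a..s} \<subseteq> {a..b}" using s zab by auto
        show "continuous_on {a..s} (\<lambda>s. h s / (L s)\<^sup>2)"
          using nz s by (intro continuous_intros continuous_on_subset[OF cL sub]
              continuous_on_subset[OF ch sub]) auto
        fix r assume r: "a < r" "r < s"
        then have r': "r \<in> {a..b}" "r \<in> {a..<z}" using s zab by auto
        have "kap r = 0" using e0[OF r'(1)] nz[OF r'(2)] fz[OF r'(2)] by simp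
        moreover from this have "k1 r = 0"
          using e1[OF r'(1)] nz[OF r'(2)] fz[OF r'(2)] by simp
        ultimately have "L r * k2 r = 2 * (h r)\<^sup>2"
          using e2[OF r'(1)] fz[OF r'(2)] by simp
        then show "((\<lambda>s. h s / (L s)\<^sup>2) has_real_derivative 0) (at r)"
          using nz[OF r'(2)]
          by (auto intro!: derivative_eq_intros dL[OF r'(1)] dh[OF r'(1)]
              simp: power2_eq_square field_simps)
      qed (use False s in auto)
    qed simp
    define q where "q = h a / (L a)\<^sup>2"
    have affine: "L s * (1 / L a - q * (s - a)) = 1" if s: "s \<in> {a..<z}" for s
    proof (cases "s = a")
      case False
      have "1 / L s + q * (s - a) = 1 / L a + q * (a - a)"
      proof (rule DERIV_isconst2[of a s "\<lambda>s. 1 / L s + q * (s - a)"])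
        have sub: "{a..s} \<subseteq> {a..b}" using s zab by auto
        show "continuous_on {a..s} (\<lambda>s. 1 / L s + q * (s - a))"
          using nz s by (intro continuous_intros continuous_on_subset[OF cL sub]) auto
        fix r assume r: "a < r" "r < s"
        then have r': "r \<in> {a..b}" "r \<in> {a..<z}" using s zab by auto
        have "q = h r / (L r)\<^sup>2" using const[OF r'(2)] by (simp add: q_def)
        then show "((\<lambda>s. 1 / L s + q * (s - a)) has_real_derivative 0) (at r)"
          using nz[OF r'(2)]
          by (auto intro!: derivative_eq_intros dL[OF r'(1)] simp: power2_eq_square)
      qed (use False s in auto)
      then have "1 / L a - q * (s - a) = 1 / L s" by simp
      then show ?thesis using nz[OF s] by simp
    qed (use La in simp)
    have "continuous_on (closure {a..<z}) (\<lambda>s. L s * (1 / L a - q * (s - a)))"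
      using az zab by (intro continuous_intros continuous_on_subset[OF cL]) auto
    then have "L z * (1 / L a - q * (z - a)) = 1"
      by (rule continuous_constant_on_closure) (use affine az in auto)
    then show False using Lz by simp
  qed
  show ?thesis using f_zero[OF L_nonzero] L_nonzero t by auto
qed

text \<open>Running the line backwards changes the signs of \<open>h\<close>, \<open>k1\<close> and \<open>Lx\<close> and leaves the equations as they are.\<close>

lemma rank_one_along_null_line:
  fixes L f h kap k1 k2 Lx Lxx fxx :: "real \<Rightarrow> real"
  assumes dL: "\<And>t. t \<in> {a<..<b} \<Longrightarrow> (L has_real_derivative h t) (at t)"
    and df: "\<And>t. t \<in> {a<..<b} \<Longrightarrow> (f has_real_derivative k1 t) (at t)"
    and dh: "\<And>t. t \<in> {a<..<b} \<Longrightarrow> (h has_real_derivative k2 t) (at t)"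
    and cLx: "continuous_on {a<..<b} Lx"
    and e0: "\<And>t. t \<in> {a<..<b} \<Longrightarrow> L t * kap t = (f t)\<^sup>2"
    and e1: "\<And>t. t \<in> {a<..<b} \<Longrightarrow> Lx t * kap t + L t * k1 t = 2 * f t * h t"
    and e2: "\<And>t. t \<in> {a<..<b} \<Longrightarrow>
      Lxx t * kap t + 2 * Lx t * k1 t + L t * k2 t = 2 * (h t)\<^sup>2 + 2 * f t * fxx t"
    and s: "s \<in> {a<..<b}" and fs: "f s = 0" and Ls: "L s \<noteq> 0" and t: "t \<in> {a<..<b}"
  shows "f t = 0 \<and> L t \<noteq> 0"
proof (cases "s \<le> t")
  case True
  have sub: "{s..t} \<subseteq> {a<..<b}" using s t by auto
  show ?thesis
    by (rule rank_one_along_null_line_forward[of s t L h f k1 k2 Lx kap Lxx fxx])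
      (use True sub fs Ls in \<open>auto intro!: dL df dh e0 e1 e2 continuous_on_subset[OF cLx sub]\<close>)
next
  case False
  have sub: "- r \<in> {a<..<b}" if "r \<in> {-s..-t}" for r using s t that by auto
  have "f (- (- t)) = 0 \<and> L (- (- t)) \<noteq> 0"
  proof (rule rank_one_along_null_line_forward[of "-s" "-t" "\<lambda>r. L (- r)" "\<lambda>r. - h (- r)" "\<lambda>r. f (- r)"
        "\<lambda>r. - k1 (- r)" "\<lambda>r. k2 (- r)" "\<lambda>r. - Lx (- r)" "\<lambda>r. kap (- r)" "\<lambda>r. Lxx (- r)" "\<lambda>r. fxx (- r)"])
    show "continuous_on {- s..- t} (\<lambda>r. - Lx (- r))"
      by (intro continuous_intros continuous_on_compose2[OF cLx]) (use s t in auto)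
    fix r assume r: "r \<in> {-s..-t}"
    show "((\<lambda>r. L (- r)) has_real_derivative - h (- r)) (at r)"
      and "((\<lambda>r. f (- r)) has_real_derivative - k1 (- r)) (at r)"
      using dL[OF sub[OF r]] df[OF sub[OF r]] by (simp_all add: DERIV_mirror)
    have "((\<lambda>r. h (- r)) has_real_derivative - k2 (- r)) (at r)"
      using dh[OF sub[OF r]] by (simp add: DERIV_mirror)
    then show "((\<lambda>r. - h (- r)) has_real_derivative k2 (- r)) (at r)"
      using DERIV_minus by fastforce
    show "L (- r) * kap (- r) = (f (- r))\<^sup>2"
      and "- Lx (- r) * kap (- r) + L (- r) * - k1 (- r) = 2 * f (- r) * - h (- r)"
      and "Lxx (- r) * kap (- r) + 2 * - Lx (- r) * - k1 (- r) + L (- r) * k2 (- r)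
        = 2 * (- h (- r))\<^sup>2 + 2 * f (- r) * fxx (- r)"
      using e0[OF sub[OF r]] e1[OF sub[OF r]] e2[OF sub[OF r]] by simp_all
  qed (use False fs Ls in auto)
  then show ?thesis by simp
qed

section \<open>Flat surfaces in space\<close>

unbundle cross3_syntax

text \<open>Lagrange's identity for the double vector product, applied to \<open>n \<times> (w \<times> n)\<close> with \<open>n = a \<times> b\<close>.\<close>

lemma orthogonal_to_orthonormal_pair:
  fixes a b w :: "real^3"
  assumes "a \<bullet> a = 1" "b \<bullet> b = 1" "a \<bullet> b = 0" "a \<bullet> w = 0" "b \<bullet> w = 0"
  shows "w = (w \<bullet> (a \<times> b)) *\<^sub>R (a \<times> b)" "(a \<times> b) \<bullet> (a \<times> b) = 1"
proof -
  let ?n = "a \<times> b"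
  show n1: "?n \<bullet> ?n = 1"
    using norm_cross_dot[of a b] assms by (simp add: power2_norm_eq_inner power_mult_distrib)
  have "w \<times> ?n = 0"
    using assms by (simp add: Lagrange inner_commute)
  then have "(?n \<bullet> ?n) *\<^sub>R w - (?n \<bullet> w) *\<^sub>R ?n = 0"
    by (metis Lagrange cross_zero_right)
  then show "w = (w \<bullet> ?n) *\<^sub>R ?n" using n1 by (simp add: inner_commute)
qed

lemma bounded_bilinear_cross3: "bounded_bilinear cross3"
  using bilinear_cross bilinear_conv_bounded_bilinear by blast

lemma partials_of_constant_product:
  assumes "bounded_bilinear P" "open U" "smooth_on_open f U" "smooth_on_open g U"
    and "\<And>z. z \<in> U \<Longrightarrow> P (f z) (g z) = c" "z \<in> U"
  shows "P (f z) (pdx g z) + P (pdx f z) (g z) = 0"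
    and "P (f z) (pdy g z) + P (pdy f z) (g z) = 0"
proof -
  note sm = smooth_on_open_bilinear[OF assms(1-4)]
  have c: "((\<lambda>z. c) has_derivative (\<lambda>v. 0)) (at z)" by simp
  show "P (f z) (pdx g z) + P (pdx f z) (g z) = 0"
    using partials_bilinear(1)[OF assms(1,3,4,6)] partials_cong(1)[OF assms(2,6,5) sm]
      has_derivative_partials(1)[OF c] by simp
  show "P (f z) (pdy g z) + P (pdy f z) (g z) = 0"
    using partials_bilinear(2)[OF assms(1,3,4,6)] partials_cong(2)[OF assms(2,6,5) sm]
      has_derivative_partials(2)[OF c] by simp
qed

locale flat_immersion =
  fixes X :: "real \<times> real \<Rightarrow> real^3" and U :: "(real \<times> real) set"
  assumes open_U: "open U"
    and smooth_X: "smooth_on_open X U"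
    and isometric_X: "z \<in> U \<Longrightarrow> pdx X z \<bullet> pdx X z = 1"
      "z \<in> U \<Longrightarrow> pdy X z \<bullet> pdy X z = 1" "z \<in> U \<Longrightarrow> pdx X z \<bullet> pdy X z = 0"
begin

definition normal :: "real \<times> real \<Rightarrow> real^3"
  where "normal z = pdx X z \<times> pdy X z"

text \<open>The coefficients of the second fundamental form.\<close>

definition L :: "real \<times> real \<Rightarrow> real" where "L z = pdx (pdx X) z \<bullet> normal z"
definition M :: "real \<times> real \<Rightarrow> real" where "M z = pdy (pdx X) z \<bullet> normal z"
definition N :: "real \<times> real \<Rightarrow> real" where "N z = pdy (pdy X) z \<bullet> normal z"

lemmas sm = smooth_X smooth_on_open_pdx smooth_on_open_pdy

lemma smooth_normal: "smooth_on_open normal U"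
  unfolding normal_def[abs_def]
  by (rule smooth_on_open_bilinear[OF bounded_bilinear_cross3 open_U]) (intro sm)+

lemma smooth_LMN: "smooth_on_open L U" "smooth_on_open M U" "smooth_on_open N U"
  unfolding L_def[abs_def] M_def[abs_def] N_def[abs_def]
  by (rule smooth_on_open_bilinear[OF bounded_bilinear_inner open_U _ smooth_normal]; intro sm)+

lemmas sm_X = smooth_on_open_pdx[OF smooth_X] smooth_on_open_pdy[OF smooth_X]

lemma mixed_X: "z \<in> U \<Longrightarrow> pdx (pdy X) z = pdy (pdx X) z"
  using mixed_partials[OF smooth_X open_U] by simp

lemma tangential_second_derivatives_vanish:
  assumes z: "z \<in> U"
  shows "pdx X z \<bullet> pdx (pdx X) z = 0" "pdy X z \<bullet> pdx (pdx X) z = 0"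
    "pdx X z \<bullet> pdy (pdx X) z = 0" "pdy X z \<bullet> pdy (pdx X) z = 0"
    "pdx X z \<bullet> pdy (pdy X) z = 0" "pdy X z \<bullet> pdy (pdy X) z = 0"
proof -
  note prod = partials_of_constant_product[OF bounded_bilinear_inner open_U]
  note AA = prod[OF sm_X(1) sm_X(1) isometric_X(1) z]
  note BB = prod[OF sm_X(2) sm_X(2) isometric_X(2) z]
  note AB = prod[OF sm_X(1) sm_X(2) isometric_X(3) z]
  show 1: "pdx X z \<bullet> pdx (pdx X) z = 0" "pdx X z \<bullet> pdy (pdx X) z = 0"
    using AA by (simp_all add: inner_commute)
  show 2: "pdy X z \<bullet> pdy (pdx X) z = 0" "pdy X z \<bullet> pdy (pdy X) z = 0"
    using BB mixed_X[OF z] by (simp_all add: inner_commute)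
  show "pdy X z \<bullet> pdx (pdx X) z = 0" "pdx X z \<bullet> pdy (pdy X) z = 0"
    using AB 1 2 mixed_X[OF z] by (simp_all add: inner_commute)
qed

lemma gauss_formula:
  assumes z: "z \<in> U"
  shows "pdx (pdx X) z = L z *\<^sub>R normal z" "pdy (pdx X) z = M z *\<^sub>R normal z"
    "pdx (pdy X) z = M z *\<^sub>R normal z" "pdy (pdy X) z = N z *\<^sub>R normal z"
  unfolding L_def M_def N_def normal_def mixed_X[OF z]
  using tangential_second_derivatives_vanish[OF z]
  by (simp_all add: orthogonal_to_orthonormal_pair(1)[OF isometric_X[OF z], symmetric])

lemma normal_unit:
  assumes z: "z \<in> U"
  shows "normal z \<bullet> normal z = 1"
  unfolding normal_def
  using orthogonal_to_orthonormal_pair(2)[OF isometric_X[OF z], of 0] by simp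

text \<open>Differentiate the vanishing product of \<open>X\<^sub>x\<^sub>x\<close> and \<open>X\<^sub>y\<close> in \<open>y\<close>, that of \<open>X\<^sub>x\<^sub>y\<close> and \<open>X\<^sub>y\<close> in \<open>x\<close>, and
subtract: the third derivatives cancel.\<close>

lemma gauss_equation:
  assumes z: "z \<in> U"
  shows "L z * N z = (M z)\<^sup>2"
proof -
  note prod = partials_of_constant_product[OF bounded_bilinear_inner open_U]
  have 1: "pdx (pdx X) z \<bullet> pdy (pdy X) z + pdy (pdx (pdx X)) z \<bullet> pdy X z = 0"
    by (rule prod(2)[OF _ sm_X(2) _ z])
      (use tangential_second_derivatives_vanish(2) in \<open>auto simp: inner_commute intro: sm\<close>)
  have 2: "pdy (pdx X) z \<bullet> pdx (pdy X) z + pdx (pdy (pdx X)) z \<bullet> pdy X z = 0"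
    by (rule prod(1)[OF _ sm_X(2) _ z])
      (use tangential_second_derivatives_vanish(4) in \<open>auto simp: inner_commute intro: sm\<close>)
  have "pdy (pdx (pdx X)) z = pdx (pdy (pdx X)) z"
    by (rule mixed_partials[OF sm_X(1) open_U z])
  with 1 2 have "pdx (pdx X) z \<bullet> pdy (pdy X) z = pdy (pdx X) z \<bullet> pdx (pdy X) z"
    by simp
  then show ?thesis
    by (simp add: gauss_formula[OF z] normal_unit[OF z] power2_eq_square mult.commute)
qed

text \<open>The derivatives of the unit normal are tangential and second derivatives of \<open>X\<close> are normal. So both
sides are the normal component of the same third derivative of \<open>X\<close>.\<close>

lemma codazzi_equations:
  assumes z: "z \<in> U"
  shows "pdy L z = pdx M z" "pdy M z = pdx N z"
proof -
  note prod = partials_bilinear[OF bounded_bilinear_inner _ smooth_normal z]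
  note nn = partials_of_constant_product[OF bounded_bilinear_inner open_U smooth_normal smooth_normal normal_unit z]
  have n0: "normal z \<bullet> pdx normal z = 0" "normal z \<bullet> pdy normal z = 0"
    using nn by (simp_all add: inner_commute)
  have "pdy L z = pdy (pdx (pdx X)) z \<bullet> normal z"
    unfolding L_def[abs_def]
    by (subst prod(2)) (auto intro: sm simp: gauss_formula[OF z] n0)
  moreover have "pdx M z = pdx (pdy (pdx X)) z \<bullet> normal z"
    unfolding M_def[abs_def]
    by (subst prod(1)) (auto intro: sm simp: gauss_formula[OF z] n0)
  ultimately show "pdy L z = pdx M z"
    using mixed_partials[OF sm_X(1) open_U z] by simp
  have "pdy M z = pdy (pdy (pdx X)) z \<bullet> normal z"
    unfolding M_def[abs_def]
    by (subst prod(2)) (auto intro: sm simp: gauss_formula[OF z] n0)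
  moreover have "pdx N z = pdx (pdy (pdy X)) z \<bullet> normal z"
    unfolding N_def[abs_def]
    by (subst prod(1)) (auto intro: sm simp: gauss_formula[OF z] n0)
  moreover have "pdx (pdy (pdy X)) z = pdy (pdx (pdy X)) z"
    using mixed_partials[OF sm_X(2) open_U z] by simp
  moreover have "pdy (pdx (pdy X)) z = pdy (pdy (pdx X)) z"
    by (rule partials_cong(2)[OF open_U z mixed_X]) (auto intro: sm)
  ultimately show "pdy M z = pdx N z" by simp
qed

lemma differentiated_gauss_equation:
  assumes z: "z \<in> U"
  shows "L z * pdx N z + pdx L z * N z = 2 * M z * pdx M z"
    and "L z * pdx (pdx N) z + 2 * pdx L z * pdx N z + pdx (pdx L) z * N z
      = 2 * (pdx M z)\<^sup>2 + 2 * M z * pdx (pdx M) z"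
proof -
  note bm = bounded_bilinear_mult[where 'a=real]
  note prod = partials_bilinear[OF bm]
  note smo = smooth_on_open_bilinear[OF bm open_U]
  have first: "L z * pdx N z + pdx L z * N z = M z * pdx M z + pdx M z * M z" if z: "z \<in> U" for z
  proof -
    have "pdx (\<lambda>z. L z * N z) z = pdx (\<lambda>z. M z * M z) z"
      using gauss_equation smo[OF smooth_LMN(1,3)]
      by (intro partials_cong(1)[OF open_U z]) (auto simp: power2_eq_square)
    then show ?thesis
      using prod(1)[OF smooth_LMN(1,3) z] prod(1)[OF smooth_LMN(2,2) z] by simp
  qed
  show "L z * pdx N z + pdx L z * N z = 2 * M z * pdx M z" using first[OF z] by simp
  have dx: "((\<lambda>z. f z * pdx g z + pdx f z * g z) has_derivative
       (\<lambda>v. (f z * (fst v * pdx (pdx g) z + snd v * pdy (pdx g) z) + (fst v * pdx f z + snd v * pdy f z) * pdx g z)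
        + (pdx f z * (fst v * pdx g z + snd v * pdy g z) + (fst v * pdx (pdx f) z + snd v * pdy (pdx f) z) * g z))) (at z)"
    if "smooth_on_open f U" "smooth_on_open g U" for f g :: "real \<times> real \<Rightarrow> real"
    using smooth_on_open_has_derivative[OF that(1) z] smooth_on_open_has_derivative[OF that(2) z]
      smooth_on_open_has_derivative[OF smooth_on_open_pdx[OF that(1)] z]
      smooth_on_open_has_derivative[OF smooth_on_open_pdx[OF that(2)] z]
    unfolding real_scaleR_def
    by (intro has_derivative_add has_derivative_mult)
  have "((\<lambda>z. M z * pdx M z + pdx M z * M z) has_derivative
       (\<lambda>v. (L z * (fst v * pdx (pdx N) z + snd v * pdy (pdx N) z) + (fst v * pdx L z + snd v * pdy L z) * pdx N z)
        + (pdx L z * (fst v * pdx N z + snd v * pdy N z) + (fst v * pdx (pdx L) z + snd v * pdy (pdx L) z) * N z))) (at z)"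
    by (rule has_derivative_transform_within_open[OF dx[OF smooth_LMN(1,3)] open_U z first])
  from has_derivative_unique[OF this dx[OF smooth_LMN(2,2)]]
  have "(\<lambda>v. (L z * (fst v * pdx (pdx N) z + snd v * pdy (pdx N) z) + (fst v * pdx L z + snd v * pdy L z) * pdx N z)
        + (pdx L z * (fst v * pdx N z + snd v * pdy N z) + (fst v * pdx (pdx L) z + snd v * pdy (pdx L) z) * N z)) (1, 0)
     = (\<lambda>v. (M z * (fst v * pdx (pdx M) z + snd v * pdy (pdx M) z) + (fst v * pdx M z + snd v * pdy M z) * pdx M z)
        + (pdx M z * (fst v * pdx M z + snd v * pdy M z) + (fst v * pdx (pdx M) z + snd v * pdy (pdx M) z) * M z)) (1, 0)"
    by (rule fun_cong)
  then show "L z * pdx (pdx N) z + 2 * pdx L z * pdx N z + pdx (pdx L) z * N z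
      = 2 * (pdx M z)\<^sup>2 + 2 * M z * pdx (pdx M) z"
    by (simp add: power2_eq_square)
qed

text \<open>The line runs in the null direction of the second fundamental form at the given point. By
\<open>rank_one_along_null_line\<close> it remains null, and the second derivative of \<open>X\<close> along it, which is the
form at its direction times the normal, is zero.\<close>

lemma affine_on_line_through_curved_point:
  assumes line: "\<And>t. t \<in> {a<..<b} \<Longrightarrow> (x0 - M (x0, y0) / L (x0, y0) * (t - y0), t) \<in> U"
    and y0: "y0 \<in> {a<..<b}" and L0: "L (x0, y0) \<noteq> 0"
  shows "\<exists>m c w. \<forall>t\<in>{a<..<b}. X (x0 + m * (t - y0), t) = c + t *\<^sub>R w"
proof -
  define m where "m = M (x0, y0) / L (x0, y0)"
  define l where "l = (\<lambda>t. (x0 - m * (t - y0), t))"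
  have lU: "l t \<in> U" if "t \<in> {a<..<b}" for t
    using line[OF that] by (simp add: l_def m_def)
  have der: "((\<lambda>t. g (l t)) has_vector_derivative ((- m) *\<^sub>R pdx g (l t) + pdy g (l t))) (at t)"
    if "smooth_on_open g U" "t \<in> {a<..<b}" for g :: "real \<times> real \<Rightarrow> 'b::real_normed_vector" and t
  proof -
    have "((\<lambda>t. g (x0 - m * (t - y0), t)) has_vector_derivative
        ((- m) *\<^sub>R pdx g (x0 - m * (t - y0), t) + 1 *\<^sub>R pdy g (x0 - m * (t - y0), t))) (at t)"
      by (rule smooth_on_open_line_derivative[OF that(1)])
        (use lU[OF that(2)] in \<open>auto simp: l_def intro!: derivative_eq_intros\<close>)
    then show ?thesis by (simp add: l_def)
  qed
  have derR: "((\<lambda>t. g (l t)) has_real_derivative (- m * pdx g (l t) + pdy g (l t))) (at t)"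
    if "smooth_on_open g U" "t \<in> {a<..<b}" for g :: "real \<times> real \<Rightarrow> real" and t
    using der[OF that] by (simp add: has_real_derivative_iff_has_vector_derivative)
  have pyx: "pdy (pdx L) z = pdx (pdx M) z" "pdy (pdx M) z = pdx (pdx N) z" if "z \<in> U" for z
  proof -
    have "pdx (pdy L) z = pdx (pdx M) z" "pdx (pdy M) z = pdx (pdx N) z"
      using codazzi_equations smooth_LMN
      by (auto intro!: partials_cong(1)[OF open_U that] smooth_on_open_pdy)
    then show "pdy (pdx L) z = pdx (pdx M) z" "pdy (pdx M) z = pdx (pdx N) z"
      using mixed_partials[OF smooth_LMN(1) open_U that] mixed_partials[OF smooth_LMN(2) open_U that]
      by simp_all
  qed
  have null: "M (l t) - m * L (l t) = 0 \<and> L (l t) \<noteq> 0" if t: "t \<in> {a<..<b}" for t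
  proof (rule rank_one_along_null_line[of a b "\<lambda>t. L (l t)" "\<lambda>t. pdx M (l t) - m * pdx L (l t)"
        "\<lambda>t. M (l t) - m * L (l t)" "\<lambda>t. pdx N (l t) - 2 * m * pdx M (l t) + m\<^sup>2 * pdx L (l t)"
        "\<lambda>t. pdx (pdx N) (l t) - 2 * m * pdx (pdx M) (l t) + m\<^sup>2 * pdx (pdx L) (l t)"
        "\<lambda>t. pdx L (l t)" "\<lambda>t. N (l t) - 2 * m * M (l t) + m\<^sup>2 * L (l t)"
        "\<lambda>t. pdx (pdx L) (l t)" "\<lambda>t. pdx (pdx M) (l t) - m * pdx (pdx L) (l t)" y0])
    show "M (l y0) - m * L (l y0) = 0" "L (l y0) \<noteq> 0"
      using L0 by (simp_all add: l_def m_def)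
    show "continuous_on {a<..<b} (\<lambda>t. pdx L (l t))"
      using derR[OF smooth_on_open_pdx[OF smooth_LMN(1)]]
      by (intro continuous_at_imp_continuous_on ballI) (rule DERIV_isCont)
    fix s assume s: "s \<in> {a<..<b}"
    note z = lU[OF s]
    show "((\<lambda>t. L (l t)) has_real_derivative pdx M (l s) - m * pdx L (l s)) (at s)"
      using derR[OF smooth_LMN(1) s] codazzi_equations(1)[OF z] by simp
    show "((\<lambda>t. M (l t) - m * L (l t)) has_real_derivative
        pdx N (l s) - 2 * m * pdx M (l s) + m\<^sup>2 * pdx L (l s)) (at s)"
      using DERIV_diff[OF derR[OF smooth_LMN(2) s] DERIV_cmult[OF derR[OF smooth_LMN(1) s], of m]]
        codazzi_equations[OF z] by (simp add: algebra_simps power2_eq_square)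
    show "((\<lambda>t. pdx M (l t) - m * pdx L (l t)) has_real_derivative
        pdx (pdx N) (l s) - 2 * m * pdx (pdx M) (l s) + m\<^sup>2 * pdx (pdx L) (l s)) (at s)"
      using DERIV_diff[OF derR[OF smooth_on_open_pdx[OF smooth_LMN(2)] s]
          DERIV_cmult[OF derR[OF smooth_on_open_pdx[OF smooth_LMN(1)] s], of m]]
        pyx[OF z] by (simp add: algebra_simps power2_eq_square)
    show "L (l s) * (N (l s) - 2 * m * M (l s) + m\<^sup>2 * L (l s)) = (M (l s) - m * L (l s))\<^sup>2"
      using gauss_equation[OF z] by algebra
    show "pdx L (l s) * (N (l s) - 2 * m * M (l s) + m\<^sup>2 * L (l s))
       + L (l s) * (pdx N (l s) - 2 * m * pdx M (l s) + m\<^sup>2 * pdx L (l s))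
       = 2 * (M (l s) - m * L (l s)) * (pdx M (l s) - m * pdx L (l s))"
      using differentiated_gauss_equation(1)[OF z] by algebra
    show "pdx (pdx L) (l s) * (N (l s) - 2 * m * M (l s) + m\<^sup>2 * L (l s))
       + 2 * pdx L (l s) * (pdx N (l s) - 2 * m * pdx M (l s) + m\<^sup>2 * pdx L (l s))
       + L (l s) * (pdx (pdx N) (l s) - 2 * m * pdx (pdx M) (l s) + m\<^sup>2 * pdx (pdx L) (l s))
       = 2 * (pdx M (l s) - m * pdx L (l s))\<^sup>2
         + 2 * (M (l s) - m * L (l s)) * (pdx (pdx M) (l s) - m * pdx (pdx L) (l s))"
      using differentiated_gauss_equation(2)[OF z] by algebra
  qed (use y0 t in auto)
  have kap: "N (l t) - 2 * m * M (l t) + m\<^sup>2 * L (l t) = 0" if t: "t \<in> {a<..<b}" for t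
  proof -
    have "L (l t) * (N (l t) - 2 * m * M (l t) + m\<^sup>2 * L (l t)) = 0"
      using gauss_equation[OF lU[OF t]] null[OF t] by algebra
    then show ?thesis using null[OF t] by simp
  qed
  define W where "W = (\<lambda>t. (- m) *\<^sub>R pdx X (l t) + pdy X (l t))"
  have "(W has_vector_derivative 0) (at t)" if t: "t \<in> {a<..<b}" for t
  proof -
    note z = lU[OF t]
    have "(W has_vector_derivative ((- m) *\<^sub>R ((- m) *\<^sub>R pdx (pdx X) (l t) + pdy (pdx X) (l t))
        + ((- m) *\<^sub>R pdx (pdy X) (l t) + pdy (pdy X) (l t)))) (at t)"
      unfolding W_def
      by (intro has_vector_derivative_add bounded_linear.has_vector_derivative[OF bounded_linear_scaleR_right]
          der sm_X t)
    moreover have "(- m) *\<^sub>R ((- m) *\<^sub>R pdx (pdx X) (l t) + pdy (pdx X) (l t))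
        + ((- m) *\<^sub>R pdx (pdy X) (l t) + pdy (pdy X) (l t))
        = (N (l t) - 2 * m * M (l t) + m\<^sup>2 * L (l t)) *\<^sub>R normal (l t)"
      unfolding gauss_formula[OF z] by (simp add: vec_eq_iff algebra_simps power2_eq_square)
    ultimately show ?thesis by (simp add: kap[OF t])
  qed
  then have "\<exists>w. \<forall>t\<in>{a<..<b}. W t = w"
    using has_vector_derivative_zero_constant[of "{a<..<b}" W] has_vector_derivative_at_within
    by (metis convex_real_interval(8))
  then obtain w where w: "\<And>t. t \<in> {a<..<b} \<Longrightarrow> W t = w" by blast
  have "((\<lambda>t. X (l t) - t *\<^sub>R w) has_vector_derivative 0) (at t)" if t: "t \<in> {a<..<b}" for t
    using der[OF smooth_X t] w[OF t] unfolding W_def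
    by (auto intro!: derivative_eq_intros)
  then have "\<exists>c. \<forall>t\<in>{a<..<b}. X (l t) - t *\<^sub>R w = c"
    using has_vector_derivative_zero_constant[of "{a<..<b}" "\<lambda>t. X (l t) - t *\<^sub>R w"]
      has_vector_derivative_at_within by (metis (no_types, lifting) convex_real_interval(8))
  then obtain c where "\<forall>t\<in>{a<..<b}. X (l t) - t *\<^sub>R w = c" by blast
  then have "\<forall>t\<in>{a<..<b}. X (x0 + (- m) * (t - y0), t) = c + t *\<^sub>R w"
    by (auto simp: l_def algebra_simps)
  then show ?thesis by blast
qed

end

unbundle no cross3_syntax

section \<open>Bends of a strip\<close>

lemma stewart:
  fixes A B C :: "'a::real_inner"
  shows "(dist ((1 - w) *\<^sub>R A + w *\<^sub>R B) C)\<^sup>2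
    = (1 - w) * (dist A C)\<^sup>2 + w * (dist B C)\<^sup>2 - w * (1 - w) * (dist A B)\<^sup>2"
  by (simp add: dist_norm power2_norm_eq_inner algebra_simps inner_commute)

abbreviation open_strip :: "(real \<times> real) set"
  where "open_strip \<equiv> UNIV \<times> {0<..<1}"

lemma convex_strip: "convex strip"
  unfolding strip_def by (intro convex_Times convex_UNIV convex_real_interval)

text \<open>The lift to the strip of a smooth isometric immersion of the flat Moebius band.\<close>

locale paper_strip =
  fixes lam :: real and X :: "real \<times> real \<Rightarrow> real^3"
  assumes lam_pos: "lam > 0"
    and glide_X: "\<And>x y. 0 \<le> y \<Longrightarrow> y \<le> 1 \<Longrightarrow> X (x + lam, 1 - y) = X (x, y)"
    and smooth_interior: "smooth_on_open X open_strip"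
    and isometric_derivative: "\<And>p. p \<in> strip \<Longrightarrow>
      \<exists>D. (X has_derivative D) (at p within strip) \<and> (\<forall>u v. D u \<bullet> D v = u \<bullet> v)"
begin

lemma open_strip_subset: "open_strip \<subseteq> strip"
  by (auto simp: strip_def)

lemma open_open_strip: "open open_strip"
  by (intro open_Times) auto

sublocale flat_immersion X open_strip
proof
  show "open open_strip" by (rule open_open_strip)
  show "smooth_on_open X open_strip" by (rule smooth_interior)
  fix z assume z: "z \<in> open_strip"
  then obtain D where D: "(X has_derivative D) (at z within strip)" "\<And>u v. D u \<bullet> D v = u \<bullet> v"
    using isometric_derivative open_strip_subset by blast
  have "(X has_derivative D) (at z)"
    using D(1) at_within_open_subset[OF z open_open_strip open_strip_subset] by simp
  from has_derivative_partials[OF this]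
  show "pdx X z \<bullet> pdx X z = 1" "pdy X z \<bullet> pdy X z = 1" "pdx X z \<bullet> pdy X z = 0"
    using D(2) by simp_all
qed

lemma norm_isometric:
  fixes D :: "real \<times> real \<Rightarrow> real^3"
  assumes "\<And>u v. D u \<bullet> D v = u \<bullet> v"
  shows "norm (D u) = norm u"
  using assms by (simp add: norm_eq_sqrt_inner)

lemma contracting:
  assumes "p \<in> strip" "q \<in> strip"
  shows "dist (X p) (X q) \<le> dist p q"
proof -
  obtain D where D: "\<And>p. p \<in> strip \<Longrightarrow> (X has_derivative D p) (at p within strip)"
    "\<And>p u v. p \<in> strip \<Longrightarrow> D p u \<bullet> D p v = u \<bullet> v"
    using isometric_derivative by metis
  have "norm (X p - X q) \<le> 1 * norm (p - q)"
  proof (rule differentiable_bound[OF convex_strip D(1)])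
    fix r assume r: "r \<in> strip"
    show "onorm (D r) \<le> 1"
      by (rule onorm_le) (simp add: norm_isometric[OF D(2)[OF r]])
  qed (use assms in auto)
  then show ?thesis by (simp add: dist_norm)
qed

lemma continuous_X: "continuous_on strip X"
  unfolding continuous_on_iff
  using contracting by (metis dist_commute le_less_trans)

lemma glide_twice: "0 \<le> y \<Longrightarrow> y \<le> 1 \<Longrightarrow> X (x + 2 * lam, y) = X (x, y)"
  using glide_X[of y x] glide_X[of "1 - y" "x + lam"] by (simp add: algebra_simps)

lemma glide_even: "0 \<le> y \<Longrightarrow> y \<le> 1 \<Longrightarrow> X (x + 2 * lam * of_int k, y) = X (x, y)"
proof (induction k rule: int_induct[where k = 0])
  case (step1 i)
  then show ?case using glide_twice[of y "x + 2 * lam * of_int i"] by (simp add: algebra_simps)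
next
  case (step2 i)
  then show ?case using glide_twice[of y "x + 2 * lam * of_int (i - 1)"] by (simp add: algebra_simps)
qed simp

lemma bounded_X: obtains K where "K > 0" "\<And>p. p \<in> strip \<Longrightarrow> norm (X p) \<le> K"
proof -
  let ?R = "{0..2 * lam} \<times> {0..1::real}"
  have "compact (X ` ?R)"
    by (intro compact_continuous_image continuous_on_subset[OF continuous_X] compact_Times)
      (auto simp: strip_def)
  then obtain K where K: "K > 0" "\<And>p. p \<in> ?R \<Longrightarrow> norm (X p) \<le> K"
    using compact_imp_bounded bounded_pos by (metis image_eqI)
  have "norm (X p) \<le> K" if pS: "p \<in> strip" for p
  proof -
    obtain x y where p: "p = (x, y)" "0 \<le> y" "y \<le> 1"
      using pS by (cases p) (auto simp: strip_def)
    obtain k :: int where "of_int k \<le> x / (2 * lam)" "x / (2 * lam) < of_int k + 1"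
      by (rule that[of "\<lfloor>x / (2 * lam)\<rfloor>"]) linarith+
    then have "0 \<le> x - 2 * lam * of_int k" "x - 2 * lam * of_int k \<le> 2 * lam"
      using lam_pos by (simp_all add: field_simps)
    then have "norm (X (x - 2 * lam * of_int k, y)) \<le> K" using p by (intro K) auto
    then show ?thesis
      using glide_even[of y "x - 2 * lam * of_int k" k] p by simp
  qed
  then show ?thesis using that K(1) by blast
qed

text \<open>The case of equality in the triangle inequality, read off from Stewart's identity.\<close>

lemma affine_on_preserved_segment:
  assumes pq: "p \<in> strip" "q \<in> strip" and eq: "dist (X p) (X q) = dist p q" and w: "0 \<le> w" "w \<le> 1"
  shows "X ((1 - w) *\<^sub>R p + w *\<^sub>R q) = (1 - w) *\<^sub>R X p + w *\<^sub>R X q"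
proof -
  let ?r = "(1 - w) *\<^sub>R p + w *\<^sub>R q"
  have r: "?r \<in> strip" using convex_strip pq w by (simp add: convex_alt)
  have dp: "dist (X p) (X ?r) \<le> w * dist p q"
  proof -
    have "dist p ?r = norm (w *\<^sub>R (p - q))" by (simp add: dist_norm algebra_simps)
    then show ?thesis using contracting[OF pq(1) r] w by (simp add: dist_norm)
  qed
  have dq: "dist (X q) (X ?r) \<le> (1 - w) * dist p q"
  proof -
    have "dist q ?r = norm ((1 - w) *\<^sub>R (q - p))" by (simp add: dist_norm algebra_simps)
    also have "\<dots> = (1 - w) * dist p q" using w by (simp add: dist_norm norm_minus_commute)
    finally show ?thesis using contracting[OF pq(2) r] by simp
  qed
  have "(dist ((1 - w) *\<^sub>R X p + w *\<^sub>R X q) (X ?r))\<^sup>2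
    \<le> (1 - w) * (w * dist p q)\<^sup>2 + w * ((1 - w) * dist p q)\<^sup>2 - w * (1 - w) * (dist p q)\<^sup>2"
    unfolding stewart eq using w dp dq by (intro diff_right_mono add_mono mult_left_mono power_mono) auto
  also have "\<dots> = 0" by algebra
  finally show ?thesis by simp
qed

text \<open>The bend from \<open>(s, 0)\<close> to \<open>(s', 1)\<close>. Comparing the end points is enough, because \<open>X\<close> is contracting:
it has to be affine on the whole segment (\<open>X_on_bend\<close>). In this form the condition is closed.\<close>

definition bend :: "real \<Rightarrow> real \<Rightarrow> bool"
  where "bend s s' \<longleftrightarrow> dist (X (s, 0)) (X (s', 1)) = sqrt (1 + (s' - s)\<^sup>2)"

lemma dist_across: "dist (s, 0) (s', 1::real) = sqrt (1 + (s' - s)\<^sup>2)" for s s' :: real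
  by (simp add: dist_prod_def dist_real_def power2_commute add.commute)

lemma boundary_in_strip [simp]: "(s, 0) \<in> strip" "(s, 1) \<in> strip"
  by (simp_all add: strip_def)

lemma X_on_bend:
  assumes "bend s s'" "0 \<le> y" "y \<le> 1"
  shows "X ((1 - y) * s + y * s', y) = (1 - y) *\<^sub>R X (s, 0) + y *\<^sub>R X (s', 1)"
  using affine_on_preserved_segment[of "(s, 0)" "(s', 1)" y] assms
  by (simp add: bend_def dist_across)

lemma bend_glide: "bend (s' + lam) (s + lam) \<longleftrightarrow> bend s s'"
  using glide_X[of 1 s'] glide_X[of 0 s]
  by (simp add: bend_def dist_commute power2_commute)

lemma bend_derivative:
  assumes b: "bend s s'" and y: "0 \<le> y" "y \<le> 1"
    and D: "(X has_derivative D) (at ((1 - y) * s + y * s', y) within strip)"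
  shows "D (s' - s, 1) = X (s', 1) - X (s, 0)"
proof -
  let ?g = "\<lambda>r::real. ((1 - r) * s + r * s', r)"
  have "(?g has_vector_derivative (s' - s, 1)) (at y within {0..1})"
    by (intro has_vector_derivative_Pair)
      (auto intro!: derivative_eq_intros simp flip: has_real_derivative_iff_has_vector_derivative)
  moreover have "?g ` {0..1} \<subseteq> strip" by (auto simp: strip_def)
  ultimately have "((X \<circ> ?g) has_vector_derivative D (s' - s, 1)) (at y within {0..1})"
    using D by (intro vector_derivative_diff_chain_within) (auto intro: has_derivative_subset)
  moreover have "((X \<circ> ?g) has_vector_derivative (X (s', 1) - X (s, 0))) (at y within {0..1})"
  proof (rule has_vector_derivative_transform)
    show "((\<lambda>r. (1 - r) *\<^sub>R X (s, 0) + r *\<^sub>R X (s', 1)) has_vector_derivative (X (s', 1) - X (s, 0)))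
      (at y within {0..1})"
      by (auto intro!: derivative_eq_intros)
  qed (use y X_on_bend[OF b] in auto)
  ultimately show ?thesis
    using y by (intro vector_derivative_unique_within_closed_interval[of 0 1 y "X \<circ> ?g"]) auto
qed

text \<open>The derivative of \<open>X\<close> at the midpoint maps the direction of the segment to \<open>w\<close> and preserves its length.\<close>

lemma bend_of_affine:
  assumes aff: "\<And>t. t \<in> {0<..<1} \<Longrightarrow> X ((1 - t) * s + t * s', t) = c + t *\<^sub>R w"
  shows "bend s s'"
proof -
  let ?g = "\<lambda>r::real. ((1 - r) * s + r * s', r)"
  have cont: "continuous_on {0..1} (\<lambda>r. X (?g r) - r *\<^sub>R w)"
    by (intro continuous_intros continuous_on_compose2[OF continuous_X]) (auto simp: strip_def)
  have *: "X (?g r) - r *\<^sub>R w = c" if "r \<in> {0..1}" for r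
    by (rule continuous_constant_on_closure[of "{0<..<1}"]) (use cont that aff in auto)
  have ends: "X (s, 0) = c" "X (s', 1) = c + w"
    using *[of 0] *[of 1] by (simp_all add: algebra_simps)
  obtain D where D: "(X has_derivative D) (at (?g (1/2)) within strip)" "\<And>u v. D u \<bullet> D v = u \<bullet> v"
    using isometric_derivative[of "?g (1/2)"] by (auto simp: strip_def)
  have "(?g has_vector_derivative (s' - s, 1)) (at (1/2) within {0..1})"
    by (intro has_vector_derivative_Pair)
      (auto intro!: derivative_eq_intros simp flip: has_real_derivative_iff_has_vector_derivative)
  moreover have "?g ` {0..1} \<subseteq> strip" by (auto simp: strip_def)
  ultimately have "((X \<circ> ?g) has_vector_derivative D (s' - s, 1)) (at (1/2) within {0..1})"
    using D by (intro vector_derivative_diff_chain_within) (auto intro: has_derivative_subset)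
  moreover have "((X \<circ> ?g) has_vector_derivative w) (at (1/2) within {0..1})"
  proof (rule has_vector_derivative_transform)
    show "((\<lambda>r. c + r *\<^sub>R w) has_vector_derivative w) (at (1/2) within {0..1})"
      by (auto intro!: derivative_eq_intros)
  qed (use * in \<open>auto simp: algebra_simps\<close>)
  ultimately have "D (s' - s, 1) = w"
    by (intro vector_derivative_unique_within_closed_interval[of 0 1 "1/2" "X \<circ> ?g"]) auto
  then have "norm w = norm (s' - s, 1::real)" using norm_isometric[OF D(2)] by metis
  then show ?thesis
    by (simp add: bend_def ends dist_norm norm_Pair add.commute)
qed

text \<open>At the common point of the two bends the derivative of \<open>X\<close> takes both directions to those of the images.
So \<open>X\<close> coincides at all four end points with one affine isometry, then also on the boundary segments
between them, and distances between points of these two segments are preserved.\<close>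

lemma crossing_bends_span_flat_piece:
  assumes b: "bend s s'" "bend t t'" and st: "s \<le> t" "t' \<le> s'"
    and u: "u \<in> {s..t}" "u' \<in> {t'..s'}"
  shows "bend u u'"
proof (cases "s = t \<and> s' = t'")
  case True
  then show ?thesis using b u by auto
next
  case False
  define d where "d = (t - s) + (s' - t')"
  \<comment> \<open>the height at which the two bends meet\<close>
  define y where "y = (t - s) / d"
  have d: "d > 0" using False st by (auto simp: d_def)
  have y: "0 \<le> y" "y \<le> 1" using d st by (auto simp: y_def d_def divide_simps)
  define o' where "o' = ((1 - y) * s + y * s', y)"
  have yd: "y * d = t - s" using d by (simp add: y_def)
  have o2: "o' = ((1 - y) * t + y * t', y)"
    using yd by (simp add: o'_def d_def algebra_simps)
  have "o' \<in> strip" using y by (simp add: o'_def strip_def)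
  then obtain D where D: "(X has_derivative D) (at o' within strip)" "\<And>u v. D u \<bullet> D v = u \<bullet> v"
    using isometric_derivative by blast
  interpret D: linear D using D(1) has_derivative_linear by blast
  have corners: "X (r, 0) = X o' + D ((r, 0) - o') \<and> X (r', 1) = X o' + D ((r', 1) - o')"
    if br: "bend r r'" and o: "o' = ((1 - y) * r + y * r', y)" for r r'
  proof -
    have De: "D (r' - r, 1) = X (r', 1) - X (r, 0)"
      using bend_derivative[OF br y] D(1) o by simp
    have "(r, 0) - o' = (- y) *\<^sub>R (r' - r, 1)" "(r', 1) - o' = (1 - y) *\<^sub>R (r' - r, 1)"
      by (simp_all add: o algebra_simps)
    then have ends: "D ((r, 0) - o') = (- y) *\<^sub>R (X (r', 1) - X (r, 0))"
      "D ((r', 1) - o') = (1 - y) *\<^sub>R (X (r', 1) - X (r, 0))"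
      using De by (simp_all only: D.scale)
    have "X o' = (1 - y) *\<^sub>R X (r, 0) + y *\<^sub>R X (r', 1)"
      using X_on_bend[OF br y] o by simp
    then show ?thesis unfolding ends by (simp add: algebra_simps)
  qed
  have c1: "X (s, 0) = X o' + D ((s, 0) - o')" "X (s', 1) = X o' + D ((s', 1) - o')"
    using corners[OF b(1)] by (simp_all add: o'_def)
  have c2: "X (t, 0) = X o' + D ((t, 0) - o')" "X (t', 1) = X o' + D ((t', 1) - o')"
    using corners[OF b(2) o2] by simp_all
  have between: "X ((1 - w) *\<^sub>R p + w *\<^sub>R q) = X o' + D (((1 - w) *\<^sub>R p + w *\<^sub>R q) - o')"
    if "p \<in> strip" "q \<in> strip" "X p = X o' + D (p - o')" "X q = X o' + D (q - o')" "0 \<le> w" "w \<le> 1" for p q w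
  proof -
    have "dist (X p) (X q) = norm (D (p - q))"
      unfolding that(3,4) by (simp add: dist_norm D.diff)
    then have "dist (X p) (X q) = dist p q" by (simp add: norm_isometric[OF D(2)] dist_norm)
    from affine_on_preserved_segment[OF that(1,2) this that(5,6)] show ?thesis
      unfolding that(3,4) by (simp add: D.diff D.add D.scale algebra_simps)
  qed
  have conv: "\<exists>w. 0 \<le> w \<and> w \<le> 1 \<and> x = (1 - w) * l + w * r" if "x \<in> {l..r}" for x l r :: real
  proof (cases "l = r")
    case True
    then show ?thesis using that by (intro exI[of _ 0]) auto
  next
    case False
    define w where "w = (x - l) / (r - l)"
    have "w * (r - l) = x - l" using False by (simp add: w_def)
    then have "x = (1 - w) * l + w * r" by (simp add: algebra_simps)
    moreover have "0 \<le> w" "w \<le> 1" using False that by (auto simp: w_def divide_simps)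
    ultimately show ?thesis by blast
  qed
  obtain w where w: "0 \<le> w" "w \<le> 1" "u = (1 - w) * s + w * t" using conv[OF u(1)] by blast
  obtain w' where w': "0 \<le> w'" "w' \<le> 1" "u' = (1 - w') * t' + w' * s'" using conv[OF u(2)] by blast
  have Xu: "X (u, 0) = X o' + D ((u, 0) - o')"
    using between[OF _ _ c1(1) c2(1) w(1,2)] w(3) by simp
  have Xu': "X (u', 1) = X o' + D ((u', 1) - o')"
    using between[OF _ _ c2(2) c1(2) w'(1,2)] w'(3) by simp
  have "dist (X (u, 0)) (X (u', 1)) = norm (D ((u, 0) - (u', 1)))"
    unfolding Xu Xu' by (simp add: dist_norm del: diff_Pair flip: D.diff)
  also have "\<dots> = dist (u, 0) (u', 1::real)" by (simp add: norm_isometric[OF D(2)] dist_norm)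
  finally show ?thesis by (simp add: bend_def dist_across)
qed

lemma bounded_lean: obtains K where "\<And>s s'. bend s s' \<Longrightarrow> \<bar>s' - s\<bar> \<le> K"
proof -
  obtain K where K: "\<And>p. p \<in> strip \<Longrightarrow> norm (X p) \<le> K" using bounded_X by metis
  have "\<bar>s' - s\<bar> \<le> 2 * K" if "bend s s'" for s s'
  proof -
    have "\<bar>s' - s\<bar> = sqrt ((s' - s)\<^sup>2)" by simp
    also have "\<dots> \<le> sqrt (1 + (s' - s)\<^sup>2)" by (intro real_sqrt_le_mono) simp
    also have "\<dots> = dist (X (s, 0)) (X (s', 1))" using that by (simp add: bend_def)
    also have "\<dots> \<le> norm (X (s, 0)) + norm (X (s', 1))"
      unfolding dist_norm by (rule norm_triangle_ineq4)
    also have "\<dots> \<le> 2 * K" using K[of "(s, 0)"] K[of "(s', 1)"] by simp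
    finally show ?thesis .
  qed
  then show ?thesis using that by blast
qed

end

section \<open>A bend through every point of the centre line\<close>

context paper_strip
begin

lemma bend_through_curved_point:
  assumes xy: "0 < y" "y < 1" and L: "L (x, y) \<noteq> 0"
  shows "\<exists>s s'. bend s s' \<and> (1 - y) * s + y * s' = x"
proof -
  have "\<exists>m c w. \<forall>t\<in>{0<..<1}. X (x + m * (t - y), t) = c + t *\<^sub>R w"
    by (rule affine_on_line_through_curved_point) (use xy L in auto)
  then obtain m c w where aff: "\<And>t. t \<in> {0<..<1} \<Longrightarrow> X (x + m * (t - y), t) = c + t *\<^sub>R w"
    by blast
  have "bend (x - m * y) (x + m * (1 - y))"
  proof (rule bend_of_affine)
    fix t :: real assume "t \<in> {0<..<1}"
    moreover have "(1 - t) * (x - m * y) + t * (x + m * (1 - y)) = x + m * (t - y)" by algebra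
    ultimately show "X ((1 - t) * (x - m * y) + t * (x + m * (1 - y)), t) = c + t *\<^sub>R w"
      using aff by simp
  qed
  moreover have "(1 - y) * (x - m * y) + y * (x + m * (1 - y)) = x" by (simp add: algebra_simps)
  ultimately show ?thesis by blast
qed

text \<open>Closedness survives the projection because the leans \<open>s' - s\<close> of bends lie in a compact interval.\<close>

lemma closed_bend_midpoints: "closed {x. \<exists>s s'. bend s s' \<and> s + s' = 2 * x}"
proof -
  obtain K where K: "\<And>s s'. bend s s' \<Longrightarrow> \<bar>s' - s\<bar> \<le> K" using bounded_lean by blast
  let ?T = "{z. dist (X (snd z - fst z / 2, 0)) (X (snd z + fst z / 2, 1)) = sqrt (1 + (fst z)\<^sup>2)}"
  have "closed ?T"
    by (intro closed_Collect_eq continuous_intros continuous_on_compose2[OF continuous_X]) auto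
  from closed_compact_projection[OF compact_Icc[of "-K" K] this]
  have "closed {x. \<exists>d. d \<in> {-K..K} \<and> bend (x - d / 2) (x + d / 2)}"
    by (simp add: bend_def)
  moreover have "(\<exists>d. d \<in> {-K..K} \<and> bend (x - d / 2) (x + d / 2)) \<longleftrightarrow> (\<exists>s s'. bend s s' \<and> s + s' = 2 * x)" for x
  proof
    assume "\<exists>d. d \<in> {-K..K} \<and> bend (x - d / 2) (x + d / 2)"
    then obtain d where "bend (x - d / 2) (x + d / 2)" by blast
    then show "\<exists>s s'. bend s s' \<and> s + s' = 2 * x"
      by (intro exI[of _ "x - d / 2"] exI[of _ "x + d / 2"]) simp
  next
    assume "\<exists>s s'. bend s s' \<and> s + s' = 2 * x"
    then obtain s s' where b: "bend s s'" and x: "s + s' = 2 * x" by blast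
    have "x - (s' - s) / 2 = s" "x + (s' - s) / 2 = s'" using x by (simp_all add: field_simps)
    then show "\<exists>d. d \<in> {-K..K} \<and> bend (x - d / 2) (x + d / 2)"
      using K[OF b] b by (intro exI[of _ "s' - s"]) auto
  qed
  ultimately show ?thesis by simp
qed

text \<open>If \<open>L\<close> is zero, so is \<open>M\<close> by the Gauss equation, and these two coefficients govern the derivatives of
\<open>X\<^sub>x\<close>.\<close>

lemma horizontal_derivative_constant_where_L_vanishes:
  assumes Q: "convex Q" "open Q" "Q \<subseteq> open_strip" and L0: "\<And>z. z \<in> Q \<Longrightarrow> L z = 0"
  obtains e where "\<And>z. z \<in> Q \<Longrightarrow> pdx X z = e"
proof -
  have "\<exists>e. \<forall>z\<in>Q. pdx X z = e"
  proof (rule has_derivative_zero_constant[OF Q(1)])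
    fix z assume z: "z \<in> Q"
    then have zU: "z \<in> open_strip" using Q by blast
    have "M z = 0" using gauss_equation[OF zU] L0[OF z] by simp
    then have "pdx (pdx X) z = 0" "pdy (pdx X) z = 0"
      using gauss_formula[OF zU] L0[OF z] by simp_all
    then show "(pdx X has_derivative (\<lambda>h. 0)) (at z within Q)"
      using smooth_on_open_has_derivative[OF sm_X(1) zU] by (simp add: has_derivative_at_withinI)
  qed
  then show ?thesis using that by blast
qed

lemma horizontal_derivative:
  assumes "0 < y" "y < 1"
  shows "((\<lambda>x. X (x, y)) has_vector_derivative pdx X (x, y)) (at x)"
    and "((\<lambda>x. pdx X (x, y)) has_vector_derivative pdx (pdx X) (x, y)) (at x)"
  using smooth_on_open_line_derivative[of X open_strip "\<lambda>t. t" x "\<lambda>t. y" 1 0]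
    smooth_on_open_line_derivative[of "pdx X" open_strip "\<lambda>t. t" x "\<lambda>t. y" 1 0]
    smooth_X sm_X assms by auto

text \<open>Without bends \<open>L\<close> would vanish along the centre line. Then \<open>X\<close> would map this line to a straight line,
but the image of \<open>X\<close> is bounded.\<close>

lemma ex_bend: "\<exists>s s'. bend s s'"
proof (rule ccontr)
  assume no: "\<nexists>s s'. bend s s'"
  define y :: real where "y = 1 / 2"
  have y: "0 < y" "y < 1" by (simp_all add: y_def)
  have L0: "L (x, y) = 0" for x using bend_through_curved_point[OF y] no by blast
  have "((\<lambda>x. pdx X (x, y)) has_vector_derivative 0) (at x)" for x
    using horizontal_derivative(2)[OF y, of x] gauss_formula(1)[of "(x, y)"] L0 y by simp
  then obtain e where e: "\<And>x. pdx X (x, y) = e"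
    using has_vector_derivative_zero_constant[of UNIV "\<lambda>x. pdx X (x, y)"] by auto
  have "((\<lambda>x. X (x, y) - x *\<^sub>R e) has_vector_derivative 0) (at x)" for x
    using horizontal_derivative(1)[OF y, of x] unfolding e by (auto intro!: derivative_eq_intros)
  then obtain c where c: "\<And>x. X (x, y) - x *\<^sub>R e = c"
    using has_vector_derivative_zero_constant[of UNIV "\<lambda>x. X (x, y) - x *\<^sub>R e"] by auto
  have "norm e = 1" using isometric_X(1)[of "(0, y)"] y e by (simp add: norm_eq_sqrt_inner)
  obtain K where K: "\<And>p. p \<in> strip \<Longrightarrow> norm (X p) \<le> K" using bounded_X by metis
  have X: "X (x, y) = c + x *\<^sub>R e" for x using c[of x] by (simp add: algebra_simps)
  have "\<bar>x\<bar> \<le> K + norm c" for x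
  proof -
    have "\<bar>x\<bar> = norm (X (x, y) - c)" using X \<open>norm e = 1\<close> by simp
    also have "\<dots> \<le> norm (X (x, y)) + norm c" by (rule norm_triangle_ineq4)
    also have "\<dots> \<le> K + norm c" using K y by (auto simp: strip_def)
    finally show ?thesis .
  qed
  from this[of "K + norm c + 1"] show False by linarith
qed

lemma bend_midpoints_unbounded:
  "\<exists>s s'. bend s s' \<and> s + s' < x" "\<exists>s s'. bend s s' \<and> s + s' > x"
proof -
  obtain s s' where b: "bend s s'" using ex_bend by blast
  have up: "\<exists>t t'. bend t t' \<and> t + t' = s + s' + 2 * lam * real n" for n
  proof (induction n)
    case (Suc n)
    then obtain t t' where "bend t t'" "t + t' = s + s' + 2 * lam * real n" by blast
    then have "bend (t' + lam) (t + lam)" "(t' + lam) + (t + lam) = s + s' + 2 * lam * real (Suc n)"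
      using bend_glide[of t' t] by (simp_all add: algebra_simps)
    then show ?case by blast
  qed (use b in auto)
  have down: "\<exists>t t'. bend t t' \<and> t + t' = s + s' - 2 * lam * real n" for n
  proof (induction n)
    case (Suc n)
    then obtain t t' where "bend t t'" "t + t' = s + s' - 2 * lam * real n" by blast
    then have "bend (t' - lam) (t - lam)" "(t' - lam) + (t - lam) = s + s' - 2 * lam * real (Suc n)"
      using bend_glide[of "t - lam" "t' - lam"] by (simp_all add: algebra_simps)
    then show ?case by blast
  qed (use b in auto)
  obtain n where n: "(s + s' - x) / (2 * lam) < real n" using reals_Archimedean2 by blast
  obtain n' where n': "(x - s - s') / (2 * lam) < real n'" using reals_Archimedean2 by blast
  show "\<exists>s s'. bend s s' \<and> s + s' < x" "\<exists>s s'. bend s s' \<and> s + s' > x"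
    using down[of n] up[of n'] n n' lam_pos by (force simp: field_simps)+
qed

text \<open>Suppose that \<open>p\<close> lies in a gap between \<open>q0\<close> and \<open>q1\<close> of the closed set of midpoints of bends, and take
bends \<open>b0\<close>, \<open>b1\<close> through the ends of the gap. No bend crosses \<open>b0\<close> or \<open>b1\<close>, since the flat piece spanned
by the two would reach into the gap. Therefore no bend enters the open region \<open>Q\<close> between \<open>b0\<close> and \<open>b1\<close>,
and \<open>L\<close> vanishes there. Hence \<open>X\<^sub>x\<close> is a constant vector \<open>e\<close> on \<open>Q\<close>, and \<open>X (x, y) - x *\<^sub>R e\<close> depends on \<open>y\<close>
only. This function of \<open>y\<close> is affine, because it is so along \<open>b0\<close>. So \<open>X\<close> is affine on \<open>Q\<close>, and the
segment through \<open>p\<close> that interpolates between \<open>b0\<close> and \<open>b1\<close> is a bend: a contradiction.\<close>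

lemma bend_through_midpoint: "\<exists>s s'. bend s s' \<and> s + s' = 2 * p"
proof (rule ccontr)
  define W where "W = {x. \<exists>s s'. bend s s' \<and> s + s' = 2 * x}"
  assume "\<nexists>s s'. bend s s' \<and> s + s' = 2 * p"
  then have pW: "p \<notin> W" by (simp add: W_def)
  have clW: "closed W" unfolding W_def by (rule closed_bend_midpoints)
  have inW: "(s + s') / 2 \<in> W" if "bend s s'" for s s'
  proof -
    have "s + s' = 2 * ((s + s') / 2)" by simp
    with that show ?thesis unfolding W_def by blast
  qed
  obtain a where a: "a \<in> W" "a < p"
    using bend_midpoints_unbounded(1)[of "2 * p"] inW by (metis (no_types) less_divide_eq_numeral1(1) mult.commute divide_less_eq_numeral1(1))
  obtain b where b: "b \<in> W" "p < b"
    using bend_midpoints_unbounded(2)[of "2 * p"] inW by (metis (no_types) less_divide_eq_numeral1(1) mult.commute)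
  have "\<exists>q\<in>W \<inter> {a..p}. \<forall>x\<in>W \<inter> {a..p}. x \<le> q"
    by (rule compact_attains_sup) (use clW a in \<open>auto intro: closed_Int_compact\<close>)
  then obtain q0 where q0: "q0 \<in> W" "q0 \<in> {a..p}" "\<And>x. x \<in> W \<Longrightarrow> x \<in> {a..p} \<Longrightarrow> x \<le> q0" by blast
  have "\<exists>q\<in>W \<inter> {p..b}. \<forall>x\<in>W \<inter> {p..b}. q \<le> x"
    by (rule compact_attains_inf) (use clW b in \<open>auto intro: closed_Int_compact\<close>)
  then obtain q1 where q1: "q1 \<in> W" "q1 \<in> {p..b}" "\<And>x. x \<in> W \<Longrightarrow> x \<in> {p..b} \<Longrightarrow> q1 \<le> x" by blast
  have q0p: "q0 < p" and q1p: "p < q1"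
    using q0(1,2) q1(1,2) pW by (auto simp: less_le)
  have gap: "x \<notin> W" if "q0 < x" "x < q1" for x
  proof
    assume "x \<in> W"
    then show False using q0(2) q0(3)[of x] q1(2) q1(3)[of x] that by (cases "x \<le> p") auto
  qed
  have gapb: "s + s' \<le> 2 * q0 \<or> 2 * q1 \<le> s + s'" if "bend s s'" for s s'
    using gap[of "(s + s') / 2"] inW[OF that] by force
  obtain s0 s0' where b0: "bend s0 s0'" "s0 + s0' = 2 * q0" using q0(1) by (auto simp: W_def)
  obtain s1 s1' where b1: "bend s1 s1'" "s1 + s1' = 2 * q1" using q1(1) by (auto simp: W_def)
  \<comment> \<open>A bend crossing \<open>b0\<close> lets one end of \<open>b0\<close> move by a small \<open>\<delta>\<close>, which puts the midpoint into the gap.\<close>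
  have nc0: "\<not> (r < s0 \<and> s0' < r')" "\<not> (s0 < r \<and> r' < s0')" if br: "bend r r'" for r r'
  proof -
    show "\<not> (r < s0 \<and> s0' < r')"
    proof
      assume c: "r < s0 \<and> s0' < r'"
      define \<delta> where "\<delta> = min (r' - s0') (p - q0)"
      have \<delta>: "\<delta> > 0" "\<delta> \<le> r' - s0'" "\<delta> \<le> p - q0" using c q0p by (auto simp: \<delta>_def)
      have "bend s0 (s0' + \<delta>)"
        by (rule crossing_bends_span_flat_piece[OF br b0(1)]) (use c \<delta> in auto)
      then show False using gapb[of s0 "s0' + \<delta>"] b0(2) \<delta> q0p q1p by auto
    qed
    show "\<not> (s0 < r \<and> r' < s0')"
    proof
      assume c: "s0 < r \<and> r' < s0'"
      define \<delta> where "\<delta> = min (r - s0) (p - q0)"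
      have \<delta>: "\<delta> > 0" "\<delta> \<le> r - s0" "\<delta> \<le> p - q0" using c q0p by (auto simp: \<delta>_def)
      have "bend (s0 + \<delta>) s0'"
        by (rule crossing_bends_span_flat_piece[OF b0(1) br]) (use c \<delta> in auto)
      then show False using gapb[of "s0 + \<delta>" "s0'"] b0(2) \<delta> q0p q1p by auto
    qed
  qed
  have nc1: "\<not> (r < s1 \<and> s1' < r')" "\<not> (s1 < r \<and> r' < s1')" if br: "bend r r'" for r r'
  proof -
    show "\<not> (r < s1 \<and> s1' < r')"
    proof
      assume c: "r < s1 \<and> s1' < r'"
      define \<delta> where "\<delta> = min (s1 - r) (q1 - p)"
      have \<delta>: "\<delta> > 0" "\<delta> \<le> s1 - r" "\<delta> \<le> q1 - p" using c q1p by (auto simp: \<delta>_def)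
      have "bend (s1 - \<delta>) s1'"
        by (rule crossing_bends_span_flat_piece[OF br b1(1)]) (use c \<delta> in auto)
      then show False using gapb[of "s1 - \<delta>" "s1'"] b1(2) \<delta> q0p q1p by auto
    qed
    show "\<not> (s1 < r \<and> r' < s1')"
    proof
      assume c: "s1 < r \<and> r' < s1'"
      define \<delta> where "\<delta> = min (s1' - r') (q1 - p)"
      have \<delta>: "\<delta> > 0" "\<delta> \<le> s1' - r'" "\<delta> \<le> q1 - p" using c q1p by (auto simp: \<delta>_def)
      have "bend s1 (s1' - \<delta>)"
        by (rule crossing_bends_span_flat_piece[OF b1(1) br]) (use c \<delta> in auto)
      then show False using gapb[of s1 "s1' - \<delta>"] b1(2) \<delta> q0p q1p by auto
    qed
  qed
  have s01: "s0 \<le> s1" "s0' \<le> s1'"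
    using nc0[OF b1(1)] b0(2) b1(2) q0p q1p by linarith+
  define l0 where "l0 = (\<lambda>t. (1 - t) * s0 + t * s0')"
  define l1 where "l1 = (\<lambda>t. (1 - t) * s1 + t * s1')"
  define Q where "Q = {z. 0 < snd z \<and> snd z < 1 \<and> l0 (snd z) < fst z \<and> fst z < l1 (snd z)}"
  have Qsub: "Q \<subseteq> open_strip" by (auto simp: Q_def)
  have "open Q"
    unfolding Q_def l0_def l1_def by (intro open_Collect_conj open_Collect_less continuous_intros)
  have "convex Q"
  proof -
    have half: "convex {z::real \<times> real. c < \<alpha> * fst z + \<beta> * snd z}" for c \<alpha> \<beta>
      using convex_halfspace_gt[of c "(\<alpha>, \<beta>)"] by (simp add: inner_prod_def)
    have "Q = {z. 0 < 0 * fst z + 1 * snd z} \<inter> {z. - 1 < 0 * fst z + (- 1) * snd z}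
        \<inter> {z. s0 < 1 * fst z + (s0 - s0') * snd z} \<inter> {z. - s1 < (- 1) * fst z + (s1' - s1) * snd z}"
      by (auto simp: Q_def l0_def l1_def algebra_simps)
    then show ?thesis by (simp only:) (intro convex_Int half)
  qed
  have L0: "L z = 0" if z: "z \<in> Q" for z
  proof (rule ccontr)
    assume nz: "L z \<noteq> 0"
    obtain x y where xy: "z = (x, y)" by (cases z)
    have y: "0 < y" "y < 1" "l0 y < x" "x < l1 y" using z by (auto simp: Q_def xy)
    obtain r r' where r: "bend r r'" "(1 - y) * r + y * r' = x"
      using bend_through_curved_point[OF y(1,2)] nz xy by blast
    have d0: "(1 - y) * (r - s0) + y * (r' - s0') > 0"
      using y(3) r(2) by (simp add: l0_def algebra_simps)
    have above: "r + r' > 2 * q0"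
    proof (rule ccontr)
      assume "\<not> r + r' > 2 * q0"
      then have "r - s0 \<le> 0 \<and> r' - s0' \<le> 0" using nc0[OF r(1)] b0(2) by argo
      then have "(1 - y) * (r - s0) \<le> 0 \<and> y * (r' - s0') \<le> 0"
        using y by (simp add: mult_nonneg_nonpos)
      then show False using d0 by linarith
    qed
    have d1: "(1 - y) * (s1 - r) + y * (s1' - r') > 0"
      using y(4) r(2) by (simp add: l1_def algebra_simps)
    have "r + r' < 2 * q1"
    proof (rule ccontr)
      assume "\<not> r + r' < 2 * q1"
      then have "s1 - r \<le> 0 \<and> s1' - r' \<le> 0" using nc1[OF r(1)] b1(2) by argo
      then have "(1 - y) * (s1 - r) \<le> 0 \<and> y * (s1' - r') \<le> 0"
        using y by (simp add: mult_nonneg_nonpos)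
      then show False using d1 by linarith
    qed
    then show False using above gapb[OF r(1)] by linarith
  qed
  obtain e where e: "\<And>z. z \<in> Q \<Longrightarrow> pdx X z = e"
    using horizontal_derivative_constant_where_L_vanishes[OF \<open>convex Q\<close> \<open>open Q\<close> Qsub L0] by blast
  \<comment> \<open>The constant of each horizontal slice is identified at its left end, which lies on \<open>b0\<close>.\<close>
  have slice: "X (x, y) - x *\<^sub>R e = X (l0 y, y) - l0 y *\<^sub>R e"
    if y: "0 < y" "y < 1" and x: "l0 y < x" "x < l1 y" for x y
  proof -
    have der: "((\<lambda>x. X (x, y) - x *\<^sub>R e) has_vector_derivative 0) (at x)" if "x \<in> {l0 y<..<l1 y}" for x
    proof -
      have "pdx X (x, y) = e" using that y by (intro e) (auto simp: Q_def)
      then show ?thesis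
        using horizontal_derivative(1)[OF y, of x] by (auto intro!: derivative_eq_intros)
    qed
    obtain c where c: "\<And>x. x \<in> {l0 y<..<l1 y} \<Longrightarrow> X (x, y) - x *\<^sub>R e = c"
      using has_vector_derivative_zero_constant[of "{l0 y<..<l1 y}" "\<lambda>x. X (x, y) - x *\<^sub>R e"]
        has_vector_derivative_at_within[OF der] by auto
    have "continuous_on UNIV (\<lambda>x. X (x, y) - x *\<^sub>R e)"
      using y by (intro continuous_intros continuous_on_compose2[OF continuous_X]) (auto simp: strip_def)
    then have "continuous_on (closure {l0 y<..<l1 y}) (\<lambda>x. X (x, y) - x *\<^sub>R e)"
      using continuous_on_subset by blast
    then have "X (l0 y, y) - l0 y *\<^sub>R e = c"
      by (rule continuous_constant_on_closure) (use c x in auto)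
    then show ?thesis using c[of x] x by simp
  qed
  \<comment> \<open>the interpolation parameter for which the midpoint is \<open>p\<close>\<close>
  define w where "w = (p - q0) / (q1 - q0)"
  have w: "0 < w" "w < 1" using q0p q1p by (auto simp: w_def)
  have wq: "w * (q1 - q0) = p - q0" using q0p q1p by (simp add: w_def)
  define u where "u = (1 - w) * s0 + w * s1"
  define u' where "u' = (1 - w) * s0' + w * s1'"
  have "bend u u'"
  proof (rule bend_of_affine)
    fix t :: real assume t: "t \<in> {0<..<1}"
    have lw: "(1 - t) * u + t * u' = l0 t + w * (l1 t - l0 t)"
      by (simp add: u_def u'_def l0_def l1_def algebra_simps)
    have "l0 t < l1 t"
    proof -
      have "l1 t - l0 t = (1 - t) * (s1 - s0) + t * (s1' - s0')"
        by (simp add: l0_def l1_def algebra_simps)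
      moreover have "s0 < s1 \<or> s0' < s1'" using b0(2) b1(2) q0p q1p by linarith
      ultimately show ?thesis using s01 t
        by (smt (verit) greaterThanLessThan_iff mult_nonneg_nonneg mult_pos_pos)
    qed
    then have "0 < w * (l1 t - l0 t)" "w * (l1 t - l0 t) < l1 t - l0 t"
      using w mult_strict_right_mono[of w 1 "l1 t - l0 t"] by simp_all
    then have "l0 t < (1 - t) * u + t * u'" "(1 - t) * u + t * u' < l1 t"
      unfolding lw by linarith+
    from slice[OF _ _ this] t
    have "X ((1 - t) * u + t * u', t) = X (l0 t, t) + ((1 - t) * u + t * u' - l0 t) *\<^sub>R e"
      by (simp add: algebra_simps)
    also have "X (l0 t, t) = (1 - t) *\<^sub>R X (s0, 0) + t *\<^sub>R X (s0', 1)"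
      using X_on_bend[OF b0(1), of t] t by (simp add: l0_def)
    also have "\<dots> + ((1 - t) * u + t * u' - l0 t) *\<^sub>R e
      = (X (s0, 0) + (u - s0) *\<^sub>R e) + t *\<^sub>R (X (s0', 1) - X (s0, 0) + (u' - u - (s0' - s0)) *\<^sub>R e)"
      by (simp add: l0_def algebra_simps)
    finally show "X ((1 - t) * u + t * u', t)
      = (X (s0, 0) + (u - s0) *\<^sub>R e) + t *\<^sub>R (X (s0', 1) - X (s0, 0) + (u' - u - (s0' - s0)) *\<^sub>R e)" .
  qed
  moreover have "u + u' = 2 * p"
  proof -
    have "u + u' = (1 - w) * (s0 + s0') + w * (s1 + s1')" by (simp add: u_def u'_def algebra_simps)
    also have "\<dots> = 2 * q0 + 2 * (w * (q1 - q0))" unfolding b0(2) b1(2) by (simp add: algebra_simps)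
    finally show ?thesis unfolding wq by simp
  qed
  ultimately show False using inW[of u u'] pW by simp
qed

end

section \<open>A continuous family of bends\<close>

context paper_strip
begin

text \<open>The lean of a bend is its horizontal displacement. Bends with \<open>s + s' = \<tau>\<close> are those through the centre
point \<open>(\<tau> / 2, 1 / 2)\<close>.\<close>

definition min_lean :: "real \<Rightarrow> real"
  where "min_lean \<tau> = Inf {d. bend ((\<tau> - d) / 2) ((\<tau> + d) / 2)}"

lemma bend_leans: "closed {d. bend ((\<tau> - d) / 2) ((\<tau> + d) / 2)}" (is "closed ?D")
  "{d. bend ((\<tau> - d) / 2) ((\<tau> + d) / 2)} \<noteq> {}"
  "bdd_below {d. bend ((\<tau> - d) / 2) ((\<tau> + d) / 2)}"
proof -
  show "closed ?D"
    unfolding bend_def by (intro closed_Collect_eq continuous_intros continuous_on_compose2[OF continuous_X]) auto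
  obtain s s' where b: "bend s s'" "s + s' = 2 * (\<tau> / 2)" using bend_through_midpoint by blast
  then have e: "(\<tau> - (s' - s)) / 2 = s" "(\<tau> + (s' - s)) / 2 = s'" by (simp_all add: field_simps)
  have "s' - s \<in> ?D" unfolding mem_Collect_eq e by (rule b(1))
  then show "?D \<noteq> {}" by blast
  obtain K where K: "\<And>s s'. bend s s' \<Longrightarrow> \<bar>s' - s\<bar> \<le> K" using bounded_lean by blast
  have "- K \<le> d" if "d \<in> ?D" for d
  proof -
    have "(\<tau> + d) / 2 - (\<tau> - d) / 2 = d" by (simp add: field_simps)
    then show ?thesis using K[of "(\<tau> - d) / 2" "(\<tau> + d) / 2"] that by simp
  qed
  then show "bdd_below ?D" by (meson bdd_belowI)
qed

lemma min_lean_bend: "bend ((\<tau> - min_lean \<tau>) / 2) ((\<tau> + min_lean \<tau>) / 2)"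
  using closed_contains_Inf[OF bend_leans(2,3,1), of \<tau>] by (simp add: min_lean_def)

lemma min_lean_le: "bend s s' \<Longrightarrow> s + s' = \<tau> \<Longrightarrow> min_lean \<tau> \<le> s' - s"
proof -
  assume b: "bend s s'" and st: "s + s' = \<tau>"
  have e: "(\<tau> - (s' - s)) / 2 = s" "(\<tau> + (s' - s)) / 2 = s'" using st by (simp_all add: field_simps)
  have "bend ((\<tau> - (s' - s)) / 2) ((\<tau> + (s' - s)) / 2)" unfolding e by (rule b)
  then show ?thesis
    unfolding min_lean_def by (intro cInf_lower bend_leans(3)) simp
qed

text \<open>If the least leans at two centre points differed by more than the parameters do, the two bends would
cross. The flat piece that they span would contain a bend through one of the two centre points with a
lean smaller than the least one.\<close>

lemma min_lean_lipschitz: "\<bar>min_lean \<tau>' - min_lean \<tau>\<bar> \<le> \<bar>\<tau>' - \<tau>\<bar>"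
proof -
  have "\<bar>min_lean \<tau>' - min_lean \<tau>\<bar> \<le> \<tau>' - \<tau>" if le: "\<tau> \<le> \<tau>'" for \<tau> \<tau>'
  proof -
    define d where "d = min_lean \<tau>"
    define d' where "d' = min_lean \<tau>'"
    define s s' t t' where "s = (\<tau> - d) / 2" and "s' = (\<tau> + d) / 2"
      and "t = (\<tau>' - d') / 2" and "t' = (\<tau>' + d') / 2"
    note defs = s_def s'_def t_def t'_def
    have b: "bend s s'" and b': "bend t t'"
      using min_lean_bend[of \<tau>] min_lean_bend[of \<tau>'] by (simp_all add: defs d_def d'_def)
    have "d' \<le> d + (\<tau>' - \<tau>)"
    proof (rule ccontr)
      assume c: "\<not> d' \<le> d + (\<tau>' - \<tau>)"
      have "bend s (\<tau>' - s)"
        by (rule crossing_bends_span_flat_piece[OF b' b]) (use c le in \<open>auto simp: defs field_simps\<close>)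
      from min_lean_le[OF this, of \<tau>'] show False using c by (simp add: defs d'_def field_simps)
    qed
    moreover have "d - (\<tau>' - \<tau>) \<le> d'"
    proof (rule ccontr)
      assume c: "\<not> d - (\<tau>' - \<tau>) \<le> d'"
      have "bend (\<tau> - t') t'"
        by (rule crossing_bends_span_flat_piece[OF b b']) (use c le in \<open>auto simp: defs field_simps\<close>)
      from min_lean_le[OF this, of \<tau>] show False using c by (simp add: defs d_def field_simps)
    qed
    ultimately show ?thesis by (simp add: d_def d'_def abs_le_iff)
  qed
  from this[of \<tau> \<tau>'] this[of \<tau>' \<tau>] show ?thesis by (cases "\<tau> \<le> \<tau>'") auto
qed

lemma min_lean_period: "min_lean (\<tau> + 4 * lam) = min_lean \<tau>"
proof -
  have "bend s s' \<longleftrightarrow> bend (s + 2 * lam) (s' + 2 * lam)" for s s'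
    using bend_glide[of "s + lam" "s' + lam"] bend_glide[of s' s] by (simp add: algebra_simps)
  from this[of "(\<tau> - d) / 2" "(\<tau> + d) / 2" for d] show ?thesis
    unfolding min_lean_def by (simp add: add_divide_distrib diff_divide_distrib algebra_simps)
qed

text \<open>The mean of the least and the greatest lean at a centre point. The glide reflection reverses leans, so
the greatest lean at \<open>\<tau>\<close> is minus the least lean at \<open>\<tau> + 2 * lam\<close>. The glide reflection exchanges the two
extremes, and it respects their mean.\<close>

definition lean :: "real \<Rightarrow> real"
  where "lean \<tau> = (min_lean \<tau> - min_lean (\<tau> + 2 * lam)) / 2"

definition bottom_end :: "real \<Rightarrow> real" where "bottom_end \<tau> = (\<tau> - lean \<tau>) / 2"
definition top_end :: "real \<Rightarrow> real" where "top_end \<tau> = (\<tau> + lean \<tau>) / 2"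

lemma lean_lipschitz: "\<bar>lean \<tau>' - lean \<tau>\<bar> \<le> \<bar>\<tau>' - \<tau>\<bar>"
proof -
  have "\<bar>min_lean (\<tau>' + 2 * lam) - min_lean (\<tau> + 2 * lam)\<bar> \<le> \<bar>\<tau>' - \<tau>\<bar>"
    using min_lean_lipschitz[of "\<tau>' + 2 * lam" "\<tau> + 2 * lam"] by simp
  note bounds = this[THEN abs_le_D1] this[THEN abs_le_D2]
    min_lean_lipschitz[of \<tau>' \<tau>, THEN abs_le_D1] min_lean_lipschitz[of \<tau>' \<tau>, THEN abs_le_D2]
  show ?thesis
    unfolding lean_def by (rule abs_leI; use bounds in \<open>simp add: field_simps\<close>)
qed

lemma lean_glide: "lean (\<tau> + 2 * lam) = - lean \<tau>"
proof -
  have "min_lean (\<tau> + 2 * lam + 2 * lam) = min_lean \<tau>"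
    using min_lean_period[of \<tau>] by (simp add: algebra_simps)
  then show ?thesis unfolding lean_def by (simp only:) (simp add: field_simps)
qed

lemma ends_glide: "bottom_end (\<tau> + 2 * lam) = top_end \<tau> + lam" "top_end (\<tau> + 2 * lam) = bottom_end \<tau> + lam"
  unfolding bottom_end_def top_end_def lean_glide by (simp_all add: field_simps)

lemma bend_bottom_top: "bend (bottom_end \<tau>) (top_end \<tau>)"
proof -
  define d where "d = min_lean \<tau>"
  define d' where "d' = - min_lean (\<tau> + 2 * lam)"
  have b: "bend ((\<tau> - d) / 2) ((\<tau> + d) / 2)" using min_lean_bend by (simp add: d_def)
  have b': "bend ((\<tau> - d') / 2) ((\<tau> + d') / 2)"
    using min_lean_bend[of "\<tau> + 2 * lam"]
      bend_glide[of "(\<tau> + d') / 2" "(\<tau> - d') / 2"] by (simp add: d'_def field_simps)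
  have "d \<le> d'"
    using min_lean_le[OF b', of \<tau>] by (simp add: d_def field_simps)
  have sl: "lean \<tau> = (d + d') / 2" by (simp add: lean_def d_def d'_def)
  show ?thesis
    unfolding bottom_end_def top_end_def
    by (rule crossing_bends_span_flat_piece[OF b' b]) (use \<open>d \<le> d'\<close> in \<open>auto simp: sl field_simps\<close>)
qed

lemma bottom_plus_top: "bottom_end \<tau> + top_end \<tau> = \<tau>"
  by (simp add: bottom_end_def top_end_def field_simps)

lemma bottom_end_mono: "\<tau> \<le> \<tau>' \<Longrightarrow> bottom_end \<tau> \<le> bottom_end \<tau>'" and top_end_mono: "\<tau> \<le> \<tau>' \<Longrightarrow> top_end \<tau> \<le> top_end \<tau>'"
  using lean_lipschitz[of \<tau>' \<tau>] by (auto simp: bottom_end_def top_end_def abs_le_iff field_simps)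

lemma continuous_lean: "continuous_on A lean"
  unfolding continuous_on_iff dist_real_def using lean_lipschitz le_less_trans by blast

lemma continuous_bottom_end: "continuous_on A bottom_end"
  unfolding bottom_end_def[abs_def] by (intro continuous_intros continuous_lean) auto

lemma continuous_top_end: "continuous_on A top_end"
  unfolding top_end_def[abs_def] by (intro continuous_intros continuous_lean) auto

lemma bends_cover_strip:
  assumes y: "0 \<le> y" "y \<le> 1"
  shows "\<exists>\<tau>. (1 - y) * bottom_end \<tau> + y * top_end \<tau> = x"
proof -
  obtain K where K: "\<And>s s'. bend s s' \<Longrightarrow> \<bar>s' - s\<bar> \<le> K" using bounded_lean by blast
  have sl: "\<bar>lean \<tau>\<bar> \<le> K" for \<tau>
    using K[OF bend_bottom_top, of \<tau>] by (simp add: bottom_end_def top_end_def field_simps)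
  let ?f = "\<lambda>\<tau>. (1 - y) * bottom_end \<tau> + y * top_end \<tau>"
  have f: "?f \<tau> = \<tau> / 2 + (2 * y - 1) * lean \<tau> / 2" for \<tau>
    by (simp add: bottom_end_def top_end_def field_simps)
  have "\<bar>(2 * y - 1) * lean \<tau>\<bar> \<le> 1 * K" for \<tau>
    unfolding abs_mult using y by (intro mult_mono sl) (auto simp: abs_le_iff)
  then have b: "\<bar>(2 * y - 1) * lean \<tau>\<bar> \<le> K" for \<tau> by simp
  have "\<exists>\<tau>\<ge>2 * x - K. \<tau> \<le> 2 * x + K \<and> ?f \<tau> = x"
  proof (rule IVT')
    show "?f (2 * x - K) \<le> x" "x \<le> ?f (2 * x + K)"
      unfolding f using b[of "2 * x - K"] b[of "2 * x + K"] by (simp_all add: abs_le_iff field_simps)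
    show "2 * x - K \<le> 2 * x + K" using sl[of 0] by simp
    show "continuous_on {2 * x - K..2 * x + K} ?f"
      by (intro continuous_intros continuous_bottom_end continuous_top_end)
  qed
  then show ?thesis by blast
qed

lemma bends_disjoint_inside:
  assumes "0 < y" "y < 1" and eq: "(1 - y) * bottom_end \<tau> + y * top_end \<tau> = (1 - y) * bottom_end \<tau>' + y * top_end \<tau>'"
  shows "\<tau> = \<tau>'"
proof (rule ccontr)
  have *: False if lt: "\<tau> < \<tau>'" and eq: "(1 - y) * bottom_end \<tau> + y * top_end \<tau> = (1 - y) * bottom_end \<tau>' + y * top_end \<tau>'" for \<tau> \<tau>'
  proof -
    have m: "bottom_end \<tau> \<le> bottom_end \<tau>'" "top_end \<tau> \<le> top_end \<tau>'" using bottom_end_mono top_end_mono lt by auto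
    have "bottom_end \<tau> < bottom_end \<tau>' \<or> top_end \<tau> < top_end \<tau>'"
      using bottom_plus_top[of \<tau>] bottom_plus_top[of \<tau>'] lt by linarith
    moreover have "(1 - y) * (bottom_end \<tau>' - bottom_end \<tau>) + y * (top_end \<tau>' - top_end \<tau>) = 0"
      using eq by (simp add: algebra_simps)
    moreover have "0 \<le> (1 - y) * (bottom_end \<tau>' - bottom_end \<tau>)" "0 \<le> y * (top_end \<tau>' - top_end \<tau>)" using m assms by simp_all
    ultimately have "(1 - y) * (bottom_end \<tau>' - bottom_end \<tau>) = 0" "y * (top_end \<tau>' - top_end \<tau>) = 0" by linarith+
    then show False using \<open>bottom_end \<tau> < bottom_end \<tau>' \<or> top_end \<tau> < top_end \<tau>'\<close> assms by simp
  qed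
  assume "\<tau> \<noteq> \<tau>'"
  then show False using *[of \<tau> \<tau>'] *[of \<tau>' \<tau>] eq by (cases "\<tau> < \<tau>'") auto
qed

end

section \<open>Odd functions on ordered pairs\<close>

text \<open>Pairs \<open>s \<le> t \<le> s + T\<close> modulo common translation by \<open>T\<close> form an annulus; if its two boundary circles are
collapsed to points, \<open>(s, t) \<mapsto> (t, s + T)\<close> becomes the antipodal map of a sphere, and this is an instance
of the Borsuk-Ulam theorem. Without a zero, \<open>F\<close> has a continuous argument. The argument is constant on
the diagonal, and its change \<open>D\<close> from \<open>(s, t)\<close> to \<open>(t, s + T)\<close> is a constant. Two such steps lead from
\<open>(0, 0)\<close> to \<open>(T, T)\<close>, on the diagonal again, so that \<open>D = 0\<close>. But \<open>D\<close> has to be an odd multiple of \<open>pi\<close>.\<close>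

lemma odd_map_on_ordered_pairs_has_zero:
  fixes F :: "real \<times> real \<Rightarrow> complex"
  assumes T: "T > 0"
    and cont: "continuous_on {(s, t). s \<le> t \<and> t \<le> s + T} F"
    and diag: "\<And>s. Im (F (s, s)) = 0 \<and> Re (F (s, s)) > 0"
    and odd: "\<And>s t. s \<le> t \<Longrightarrow> t \<le> s + T \<Longrightarrow> F (t, s + T) = - F (s, t)"
  shows "\<exists>s t. s \<le> t \<and> t \<le> s + T \<and> F (s, t) = 0"
proof (rule ccontr)
  assume nz: "\<nexists>s t. s \<le> t \<and> t \<le> s + T \<and> F (s, t) = 0"
  define S where "S = {(s, t). s \<le> t \<and> t \<le> s + T}"
  have "convex S"
  proof -
    have "S = {z. (1, -1) \<bullet> z \<le> 0} \<inter> {z. (-1, 1) \<bullet> z \<le> T}"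
      by (auto simp: S_def inner_prod_def)
    then show ?thesis by (simp only: convex_Int convex_halfspace_le)
  qed
  then obtain g where g: "continuous_on S g" "\<And>z. z \<in> S \<Longrightarrow> F z = exp (g z)"
    using continuous_logarithm_on_contractible[of S F, OF _ convex_imp_contractible] cont nz
    by (auto simp: S_def)
  \<comment> \<open>Distinct real values with the same \<open>exp (\<i> * h)\<close> are at least \<open>2 * pi\<close> apart.\<close>
  have const: "\<exists>c. \<forall>z\<in>A. h z = c"
    if A: "connected A" "continuous_on A h" and e: "\<And>z. z \<in> A \<Longrightarrow> exp (\<i> * of_real (h z)) = w"
    for A :: "'b::topological_space set" and h :: "'b \<Rightarrow> real" and w
  proof -
    have "h constant_on A"
    proof (rule continuous_discrete_range_constant[OF A])
      fix x assume x: "x \<in> A"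
      have "2 * pi \<le> norm (h y - h x)" if y: "y \<in> A" "h y \<noteq> h x" for y
      proof -
        have "exp (\<i> * of_real (h y)) = exp (\<i> * of_real (h x))" using e x y by simp
        then obtain n :: int where "\<i> * of_real (h y) = \<i> * of_real (h x) + (of_int (2 * n) * pi) * \<i>"
          unfolding exp_eq by blast
        then have n: "h y - h x = 2 * of_int n * pi"
          by (simp add: complex_eq_iff)
        then have "n \<noteq> 0" using y by auto
        then have "1 \<le> \<bar>real_of_int n\<bar>" by linarith
        then show ?thesis unfolding n by (simp add: abs_mult)
      qed
      then show "\<exists>e>0. \<forall>y. y \<in> A \<and> h y \<noteq> h x \<longrightarrow> e \<le> norm (h y - h x)"
        by (intro exI[of _ "2 * pi"]) auto
    qed
    then show ?thesis by (simp add: constant_on_def)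
  qed
  have arg: "exp (\<i> * of_real (Im z)) = exp z / of_real (exp (Re z))" for z
    by (simp add: exp_eq_polar[of z] exp_of_real[symmetric] cis_conv_exp)
  define D where "D = (\<lambda>z. Im (g (snd z, fst z + T)) - Im (g z))"
  have "\<exists>c. \<forall>z\<in>S. D z = c"
  proof (rule const)
    show "connected S" using \<open>convex S\<close> by (rule convex_connected)
    show "continuous_on S D"
      unfolding D_def
      by (intro continuous_intros continuous_on_compose2[OF g(1)] g(1)) (auto simp: S_def)
    fix z assume z: "z \<in> S"
    let ?z' = "(snd z, fst z + T)"
    have z': "?z' \<in> S" using z by (auto simp: S_def)
    have F: "F ?z' = - F z" using odd[of "fst z" "snd z"] z by (auto simp: S_def)
    then have "exp (g ?z') = - exp (g z)" using g(2)[OF z] g(2)[OF z'] by simp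
    then have "exp (g ?z' - g z) = -1" by (simp add: exp_diff)
    then have "norm (exp (g ?z' - g z)) = 1" by simp
    then have "exp (Re (g ?z' - g z)) = 1" by simp
    with \<open>exp (g ?z' - g z) = -1\<close> show "exp (\<i> * of_real (D z)) = -1"
      using arg[of "g ?z' - g z"] by (simp add: D_def)
  qed
  then obtain c where c: "\<And>z. z \<in> S \<Longrightarrow> D z = c" by blast
  have "\<exists>c. \<forall>s\<in>UNIV. Im (g (s, s)) = c"
  proof (rule const)
    show "continuous_on UNIV (\<lambda>s. Im (g (s, s)))"
      by (intro continuous_intros continuous_on_compose2[OF g(1)]) (use T in \<open>auto simp: S_def\<close>)
    fix s :: real
    have s: "(s, s) \<in> S" using T by (simp add: S_def)
    have F: "F (s, s) = of_real (Re (F (s, s)))" using diag[of s] by (simp add: complex_eq_iff)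
    have "norm (F (s, s)) = Re (F (s, s))" using diag[of s] by (subst F) simp
    moreover have "norm (F (s, s)) = exp (Re (g (s, s)))" using g(2)[OF s] by simp
    ultimately have "F (s, s) = of_real (exp (Re (g (s, s))))" using F by simp
    then show "exp (\<i> * of_real (Im (g (s, s)))) = 1"
      using arg[of "g (s, s)"] g(2)[OF s] by simp
  qed simp
  then obtain k where k: "\<And>s. Im (g (s, s)) = k" by blast
  have "D (0, 0) = c" "D (0, T) = c" using c T by (auto simp: S_def)
  then have "c = 0" using k[of 0] k[of T] by (simp add: D_def)
  have z: "(0, 0) \<in> S" "(0, T) \<in> S" using T by (auto simp: S_def)
  have "exp (g (0, T)) = - exp (g (0, 0))"
    using odd[of 0 0] g(2)[OF z(1)] g(2)[OF z(2)] T by simp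
  moreover have "Im (g (0, T)) = Im (g (0, 0))" using \<open>D (0, 0) = c\<close> \<open>c = 0\<close> by (simp add: D_def)
  ultimately have "exp (Re (g (0, T))) *\<^sub>R cis (Im (g (0, 0))) = - (exp (Re (g (0, 0))) *\<^sub>R cis (Im (g (0, 0))))"
    by (simp add: exp_eq_polar scaleR_conv_of_real)
  then have "(exp (Re (g (0, T))) + exp (Re (g (0, 0)))) *\<^sub>R cis (Im (g (0, 0))) = 0"
    by (simp add: scaleR_add_left)
  moreover have "exp (Re (g (0, T))) + exp (Re (g (0, 0))) > 0" by (intro add_pos_pos exp_gt_zero)
  ultimately show False by simp
qed

section \<open>The T-pattern\<close>

unbundle cross3_syntax

lemma coplanar_perpendicular_decomposition:
  fixes v w d :: "real^3"
  assumes "v \<noteq> 0" "w \<noteq> 0" "v \<bullet> w = 0" "d \<bullet> (v \<times> w) = 0"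
  shows "d = ((d \<bullet> v) / (v \<bullet> v)) *\<^sub>R v + ((d \<bullet> w) / (w \<bullet> w)) *\<^sub>R w"
proof -
  let ?r = "d - ((d \<bullet> v) / (v \<bullet> v)) *\<^sub>R v - ((d \<bullet> w) / (w \<bullet> w)) *\<^sub>R w"
  have "w \<bullet> v = 0" using assms(3) by (simp add: inner_commute)
  then have "?r \<bullet> v = 0" "?r \<bullet> w = 0"
    using assms by (simp_all add: inner_diff_left)
  then have "?r \<times> (v \<times> w) = 0" by (simp add: Lagrange)
  moreover have "?r \<bullet> (v \<times> w) = 0"
    using assms(4) by (simp add: inner_diff_left dot_cross_self)
  moreover have "v \<times> w \<noteq> 0"
    using norm_cross_dot[of v w] assms by auto
  ultimately have "?r = 0" using norm_and_cross_eq_0 by blast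
  then show ?thesis by (simp add: algebra_simps)
qed

locale embedded_paper_strip = paper_strip +
  assumes injective: "\<And>p q. p \<in> strip \<Longrightarrow> q \<in> strip \<Longrightarrow> X p = X q \<Longrightarrow>
    \<exists>n. q = (glide lam ^^ n) p \<or> p = (glide lam ^^ n) q"
begin

definition lower :: "real \<Rightarrow> real^3" where "lower \<tau> = X (bottom_end \<tau>, 0)"
definition upper :: "real \<Rightarrow> real^3" where "upper \<tau> = X (top_end \<tau>, 1)"

lemma lower_upper_glide: "lower (\<tau> + 2 * lam) = upper \<tau>" "upper (\<tau> + 2 * lam) = lower \<tau>"
  unfolding lower_def upper_def ends_glide
  using glide_X[of 1 "top_end \<tau>"] glide_X[of 0 "bottom_end \<tau>"] by simp_all

lemma continuous_lower: "continuous_on A lower"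
  unfolding lower_def[abs_def]
  by (intro continuous_on_compose2[OF continuous_X] continuous_intros continuous_bottom_end) auto

lemma continuous_upper: "continuous_on A upper"
  unfolding upper_def[abs_def]
  by (intro continuous_on_compose2[OF continuous_X] continuous_intros continuous_top_end) auto

lemma dist_lower_upper: "dist (lower \<tau>) (upper \<tau>) = sqrt (1 + (top_end \<tau> - bottom_end \<tau>)\<^sup>2)"
  using bend_bottom_top[of \<tau>] by (simp add: bend_def lower_def upper_def)

lemma dist_lower_upper_ge_1: "1 \<le> dist (lower \<tau>) (upper \<tau>)"
  unfolding dist_lower_upper by simp

lemma glide_power_on_bend:
  "\<exists>y'. (glide lam ^^ n) ((1 - y) * bottom_end \<tau> + y * top_end \<tau>, y)
    = ((1 - y') * bottom_end (\<tau> + 2 * lam * n) + y' * top_end (\<tau> + 2 * lam * n), y')"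
proof (induction n)
  case (Suc n)
  then obtain y' where y': "(glide lam ^^ n) ((1 - y) * bottom_end \<tau> + y * top_end \<tau>, y)
    = ((1 - y') * bottom_end (\<tau> + 2 * lam * n) + y' * top_end (\<tau> + 2 * lam * n), y')" by blast
  have next_n: "\<tau> + 2 * lam * Suc n = (\<tau> + 2 * lam * n) + 2 * lam" by (simp add: algebra_simps)
  have "(glide lam ^^ Suc n) ((1 - y) * bottom_end \<tau> + y * top_end \<tau>, y)
    = glide lam ((1 - y') * bottom_end (\<tau> + 2 * lam * n) + y' * top_end (\<tau> + 2 * lam * n), y')"
    by (simp only: funpow.simps comp_apply y')
  also have "\<dots> = ((1 - (1 - y')) * bottom_end (\<tau> + 2 * lam * Suc n)
    + (1 - y') * top_end (\<tau> + 2 * lam * Suc n), 1 - y')"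
    unfolding next_n ends_glide by (simp add: glide_def algebra_simps)
  finally show ?case by blast
qed auto

lemma bends_meet_inside:
  assumes y: "0 < y" "y < 1" and y': "0 < y'" "y' < 1"
    and eq: "(1 - y) *\<^sub>R lower \<tau> + y *\<^sub>R upper \<tau> = (1 - y') *\<^sub>R lower \<tau>' + y' *\<^sub>R upper \<tau>'"
  shows "\<exists>n::nat. \<tau>' = \<tau> + 2 * lam * n \<or> \<tau> = \<tau>' + 2 * lam * n"
proof -
  let ?P = "\<lambda>\<tau> y. ((1 - y) * bottom_end \<tau> + y * top_end \<tau>, y)"
  have "X (?P \<tau> y) = X (?P \<tau>' y')"
    using X_on_bend[OF bend_bottom_top, of y \<tau>] X_on_bend[OF bend_bottom_top, of y' \<tau>'] eq y y'
    by (simp add: lower_def upper_def)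
  moreover have "?P \<tau> y \<in> strip" "?P \<tau>' y' \<in> strip" using y y' by (auto simp: strip_def)
  ultimately obtain n where n: "?P \<tau>' y' = (glide lam ^^ n) (?P \<tau> y) \<or> ?P \<tau> y = (glide lam ^^ n) (?P \<tau>' y')"
    using injective by blast
  have "\<tau>1 + 2 * lam * n = \<tau>2" if "?P \<tau>2 y2 = (glide lam ^^ n) (?P \<tau>1 y1)" "0 < y2" "y2 < 1" for \<tau>1 \<tau>2 y1 y2
  proof -
    obtain y3 where "(glide lam ^^ n) (?P \<tau>1 y1) = ?P (\<tau>1 + 2 * lam * n) y3"
      using glide_power_on_bend by blast
    with that(1) have "y3 = y2" "(1 - y2) * bottom_end \<tau>2 + y2 * top_end \<tau>2
        = (1 - y2) * bottom_end (\<tau>1 + 2 * lam * n) + y2 * top_end (\<tau>1 + 2 * lam * n)" by auto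
    then show ?thesis using bends_disjoint_inside[OF that(2,3)] by metis
  qed
  then show ?thesis using n y y' by metis
qed

text \<open>The real part of \<open>F\<close> tests whether the images of two bends are perpendicular, the imaginary part whether
they are coplanar. One turn around the band reverses the direction vector \<open>v\<close> and keeps the line, so
that \<open>F\<close> is odd.\<close>

lemma ex_perpendicular_coplanar_bends:
  "\<exists>s t \<mu> \<nu>. s < t \<and> t < s + 2 * lam \<and> (upper s - lower s) \<bullet> (upper t - lower t) = 0 \<and>
    lower s + \<mu> *\<^sub>R (upper s - lower s) = lower t + \<nu> *\<^sub>R (upper t - lower t)"
proof -
  define v where "v = (\<lambda>\<tau>. upper \<tau> - lower \<tau>)"
  define F where "F = (\<lambda>z. Complex (v (fst z) \<bullet> v (snd z))
    ((lower (snd z) - lower (fst z)) \<bullet> (v (fst z) \<times> v (snd z))))"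
  have v0: "v \<tau> \<noteq> 0" for \<tau>
    using dist_lower_upper_ge_1[of \<tau>] by (auto simp: v_def)
  have vglide: "v (\<tau> + 2 * lam) = - v \<tau>" for \<tau> by (simp add: v_def lower_upper_glide)
  have cont_v: "continuous_on A v" for A
    unfolding v_def by (intro continuous_intros continuous_lower continuous_upper)
  have "\<exists>s t. s \<le> t \<and> t \<le> s + 2 * lam \<and> F (s, t) = 0"
  proof (rule odd_map_on_ordered_pairs_has_zero)
    show "2 * lam > 0" using lam_pos by simp
    show "continuous_on {(s, t). s \<le> t \<and> t \<le> s + 2 * lam} F"
      unfolding F_def Complex_eq
      by (intro continuous_intros continuous_on_cross continuous_on_compose2[OF cont_v[of UNIV]]
          continuous_on_compose2[OF continuous_lower[of UNIV]]) auto
    show "Im (F (s, s)) = 0 \<and> Re (F (s, s)) > 0" for s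
      using v0 by (simp add: F_def)
    fix s t assume "s \<le> t" "t \<le> s + 2 * lam"
    have "lower (s + 2 * lam) = lower s + v s" by (simp add: lower_upper_glide v_def)
    then have "(lower (s + 2 * lam) - lower t) \<bullet> (v t \<times> - v s) = - ((lower t - lower s) \<bullet> (v s \<times> v t))"
      using cross_skew[of "v t" "v s"]
      by (simp add: inner_diff_left inner_add_left dot_cross_self)
    then show "F (t, s + 2 * lam) = - F (s, t)"
      by (simp add: F_def vglide complex_eq_iff inner_commute)
  qed
  then obtain s t where st: "s \<le> t" "t \<le> s + 2 * lam" "F (s, t) = 0" by blast
  then have perp: "v s \<bullet> v t = 0" and cop: "(lower t - lower s) \<bullet> (v s \<times> v t) = 0"
    by (simp_all add: F_def complex_eq_iff)
  have "s \<noteq> t" using perp v0 by auto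
  moreover have "t \<noteq> s + 2 * lam" using perp v0[of s] by (auto simp: vglide)
  ultimately have lt: "s < t" "t < s + 2 * lam" using st by auto
  let ?d = "lower t - lower s"
  obtain \<mu> \<nu> where "?d = \<mu> *\<^sub>R v s + \<nu> *\<^sub>R v t"
    using coplanar_perpendicular_decomposition[OF v0 v0 perp cop] by blast
  then have "lower s + \<mu> *\<^sub>R v s = lower t + (- \<nu>) *\<^sub>R v t" by (simp add: algebra_simps)
  then show ?thesis using lt perp unfolding v_def by blast
qed

text \<open>The common point of the two lines is not interior to both segments, by \<open>bends_meet_inside\<close>. The
condition \<open>\<mu> \<le> 0\<close> places it outside the first segment, or at its lower end, and the lower end nearer to
it. Up to relabelling this is all: passing from \<open>(s, t)\<close> to \<open>(t, s + 2 * lam)\<close> exchanges the two bends,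
and adding \<open>2 * lam\<close> to both parameters exchanges the ends of each of them.\<close>

lemma ex_T_pattern:
  "\<exists>s t \<mu> \<nu>. s < t \<and> t < s + 2 * lam \<and> (upper s - lower s) \<bullet> (upper t - lower t) = 0 \<and>
    lower s + \<mu> *\<^sub>R (upper s - lower s) = lower t + \<nu> *\<^sub>R (upper t - lower t) \<and> \<mu> \<le> 0"
proof -
  obtain s t \<mu> \<nu> where st: "s < t" "t < s + 2 * lam"
    and perp: "(upper s - lower s) \<bullet> (upper t - lower t) = 0"
    and foot: "lower s + \<mu> *\<^sub>R (upper s - lower s) = lower t + \<nu> *\<^sub>R (upper t - lower t)"
    using ex_perpendicular_coplanar_bends by blast
  note glides = lower_upper_glide[of s] lower_upper_glide[of t]
    lower_upper_glide[of "s + 2 * lam"] 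
  have "\<not> (0 < \<mu> \<and> \<mu> < 1 \<and> 0 < \<nu> \<and> \<nu> < 1)"
  proof
    assume *: "0 < \<mu> \<and> \<mu> < 1 \<and> 0 < \<nu> \<and> \<nu> < 1"
    have "(1 - \<mu>) *\<^sub>R lower s + \<mu> *\<^sub>R upper s = (1 - \<nu>) *\<^sub>R lower t + \<nu> *\<^sub>R upper t"
      using foot by (simp add: algebra_simps)
    then obtain n :: nat where n: "t = s + 2 * lam * n \<or> s = t + 2 * lam * n"
      using bends_meet_inside * by blast
    have "0 \<le> 2 * lam * n" using lam_pos by simp
    then have "t = s + 2 * lam * n" using n st by linarith
    then have "0 < lam * n" "lam * n < lam" using st by simp_all
    then have "0 < real n" "real n < 1" using lam_pos by (simp_all add: zero_less_mult_iff)
    then show False by simp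
  qed
  then consider "\<mu> \<le> 0" | "1 \<le> \<mu>" | "\<nu> \<le> 0" | "1 \<le> \<nu>" by linarith
  then show ?thesis
  proof cases
    case 1
    then show ?thesis using st perp foot by blast
  next
    case 2
    have "lower (s + 2 * lam) + (1 - \<mu>) *\<^sub>R (upper (s + 2 * lam) - lower (s + 2 * lam))
      = lower (t + 2 * lam) + (1 - \<nu>) *\<^sub>R (upper (t + 2 * lam) - lower (t + 2 * lam))"
      using foot unfolding glides by (simp add: algebra_simps)
    moreover have "(upper (s + 2 * lam) - lower (s + 2 * lam)) \<bullet> (upper (t + 2 * lam) - lower (t + 2 * lam)) = 0"
      using perp unfolding glides by (simp add: algebra_simps)
    ultimately show ?thesis
      using 2 st by (intro exI[of _ "s + 2 * lam"] exI[of _ "t + 2 * lam"] exI[of _ "1 - \<mu>"] exI[of _ "1 - \<nu>"]) auto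
  next
    case 3
    have "lower t + \<nu> *\<^sub>R (upper t - lower t)
      = lower (s + 2 * lam) + (1 - \<mu>) *\<^sub>R (upper (s + 2 * lam) - lower (s + 2 * lam))"
      using foot unfolding glides by (simp add: algebra_simps)
    moreover have "(upper t - lower t) \<bullet> (upper (s + 2 * lam) - lower (s + 2 * lam)) = 0"
      using perp unfolding glides by (simp add: algebra_simps inner_commute)
    ultimately show ?thesis
      using 3 st by (intro exI[of _ "t"] exI[of _ "s + 2 * lam"] exI[of _ "\<nu>"] exI[of _ "1 - \<mu>"]) auto
  next
    case 4
    have "lower (t + 2 * lam) + (1 - \<nu>) *\<^sub>R (upper (t + 2 * lam) - lower (t + 2 * lam))
      = lower (s + 2 * lam + 2 * lam) + \<mu> *\<^sub>R (upper (s + 2 * lam + 2 * lam) - lower (s + 2 * lam + 2 * lam))"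
      using foot unfolding glides by (simp add: algebra_simps)
    moreover have "(upper (t + 2 * lam) - lower (t + 2 * lam))
        \<bullet> (upper (s + 2 * lam + 2 * lam) - lower (s + 2 * lam + 2 * lam)) = 0"
      using perp unfolding glides by (simp add: algebra_simps inner_commute)
    ultimately show ?thesis
      using 4 st by (intro exI[of _ "t + 2 * lam"] exI[of _ "s + 2 * lam + 2 * lam"] exI[of _ "1 - \<nu>"] exI[of _ \<mu>]) auto
  qed
qed

end

unbundle no cross3_syntax

section \<open>Distances in a nearly optimal T-pattern\<close>

text \<open>In an orthonormal frame at the midpoint of \<open>p q\<close> the points \<open>p\<close>, \<open>q\<close> are \<open>(- d / 2, 0)\<close>, \<open>(d / 2, 0)\<close> and
\<open>b\<close> is \<open>(\<beta>, h)\<close>; \<open>S1\<close>, \<open>S2\<close> are the distances from \<open>b\<close> to \<open>p\<close>, \<open>q\<close>. The equation \<open>key\<close> says that \<open>b\<close> lies on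
the ellipse with foci \<open>p\<close>, \<open>q\<close> and sum \<open>T\<close> of focal distances. It yields \<open>d\<^sup>2 + 4 * h\<^sup>2 \<le> T\<^sup>2\<close>, and with
\<open>m = lam\<^sup>2 - 3\<close> the hypotheses become \<open>2 - m \<le> 2 * lam * x \<le> 2 + m\<close>. Since \<open>m\<close> is at most \<open>15 / 4 * \<epsilon>\<close>, every
quantity is within a multiple of \<open>\<epsilon>\<close> of its value at \<open>lam = sqrt 3\<close>, \<open>x = 1 / sqrt 3\<close>, except \<open>\<beta>\<close>, which the
ellipse controls through its square.\<close>

lemma near_extremal_distances:
  fixes lam x d h \<beta> \<epsilon> S1 S2 :: real
  assumes eps: "0 < \<epsilon>" "\<epsilon> < 1 / 4" and lam: "0 < lam" "lam < sqrt 3 + \<epsilon>"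
    and d: "0 < d" "d\<^sup>2 = 1 + x\<^sup>2" "d \<le> lam - x" and h: "1 \<le> h"
    and S: "0 \<le> S1" "0 \<le> S2" "S1\<^sup>2 = (\<beta> + d / 2)\<^sup>2 + h\<^sup>2" "S2\<^sup>2 = (\<beta> - d / 2)\<^sup>2 + h\<^sup>2" "S1 + S2 \<le> lam + x"
  shows "(lam - x)\<^sup>2 - d\<^sup>2 \<le> 8 * \<epsilon>" "(lam + x)\<^sup>2 - (S1 + S2)\<^sup>2 \<le> 8 * \<epsilon>"
    "\<beta>\<^sup>2 \<le> 4 * \<epsilon>" "h \<le> 1 + \<epsilon>" "\<bar>d / 2 - 1 / sqrt 3\<bar> \<le> \<epsilon>"
proof -
  define T where "T = S1 + S2"
  define m where "m = lam\<^sup>2 - 3"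
  have r: "sqrt 3 < 7 / 4" "17 / 10 < sqrt 3"
    by (rule real_less_lsqrt real_less_rsqrt; simp add: power2_eq_square)+
  have r2: "(sqrt 3)\<^sup>2 = 3" by simp
  have "lam\<^sup>2 \<le> (sqrt 3 + \<epsilon>)\<^sup>2" using lam by (intro power_mono) auto
  also have "\<dots> = 3 + (2 * sqrt 3 + \<epsilon>) * \<epsilon>" using r2 by (simp add: power2_eq_square algebra_simps)
  also have "\<dots> \<le> 3 + (15 / 4) * \<epsilon>" using r eps by (intro add_left_mono mult_right_mono) auto
  finally have m: "m \<le> 15 / 4 * \<epsilon>" by (simp add: m_def)
  have m1: "m < 15 / 16" using m eps by linarith
  have "d\<^sup>2 \<le> (lam - x)\<^sup>2" using d by (intro power_mono) auto
  then have x1: "2 * (lam * x) \<le> 2 + m" unfolding d m_def by (simp add: power2_eq_square algebra_simps)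
  have Tpos: "0 \<le> T" using S by (simp add: T_def)
  have "h\<^sup>2 \<ge> 1\<^sup>2" using h by (intro power_mono) auto
  then have h2: "h\<^sup>2 \<ge> 1" by simp
  have Td: "d\<^sup>2 \<le> T\<^sup>2"
  proof (rule power_mono)
    have "\<bar>\<beta> + d / 2\<bar> \<le> S1" "\<bar>\<beta> - d / 2\<bar> \<le> S2"
      using S by (auto intro!: power2_le_imp_le[of _ S1] power2_le_imp_le[of _ S2])
    then show "d \<le> T" by (auto simp: T_def abs_le_iff)
  qed (use d in simp)
  have key: "T\<^sup>2 * (T\<^sup>2 - d\<^sup>2 - 4 * h\<^sup>2) = 4 * \<beta>\<^sup>2 * (T\<^sup>2 - d\<^sup>2)"
  proof -
    define D where "D = S1 - S2"
    have "T * D = S1\<^sup>2 - S2\<^sup>2" by (simp add: T_def D_def power2_eq_square algebra_simps)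
    also have "\<dots> = 2 * \<beta> * d" unfolding S(3,4) by (simp add: power2_eq_square algebra_simps)
    finally have TD: "(T * D)\<^sup>2 = (2 * \<beta> * d)\<^sup>2" by simp
    have "T\<^sup>2 + D\<^sup>2 = 2 * (S1\<^sup>2 + S2\<^sup>2)" by (simp add: T_def D_def power2_eq_square algebra_simps)
    also have "\<dots> = 4 * \<beta>\<^sup>2 + d\<^sup>2 + 4 * h\<^sup>2" unfolding S(3,4) by (simp add: power2_eq_square field_simps)
    finally have e: "T\<^sup>2 - d\<^sup>2 - 4 * h\<^sup>2 = 4 * \<beta>\<^sup>2 - D\<^sup>2" by linarith
    have "T\<^sup>2 * (T\<^sup>2 - d\<^sup>2 - 4 * h\<^sup>2) = 4 * \<beta>\<^sup>2 * T\<^sup>2 - (T * D)\<^sup>2"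
      unfolding e by (simp add: power_mult_distrib algebra_simps)
    then show ?thesis unfolding TD by (simp add: power_mult_distrib algebra_simps)
  qed
  have "T\<^sup>2 > 0" using Td d by (smt (verit) zero_less_power2)
  \<comment> \<open>the height of a point of an ellipse is at most the semi-minor axis\<close>
  have T1: "T\<^sup>2 - d\<^sup>2 - 4 * h\<^sup>2 \<ge> 0"
  proof -
    have "0 \<le> T\<^sup>2 * (T\<^sup>2 - d\<^sup>2 - 4 * h\<^sup>2)" unfolding key using Td by simp
    then show ?thesis using \<open>T\<^sup>2 > 0\<close> by (simp add: zero_le_mult_iff)
  qed
  have T2: "T\<^sup>2 \<le> (lam + x)\<^sup>2" using S(5) Tpos by (intro power_mono) (auto simp: T_def)
  have lx: "(lam + x)\<^sup>2 = 3 + m + 2 * (lam * x) + x\<^sup>2" "(lam - x)\<^sup>2 = 3 + m - 2 * (lam * x) + x\<^sup>2"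
    by (simp_all add: m_def power2_eq_square algebra_simps)
  have x2: "2 - m \<le> 2 * (lam * x)"
    using T1 T2 h2 unfolding lx d by linarith
  have m0: "0 \<le> m" using x1 x2 by linarith
  show "(lam - x)\<^sup>2 - d\<^sup>2 \<le> 8 * \<epsilon>" unfolding lx d using x2 m eps by linarith
  show "(lam + x)\<^sup>2 - (S1 + S2)\<^sup>2 \<le> 8 * \<epsilon>"
    using T1 h2 x1 m eps unfolding lx d T_def by linarith
  have xx: "4 * (3 + m) * x\<^sup>2 = (2 * (lam * x))\<^sup>2" by (simp add: m_def power2_eq_square algebra_simps)
  have xu: "4 * (3 + m) * x\<^sup>2 \<le> (2 + m)\<^sup>2" and xl: "(2 - m)\<^sup>2 \<le> 4 * (3 + m) * x\<^sup>2"
  proof -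
    have "0 \<le> 2 * (lam * x)" "0 \<le> 2 - m" using x2 m1 by linarith+
    then show "4 * (3 + m) * x\<^sup>2 \<le> (2 + m)\<^sup>2" "(2 - m)\<^sup>2 \<le> 4 * (3 + m) * x\<^sup>2"
      unfolding xx using power_mono[OF x1] power_mono[OF x2] by blast+
  qed
  have mm: "m * m \<le> m" using m0 m1 by (simp add: mult_left_le)
  have xu': "x\<^sup>2 - 1 / 3 \<le> m / 2"
  proof -
    have "12 * x\<^sup>2 \<le> 4 * (3 + m) * x\<^sup>2" using m0 by (intro mult_right_mono) auto
    also note xu
    also have "(2 + m)\<^sup>2 \<le> 4 + 5 * m" using mm by (simp add: power2_eq_square algebra_simps)
    finally show ?thesis using m0 by linarith
  qed
  have xl': "1 / 3 - x\<^sup>2 \<le> m / 2"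
  proof (rule ccontr)
    assume "\<not> 1 / 3 - x\<^sup>2 \<le> m / 2"
    then have "x\<^sup>2 < 1 / 3 - m / 2" by linarith
    then have "4 * (3 + m) * x\<^sup>2 < 4 * (3 + m) * (1 / 3 - m / 2)" using m0 by (intro mult_strict_left_mono) auto
    also have "\<dots> \<le> 4 - 4 * m" using m0 by (simp add: algebra_simps)
    also have "\<dots> \<le> (2 - m)\<^sup>2" by (simp add: power2_eq_square algebra_simps)
    finally show False using xl by linarith
  qed
  show "h \<le> 1 + \<epsilon>"
  proof (rule power2_le_imp_le)
    have "4 * h\<^sup>2 \<le> 4 + 2 * m" using T1 T2 x1 unfolding lx d by linarith
    then have "h\<^sup>2 \<le> 1 + 2 * \<epsilon>" using m eps by linarith
    also have "\<dots> \<le> (1 + \<epsilon>)\<^sup>2" by (simp add: power2_eq_square algebra_simps)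
    finally show "h\<^sup>2 \<le> (1 + \<epsilon>)\<^sup>2" .
  qed (use eps in simp)
  show "\<beta>\<^sup>2 \<le> 4 * \<epsilon>"
  proof -
    have "16 * \<beta>\<^sup>2 \<le> 4 * \<beta>\<^sup>2 * (T\<^sup>2 - d\<^sup>2)"
      using mult_left_mono[of 4 "T\<^sup>2 - d\<^sup>2" "4 * \<beta>\<^sup>2"] T1 h2 by simp
    also have "\<dots> = T\<^sup>2 * (T\<^sup>2 - d\<^sup>2 - 4 * h\<^sup>2)" using key by simp
    also have "\<dots> \<le> 8 * (2 * m)"
    proof (rule mult_mono)
      show "T\<^sup>2 \<le> 8" using T2 x1 xu' m1 unfolding lx by linarith
      show "T\<^sup>2 - d\<^sup>2 - 4 * h\<^sup>2 \<le> 2 * m" using T2 h2 x1 unfolding lx d by linarith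
    qed (use T1 in auto)
    finally show ?thesis using m eps by linarith
  qed
  show "\<bar>d / 2 - 1 / sqrt 3\<bar> \<le> \<epsilon>"
  proof -
    have i: "(1 / sqrt 3)\<^sup>2 = 1 / 3" "1 / sqrt 3 > 1 / 2"
      using r by (simp_all add: power_divide field_simps)
    have "1 \<le> d" by (rule power2_le_imp_le) (use d in simp_all)
    have "\<bar>d / 2 - 1 / sqrt 3\<bar> * 1 \<le> \<bar>d / 2 - 1 / sqrt 3\<bar> * (d / 2 + 1 / sqrt 3)"
    proof (rule mult_left_mono)
      show "1 \<le> d / 2 + 1 / sqrt 3" using i(2) \<open>1 \<le> d\<close> by linarith
    qed simp
    also have "\<dots> = \<bar>(d / 2 - 1 / sqrt 3) * (d / 2 + 1 / sqrt 3)\<bar>"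
      using i d by (simp add: abs_mult)
    also have "(d / 2 - 1 / sqrt 3) * (d / 2 + 1 / sqrt 3) = (d / 2)\<^sup>2 - (1 / sqrt 3)\<^sup>2"
      by (simp add: power2_eq_square algebra_simps)
    also have "\<dots> = (x\<^sup>2 - 1 / 3) / 4" unfolding i(1) power_divide d(2) by (simp add: field_simps)
    also have "\<bar>(x\<^sup>2 - 1 / 3) / 4\<bar> \<le> \<epsilon>"
      using xu' xl' m eps by (auto simp: abs_le_iff field_simps)
    finally show ?thesis by simp
  qed
qed

text \<open>The position on the segment from \<open>u\<close> to \<open>v\<close> that is assigned to a point \<open>z\<close> off the segment. In contrast to the
nearest point it is given by a formula, which is continuous in \<open>z\<close> and exact at both ends.\<close>

definition share :: "'a::metric_space \<Rightarrow> 'a \<Rightarrow> 'a \<Rightarrow> real"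
  where "share u v z = dist u z / (dist u z + dist v z)"

lemma share_denominator:
  assumes "u \<noteq> v"
  shows "0 < dist u z + dist v z"
  using dist_triangle2[of u v z] assms by (metis dist_commute dist_pos_lt le_less_trans not_le)

lemma share_bounds: "0 \<le> share u v z" "share u v z \<le> 1"
  using share_denominator[of u v z] by (cases "u = v"; simp add: share_def divide_le_eq_1 divide_simps)+

lemma share_ends: "u \<noteq> v \<Longrightarrow> share u v u = 0" "u \<noteq> v \<Longrightarrow> share u v v = 1"
  by (simp_all add: share_def dist_commute)

lemma share_swap: "u \<noteq> v \<Longrightarrow> share v u z = 1 - share u v z"
  using share_denominator[of u v z] by (simp add: share_def field_simps)

lemma continuous_on_share:
  assumes "u \<noteq> v" "continuous_on A z"
  shows "continuous_on A (\<lambda>t. share u v (z t))"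
  unfolding share_def using share_denominator[OF assms(1)]
  by (intro continuous_intros assms(2)) (metis less_irrefl)

text \<open>Let \<open>x\<close>, \<open>y\<close> be the distances of \<open>z\<close> from \<open>u\<close>, \<open>v\<close>, and \<open>D\<close> the squared length of the segment. At the
parameter \<open>x / (x + y)\<close> Stewart's identity becomes \<open>x * y * (1 - D / (x + y)\<^sup>2)\<close>, which is at most
\<open>((x + y)\<^sup>2 - D) / 4\<close>.\<close>

lemma point_near_segment:
  fixes u v z :: "'a::real_inner"
  assumes uv: "u \<noteq> v" and \<eta>: "0 \<le> \<eta>" "(dist u z + dist v z)\<^sup>2 - (dist u v)\<^sup>2 \<le> 4 * \<eta>\<^sup>2"
  shows "dist ((1 - share u v z) *\<^sub>R u + share u v z *\<^sub>R v) z \<le> \<eta>"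
proof (rule power2_le_imp_le)
  let ?k = "dist u z + dist v z" and ?\<theta> = "share u v z"
  define x y D where "x = dist u z" and "y = dist v z" and "D = (dist u v)\<^sup>2"
  have k: "0 < x + y" using share_denominator[OF uv] by (simp add: x_def y_def)
  have t: "?\<theta> = x / (x + y)" "1 - ?\<theta> = y / (x + y)" using k by (auto simp: share_def x_def y_def field_simps)
  have tri: "D \<le> (x + y)\<^sup>2"
    unfolding D_def x_def y_def using dist_triangle2[of u v z] by (intro power_mono) auto
  have "(1 - ?\<theta>) * x\<^sup>2 + ?\<theta> * y\<^sup>2 - ?\<theta> * (1 - ?\<theta>) * D = x * y / (x + y)\<^sup>2 * ((x + y)\<^sup>2 - D)"
    unfolding t using k by (simp add: divide_simps) algebra
  also have "\<dots> \<le> 1 / 4 * ((x + y)\<^sup>2 - D)"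
  proof (rule mult_right_mono)
    have "4 * (x * y) \<le> (x + y)\<^sup>2"
      using zero_le_power2[of "x - y"] by (simp add: power2_eq_square algebra_simps)
    then show "x * y / (x + y)\<^sup>2 \<le> 1 / 4" using k by (simp add: divide_simps)
  qed (use tri in simp)
  also have "\<dots> \<le> \<eta>\<^sup>2" using \<eta>(2) by (simp add: x_def y_def D_def)
  finally show "(dist ((1 - ?\<theta>) *\<^sub>R u + ?\<theta> *\<^sub>R v) z)\<^sup>2 \<le> \<eta>\<^sup>2"
    unfolding stewart x_def y_def D_def .
qed (rule \<eta>(1))

text \<open>Replace \<open>Z0 r\<close> by the point of the side \<open>p b\<close> with coordinate \<open>\<alpha> r\<close>, and \<open>Z1 r\<close> by the point of \<open>p q\<close> with
coordinate \<open>\<gamma> r\<close>. The segment between these points begins at \<open>p q\<close> and ends at the segment from \<open>b\<close> to the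
point of \<open>p q\<close> that belongs to \<open>a\<close>. The point with coordinates \<open>(u, v)\<close> is between the two, so at some time
it is on the line through the moving points, by the intermediate value theorem for
\<open>u * \<gamma> r + v * \<alpha> r - \<alpha> r * \<gamma> r\<close>. It is even on the segment, unless both end points have shrunk to \<open>p\<close>;
the hypothesis \<open>apart\<close> excludes this.\<close>

lemma moving_segment_sweeps_triangle:
  fixes Z0 Z1 :: "real \<Rightarrow> 'a::real_inner"
  assumes cont: "continuous_on {0..1} Z0" "continuous_on {0..1} Z1"
    and ends: "Z0 0 = p" "Z0 1 = b" "Z1 0 = q" "Z1 1 = a"
    and ne: "p \<noteq> b" "p \<noteq> q" and \<eta>: "0 \<le> \<eta>"
    and near0: "\<And>r. r \<in> {0..1} \<Longrightarrow> (dist p (Z0 r) + dist b (Z0 r))\<^sup>2 - (dist p b)\<^sup>2 \<le> 4 * \<eta>\<^sup>2"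
    and near1: "\<And>r. r \<in> {0..1} \<Longrightarrow> (dist p (Z1 r) + dist q (Z1 r))\<^sup>2 - (dist p q)\<^sup>2 \<le> 4 * \<eta>\<^sup>2"
    and apart: "\<And>r. r \<in> {0..1} \<Longrightarrow> 2 * \<eta> < dist (Z0 r) (Z1 r)"
    and uv: "0 \<le> u" "u \<le> 1" "0 \<le> v" "u * share p q a + v \<le> share p q a"
  shows "\<exists>r\<in>{0..1}. \<exists>\<theta>\<in>{0..1}.
    dist (p + u *\<^sub>R (b - p) + v *\<^sub>R (q - p)) ((1 - \<theta>) *\<^sub>R Z0 r + \<theta> *\<^sub>R Z1 r) \<le> \<eta>"
proof -
  define \<alpha> where "\<alpha> = (\<lambda>r. share p b (Z0 r))"
  define \<gamma> where "\<gamma> = (\<lambda>r. share p q (Z1 r))"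
  have cont_\<alpha>: "continuous_on {0..1} \<alpha>" and cont_\<gamma>: "continuous_on {0..1} \<gamma>"
    unfolding \<alpha>_def \<gamma>_def by (intro continuous_on_share ne cont)+
  have \<alpha>: "0 \<le> \<alpha> r" "\<alpha> r \<le> 1" and \<gamma>: "0 \<le> \<gamma> r" "\<gamma> r \<le> 1" for r
    by (auto simp: \<alpha>_def \<gamma>_def share_bounds)
  have at_ends: "\<alpha> 0 = 0" "\<alpha> 1 = 1" "\<gamma> 0 = 1" "\<gamma> 1 = share p q a"
    by (simp_all add: \<alpha>_def \<gamma>_def ends share_ends ne)
  have d0: "dist (p + \<alpha> r *\<^sub>R (b - p)) (Z0 r) \<le> \<eta>" if "r \<in> {0..1}" for r
    using point_near_segment[OF ne(1) \<eta> near0[OF that]] by (simp add: \<alpha>_def algebra_simps)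
  have d1: "dist (p + \<gamma> r *\<^sub>R (q - p)) (Z1 r) \<le> \<eta>" if "r \<in> {0..1}" for r
    using point_near_segment[OF ne(2) \<eta> near1[OF that]] by (simp add: \<gamma>_def algebra_simps)
  have not_both: "\<not> (\<alpha> r = 0 \<and> \<gamma> r = 0)" if r: "r \<in> {0..1}" for r
  proof
    assume "\<alpha> r = 0 \<and> \<gamma> r = 0"
    then have "dist p (Z0 r) \<le> \<eta>" "dist p (Z1 r) \<le> \<eta>" using d0[OF r] d1[OF r] by simp_all
    then show False using apart[OF r] dist_triangle3[of "Z0 r" "Z1 r" p] by linarith
  qed
  have "\<exists>r\<in>{0..1}. \<exists>\<theta>\<in>{0..1}. u = (1 - \<theta>) * \<alpha> r \<and> v = \<theta> * \<gamma> r"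
  proof (cases "u = 0 \<or> v = 0")
    case True
    then show ?thesis
    proof
      assume "u = 0"
      moreover have "v \<le> 1" using uv(4) \<open>u = 0\<close> share_bounds(2)[of p q a] by simp
      ultimately show ?thesis using at_ends uv by (intro bexI[of _ 0] bexI[of _ v]) auto
    next
      assume "v = 0"
      have "\<exists>r\<ge>0. r \<le> 1 \<and> \<alpha> r = u"
        by (rule IVT') (use at_ends uv cont_\<alpha> in auto)
      then obtain r where "r \<in> {0..1}" "\<alpha> r = u" by auto
      then show ?thesis using \<open>v = 0\<close> by (intro bexI[of _ r] bexI[of _ 0]) auto
    qed
  next
    case False
    let ?F = "\<lambda>r. u * \<gamma> r + v * \<alpha> r - \<alpha> r * \<gamma> r"
    have "\<exists>r\<ge>0. r \<le> 1 \<and> ?F r = 0"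
    proof (rule IVT2')
      show "continuous_on {0..1} ?F" by (intro continuous_intros cont_\<alpha> cont_\<gamma>)
    qed (use at_ends uv in auto)
    then obtain r where r: "r \<in> {0..1}" "u * \<gamma> r + v * \<alpha> r = \<alpha> r * \<gamma> r" by auto
    have "\<alpha> r \<noteq> 0" "\<gamma> r \<noteq> 0" using r not_both[OF r(1)] False by auto
    then have pos: "0 < \<alpha> r" "0 < \<gamma> r" using \<alpha>[of r] \<gamma>[of r] by linarith+
    define \<theta> where "\<theta> = v / \<gamma> r"
    have "1 - \<theta> = u / \<alpha> r" using r(2) pos by (simp add: \<theta>_def field_simps)
    then have "u = (1 - \<theta>) * \<alpha> r" "v = \<theta> * \<gamma> r" "0 \<le> \<theta>" "0 \<le> 1 - \<theta>"
      using pos uv by (simp_all add: \<theta>_def)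
    then show ?thesis using r(1) by (intro bexI[of _ r] bexI[of _ \<theta>]) auto
  qed
  then obtain r \<theta> where r: "r \<in> {0..1}" and \<theta>: "\<theta> \<in> {0..1}" and uv': "u = (1 - \<theta>) * \<alpha> r" "v = \<theta> * \<gamma> r" by blast
  let ?e0 = "p + \<alpha> r *\<^sub>R (b - p)" and ?e1 = "p + \<gamma> r *\<^sub>R (q - p)"
  have "p + u *\<^sub>R (b - p) + v *\<^sub>R (q - p) - ((1 - \<theta>) *\<^sub>R Z0 r + \<theta> *\<^sub>R Z1 r)
    = (1 - \<theta>) *\<^sub>R (?e0 - Z0 r) + \<theta> *\<^sub>R (?e1 - Z1 r)"
    by (simp add: uv' algebra_simps)
  then have "dist (p + u *\<^sub>R (b - p) + v *\<^sub>R (q - p)) ((1 - \<theta>) *\<^sub>R Z0 r + \<theta> *\<^sub>R Z1 r)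
    \<le> norm ((1 - \<theta>) *\<^sub>R (?e0 - Z0 r)) + norm (\<theta> *\<^sub>R (?e1 - Z1 r))"
    by (metis dist_norm norm_triangle_ineq)
  also have "\<dots> = (1 - \<theta>) * dist ?e0 (Z0 r) + \<theta> * dist ?e1 (Z1 r)" using \<theta> by (simp add: dist_norm)
  also have "\<dots> \<le> (1 - \<theta>) * \<eta> + \<theta> * \<eta>"
    using \<theta> d0[OF r] d1[OF r] by (intro add_mono mult_left_mono) auto
  also have "\<dots> = \<eta>" by (simp add: algebra_simps)
  finally show ?thesis using r \<theta> by blast
qed

text \<open>The arcs at \<open>a\<close> and at \<open>b\<close> turn the T-pattern into the data of \<open>near_extremal_distances\<close>, in the frame
\<open>(e, f)\<close> of the two perpendicular directions at the midpoint \<open>c\<close> of \<open>p q\<close>. The height \<open>h\<close> is at least the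
length of \<open>a b\<close>, because \<open>a\<close> is on the same side of the line \<open>p q\<close> as \<open>b\<close>, or on this line. The
equilateral triangle has the midpoint \<open>c\<close> of one side, the direction \<open>e\<close> of this side and the direction
\<open>f\<close> of the height in common with this configuration.\<close>

lemma near_equilateral_triangle:
  fixes a b p q :: "'a::real_inner"
  assumes eps: "0 < \<epsilon>" "\<epsilon> < 1 / 4" and lam: "0 < lam" "lam < sqrt 3 + \<epsilon>"
    and perp: "(b - a) \<bullet> (q - p) = 0" and foot: "a + \<mu> *\<^sub>R (b - a) = p + \<nu> *\<^sub>R (q - p)" "\<mu> \<le> 0"
    and len: "1 \<le> dist a b" "(dist p q)\<^sup>2 = 1 + x\<^sup>2"
    and arcs: "dist a p + dist a q \<le> lam - x" "dist b p + dist b q \<le> lam + x"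
  shows "(lam - x)\<^sup>2 - (dist p q)\<^sup>2 \<le> 8 * \<epsilon>" "(lam + x)\<^sup>2 - (dist b p + dist b q)\<^sup>2 \<le> 8 * \<epsilon>"
    "b \<noteq> p" "b \<noteq> q"
    "\<exists>P Q R. dist P Q = 2 / sqrt 3 \<and> dist Q R = 2 / sqrt 3 \<and> dist R P = 2 / sqrt 3 \<and>
      dist P p \<le> 3 * sqrt \<epsilon> \<and> dist Q q \<le> 3 * sqrt \<epsilon> \<and> dist R b \<le> 3 * sqrt \<epsilon>"
proof -
  define d where "d = dist p q"
  have d2: "d\<^sup>2 = 1 + x\<^sup>2" using len by (simp add: d_def)
  then have d: "d > 0" by (smt (verit) d_def zero_le_dist zero_le_power2 zero_less_power2 zero_eq_power2)
  define l where "l = dist a b"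
  have l: "l \<ge> 1" using len by (simp add: l_def)
  define e where "e = (1 / d) *\<^sub>R (q - p)"
  define f where "f = (1 / l) *\<^sub>R (b - a)"
  have qp: "q - p = d *\<^sub>R e" and ba: "b - a = l *\<^sub>R f" using d l by (simp_all add: e_def f_def)
  have ef: "e \<bullet> e = 1" "f \<bullet> f = 1" "e \<bullet> f = 0"
  proof -
    have "(q - p) \<bullet> (q - p) = d * d" "(b - a) \<bullet> (b - a) = l * l"
      unfolding d_def l_def dist_norm power2_norm_eq_inner[symmetric]
      by (simp_all add: power2_eq_square norm_minus_commute)
    then show "e \<bullet> e = 1" "f \<bullet> f = 1" "e \<bullet> f = 0"
      using d l perp unfolding e_def f_def inner_scaleR_left inner_scaleR_right
      by (simp_all add: inner_commute)
  qed
  have nrm: "norm (s *\<^sub>R e + t *\<^sub>R f) = sqrt (s\<^sup>2 + t\<^sup>2)" for s t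
    using ef by (simp add: norm_eq_sqrt_inner inner_add_left inner_add_right inner_commute power2_eq_square)
  define \<beta> where "\<beta> = (\<nu> - 1 / 2) * d"
  define h where "h = (1 - \<mu>) * l"
  define c where "c = p + (d / 2) *\<^sub>R e"
  have h: "1 \<le> h" using mult_mono[of 1 "1 - \<mu>" 1 l] foot(2) l by (simp add: h_def)
  have foot': "a + (\<mu> * l) *\<^sub>R f = p + (\<nu> * d) *\<^sub>R e" using foot(1) unfolding qp ba by simp
  have "b = a + (\<mu> * l) *\<^sub>R f + ((1 - \<mu>) * l) *\<^sub>R f" using ba by (simp add: algebra_simps)
  then have b: "b = c + \<beta> *\<^sub>R e + h *\<^sub>R f"
    unfolding foot' by (simp add: c_def \<beta>_def h_def algebra_simps)
  have p: "p = c - (d / 2) *\<^sub>R e" by (simp add: c_def)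
  have "q = p + d *\<^sub>R e" using qp by (simp add: algebra_simps)
  also have "\<dots> = c + (d / 2 + - d / 2 + d / 2) *\<^sub>R e"
    unfolding p by (simp flip: scaleR_add_left add: algebra_simps)
  finally have q: "q = c + (d / 2) *\<^sub>R e" by simp
  have "b - p = (\<beta> + d / 2) *\<^sub>R e + h *\<^sub>R f" "b - q = (\<beta> - d / 2) *\<^sub>R e + h *\<^sub>R f"
    unfolding b p q by (simp_all add: algebra_simps)
  then have bp: "(dist b p)\<^sup>2 = (\<beta> + d / 2)\<^sup>2 + h\<^sup>2" "(dist b q)\<^sup>2 = (\<beta> - d / 2)\<^sup>2 + h\<^sup>2"
    by (simp_all add: dist_norm nrm)
  have "0 < (dist b p)\<^sup>2" "0 < (dist b q)\<^sup>2"
    unfolding bp using h by (auto intro!: add_nonneg_pos)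
  then show "b \<noteq> p" "b \<noteq> q" by auto
  have dl: "d \<le> lam - x" using arcs(1) dist_triangle3[of p q a] by (simp add: d_def)
  note real = near_extremal_distances[OF eps lam d d2 dl h zero_le_dist zero_le_dist bp arcs(2)]
  show "(lam - x)\<^sup>2 - (dist p q)\<^sup>2 \<le> 8 * \<epsilon>" "(lam + x)\<^sup>2 - (dist b p + dist b q)\<^sup>2 \<le> 8 * \<epsilon>"
    using real(1,2) by (simp_all add: d_def)
  define k where "k = 1 / sqrt 3"
  have k: "k > 0" "k\<^sup>2 = 1 / 3" by (simp_all add: k_def power_divide)
  have k2: "2 / sqrt 3 = 2 * k" by (simp add: k_def)
  have se: "\<epsilon> \<le> sqrt \<epsilon> / 2"
  proof -
    have "sqrt \<epsilon> \<le> 1 / 2" using eps by (intro real_le_lsqrt) (auto simp: power2_eq_square)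
    then have "sqrt \<epsilon> * sqrt \<epsilon> \<le> 1 / 2 * sqrt \<epsilon>" using eps by (intro mult_right_mono) auto
    then show ?thesis using eps by simp
  qed
  have sides: "dist (c - k *\<^sub>R e) (c + k *\<^sub>R e) = 2 * k" "dist (c + k *\<^sub>R e) (c + f) = 2 * k"
    "dist (c + f) (c - k *\<^sub>R e) = 2 * k"
  proof -
    have "k\<^sup>2 + 1 = (2 * k)\<^sup>2" using k by (simp add: power_mult_distrib)
    then have s: "sqrt (k\<^sup>2 + 1) = 2 * k" using k by (simp only: real_sqrt_abs)
    have "dist (c - k *\<^sub>R e) (c + k *\<^sub>R e) = norm ((- (2 * k)) *\<^sub>R e + 0 *\<^sub>R f)"
      by (simp add: dist_norm scaleR_2 flip: scaleR_scaleR)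
    also have "\<dots> = 2 * k" unfolding nrm using k by (simp add: real_sqrt_mult)
    finally show "dist (c - k *\<^sub>R e) (c + k *\<^sub>R e) = 2 * k" .
    have "dist (c + k *\<^sub>R e) (c + f) = norm (k *\<^sub>R e + (-1) *\<^sub>R f)" by (simp add: dist_norm)
    also have "\<dots> = 2 * k" unfolding nrm using s by simp
    finally show "dist (c + k *\<^sub>R e) (c + f) = 2 * k" .
    have "dist (c + f) (c - k *\<^sub>R e) = norm (k *\<^sub>R e + 1 *\<^sub>R f)" by (simp add: dist_norm algebra_simps)
    also have "\<dots> = 2 * k" unfolding nrm using s by simp
    finally show "dist (c + f) (c - k *\<^sub>R e) = 2 * k" .
  qed
  have "dist (c - k *\<^sub>R e) p = norm ((d / 2 - k) *\<^sub>R e + 0 *\<^sub>R f)"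
    unfolding p by (simp add: dist_norm algebra_simps)
  moreover have "dist (c + k *\<^sub>R e) q = norm ((k - d / 2) *\<^sub>R e + 0 *\<^sub>R f)"
    unfolding q by (simp add: dist_norm algebra_simps)
  ultimately have Pp: "dist (c - k *\<^sub>R e) p \<le> 3 * sqrt \<epsilon>" "dist (c + k *\<^sub>R e) q \<le> 3 * sqrt \<epsilon>"
    using real(5) se eps unfolding nrm k_def[symmetric] by (simp_all add: abs_minus_commute)
  have "dist (c + f) b = norm ((- \<beta>) *\<^sub>R e + (1 - h) *\<^sub>R f)"
    unfolding b by (simp add: dist_norm algebra_simps)
  also have "\<dots> \<le> \<bar>\<beta>\<bar> + \<bar>1 - h\<bar>"
    unfolding nrm using sqrt_sum_squares_le_sum_abs[of "- \<beta>" "1 - h"] by simp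
  also have "\<dots> \<le> 2 * sqrt \<epsilon> + \<epsilon>"
  proof (rule add_mono)
    show "\<bar>\<beta>\<bar> \<le> 2 * sqrt \<epsilon>"
      by (rule power2_le_imp_le) (use real(3) eps in \<open>auto simp: power_mult_distrib\<close>)
    show "\<bar>1 - h\<bar> \<le> \<epsilon>" using real(4) h by simp
  qed
  finally have "dist (c + f) b \<le> 3 * sqrt \<epsilon>" using se eps by simp
  then show "\<exists>P Q R. dist P Q = 2 / sqrt 3 \<and> dist Q R = 2 / sqrt 3 \<and> dist R P = 2 / sqrt 3 \<and>
      dist P p \<le> 3 * sqrt \<epsilon> \<and> dist Q q \<le> 3 * sqrt \<epsilon> \<and> dist R b \<le> 3 * sqrt \<epsilon>"
    unfolding k2 using sides Pp by blast
qed

section \<open>The band and the triangle\<close>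

text \<open>Among paths \<open>r + B \<le> k\<close> that replace the side \<open>A\<close> of a broken line with sides \<open>A\<close>, \<open>B\<close>, the excess over \<open>A\<close>
is controlled by that of \<open>k\<close> over \<open>A + B\<close>, since \<open>r\<^sup>2 - A\<^sup>2 \<le> (r + B)\<^sup>2 - (A + B)\<^sup>2\<close>.\<close>

lemma square_gap_of_longer_arc:
  fixes A B r k e :: real
  assumes "0 \<le> A" "0 \<le> B" "A \<le> r" "r + B \<le> k" "k\<^sup>2 - (A + B)\<^sup>2 \<le> e"
  shows "r\<^sup>2 - A\<^sup>2 \<le> e"
proof -
  have "(r + B)\<^sup>2 \<le> k\<^sup>2" using assms by (intro power_mono) auto
  moreover have "0 \<le> 2 * B * (r - A)" using assms by simp
  ultimately show ?thesis using assms(5) by (simp add: power2_eq_square algebra_simps)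
qed

lemma convex_combination_near:
  fixes x y x' y' :: "'a::real_normed_vector"
  assumes "dist x x' \<le> \<eta>" "dist y y' \<le> \<eta>" "0 \<le> r" "r \<le> 1"
  shows "dist ((1 - r) *\<^sub>R x + r *\<^sub>R y) ((1 - r) *\<^sub>R x' + r *\<^sub>R y') \<le> \<eta>"
proof -
  have "(1 - r) *\<^sub>R x + r *\<^sub>R y - ((1 - r) *\<^sub>R x' + r *\<^sub>R y') = (1 - r) *\<^sub>R (x - x') + r *\<^sub>R (y - y')"
    by (simp add: algebra_simps)
  then have "dist ((1 - r) *\<^sub>R x + r *\<^sub>R y) ((1 - r) *\<^sub>R x' + r *\<^sub>R y')
    \<le> norm ((1 - r) *\<^sub>R (x - x')) + norm (r *\<^sub>R (y - y'))"
    by (metis dist_norm norm_triangle_ineq)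
  also have "\<dots> = (1 - r) * dist x x' + r * dist y y'" using assms by (simp add: dist_norm)
  also have "\<dots> \<le> (1 - r) * \<eta> + r * \<eta>" using assms by (intro add_mono mult_left_mono) auto
  also have "\<dots> = \<eta>" by (simp add: algebra_simps)
  finally show ?thesis .
qed

lemma nearby_triangles:
  fixes p q b :: "'a::real_normed_vector"
  assumes "dist p P \<le> \<delta>" "dist q Q \<le> \<delta>" "dist b R \<le> \<delta>" and w: "w \<in> convex hull {p, q, b}"
  shows "\<exists>w'\<in>convex hull {P, Q, R}. dist w w' \<le> \<delta>"
proof -
  obtain u v c where uvc: "0 \<le> u" "0 \<le> v" "0 \<le> c" "u + v + c = 1" "w = u *\<^sub>R p + v *\<^sub>R q + c *\<^sub>R b"
    using w unfolding convex_hull_3 by blast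
  let ?w = "u *\<^sub>R P + v *\<^sub>R Q + c *\<^sub>R R"
  have "?w \<in> convex hull {P, Q, R}" unfolding convex_hull_3 using uvc by blast
  moreover have "dist w ?w \<le> \<delta>"
  proof -
    have "w - ?w = u *\<^sub>R (p - P) + v *\<^sub>R (q - Q) + c *\<^sub>R (b - R)"
      by (simp add: uvc(5) algebra_simps)
    then have "dist w ?w \<le> norm (u *\<^sub>R (p - P)) + norm (v *\<^sub>R (q - Q)) + norm (c *\<^sub>R (b - R))"
      by (metis dist_norm norm_triangle_le order_refl norm_triangle_ineq add_right_mono order_trans)
    also have "\<dots> = u * dist p P + v * dist q Q + c * dist b R" using uvc by (simp add: dist_norm)
    also have "\<dots> \<le> u * \<delta> + v * \<delta> + c * \<delta>" using uvc assms by (intro add_mono mult_left_mono) auto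
    also have "\<dots> = \<delta>" using uvc(4) by (simp flip: distrib_right)
    finally show ?thesis .
  qed
  ultimately show ?thesis by blast
qed

context embedded_paper_strip
begin

lemma bend_shift:
  "closed_segment (lower (\<tau> + 2 * lam * of_int k)) (upper (\<tau> + 2 * lam * of_int k))
    = closed_segment (lower \<tau>) (upper \<tau>)"
proof (induction k rule: int_induct[where k = 0])
  case (step1 i)
  have "\<tau> + 2 * lam * of_int (i + 1) = \<tau> + 2 * lam * of_int i + 2 * lam" by (simp add: algebra_simps)
  then show ?case using step1 by (simp only: lower_upper_glide closed_segment_commute)
next
  case (step2 i)
  have "\<tau> + 2 * lam * of_int i = \<tau> + 2 * lam * of_int (i - 1) + 2 * lam" by (simp add: algebra_simps)
  then show ?case using step2 by (simp only: lower_upper_glide closed_segment_commute)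
qed simp

lemma image_is_union_of_bends:
  "X ` strip = (\<Union>\<tau>\<in>{s..s + 2 * lam}. closed_segment (lower \<tau>) (upper \<tau>))"
proof (intro equalityI subsetI)
  fix z assume "z \<in> X ` strip"
  then obtain x y where z: "z = X (x, y)" and y: "0 \<le> y" "y \<le> 1" by (auto simp: strip_def)
  obtain \<tau> where x: "(1 - y) * bottom_end \<tau> + y * top_end \<tau> = x" using bends_cover_strip[OF y] by blast
  have zt: "z \<in> closed_segment (lower \<tau>) (upper \<tau>)"
    using X_on_bend[OF bend_bottom_top y, of \<tau>] y
    by (auto simp: z x[symmetric] lower_def upper_def closed_segment_def)
  obtain k :: int where k: "of_int k \<le> (\<tau> - s) / (2 * lam)" "(\<tau> - s) / (2 * lam) < of_int k + 1"
    by (rule that[of "\<lfloor>(\<tau> - s) / (2 * lam)\<rfloor>"]) linarith+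
  define \<tau>' where "\<tau>' = \<tau> - 2 * lam * of_int k"
  have "\<tau>' \<in> {s..s + 2 * lam}" using k lam_pos by (simp add: \<tau>'_def field_simps)
  moreover have "z \<in> closed_segment (lower \<tau>') (upper \<tau>')"
    using zt bend_shift[of \<tau>' k] unfolding \<tau>'_def diff_add_cancel by blast
  ultimately show "z \<in> (\<Union>\<tau>\<in>{s..s + 2 * lam}. closed_segment (lower \<tau>) (upper \<tau>))" by blast
next
  fix z assume "z \<in> (\<Union>\<tau>\<in>{s..s + 2 * lam}. closed_segment (lower \<tau>) (upper \<tau>))"
  then obtain \<tau> y where "0 \<le> y" "y \<le> 1" "z = (1 - y) *\<^sub>R lower \<tau> + y *\<^sub>R upper \<tau>"
    by (auto simp: closed_segment_def)
  then have "z = X ((1 - y) * bottom_end \<tau> + y * top_end \<tau>, y)" "((1 - y) * bottom_end \<tau> + y * top_end \<tau>, y) \<in> strip"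
    using X_on_bend[OF bend_bottom_top, of y \<tau>] by (auto simp: lower_def upper_def strip_def)
  then show "z \<in> X ` strip" by blast
qed

lemma boundary_arc_lengths:
  assumes "\<tau> \<le> \<tau>'"
  shows "dist (lower \<tau>) (lower \<tau>') \<le> bottom_end \<tau>' - bottom_end \<tau>" "dist (upper \<tau>) (upper \<tau>') \<le> top_end \<tau>' - top_end \<tau>"
  using contracting[of "(bottom_end \<tau>, 0)" "(bottom_end \<tau>', 0)"] contracting[of "(top_end \<tau>, 1)" "(top_end \<tau>', 1)"]
    bottom_end_mono[OF assms] top_end_mono[OF assms]
  by (simp_all add: lower_def upper_def dist_prod_def dist_real_def)

text \<open>Bends with parameter from \<open>s\<close> to \<open>t\<close> lead from \<open>a b\<close> to \<open>p q\<close>, those from \<open>t\<close> to \<open>s + 2 * lam\<close> lead from \<open>p q\<close>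
back to \<open>a b\<close>, with the ends exchanged. In the second range the lower end points run along the arc from
\<open>p\<close> to \<open>b\<close> and the upper ones along the arc from \<open>q\<close> to \<open>a\<close>; in the first one the upper end points run along
the arc from \<open>b\<close> to \<open>q\<close> and the lower ones along the arc from \<open>a\<close> to \<open>p\<close>. All these end points are within
\<open>\<eta>\<close> of a side of the triangle \<open>p q b\<close>, and the vertices of the latter are within \<open>3 * sqrt \<epsilon>\<close> of those of
the equilateral triangle. Hence both claims hold with the constant \<open>9 / 2\<close>.\<close>

lemma close_to_equilateral_triangle:
  assumes eps: "0 < \<epsilon>" "\<epsilon> < 1 / 4" and lam: "lam < sqrt 3 + \<epsilon>"
  shows "\<exists>T. solid_equilateral_triangle (2 * sqrt 3) T \<and>
    (\<forall>p\<in>X ` strip. infdist p T \<le> 6 * sqrt \<epsilon>) \<and>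
    (\<epsilon> < 1 / 384 \<longrightarrow> (\<forall>p\<in>T. infdist p (X ` strip) \<le> 18 * sqrt \<epsilon>))"
proof -
  obtain s t \<mu> \<nu> where st: "s < t" "t < s + 2 * lam"
    and perp: "(upper s - lower s) \<bullet> (upper t - lower t) = 0"
    and foot: "lower s + \<mu> *\<^sub>R (upper s - lower s) = lower t + \<nu> *\<^sub>R (upper t - lower t)" "\<mu> \<le> 0"
    using ex_T_pattern by blast
  define a b p q where "a = lower s" and "b = upper s" and "p = lower t" and "q = upper t"
  define x where "x = top_end t - bottom_end t"
  have ab': "lower (s + 2 * lam) = b" "upper (s + 2 * lam) = a"
    by (simp_all add: lower_upper_glide a_def b_def)
  have ap: "dist a p \<le> bottom_end t - bottom_end s" and bq: "dist b q \<le> top_end t - top_end s"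
    using boundary_arc_lengths[of s t] st by (simp_all add: a_def b_def p_def q_def)
  have pb: "dist p b \<le> top_end s + lam - bottom_end t" and qa: "dist q a \<le> bottom_end s + lam - top_end t"
    using boundary_arc_lengths[of t "s + 2 * lam"] st
    by (simp_all add: ab' ends_glide p_def[symmetric] q_def[symmetric])
  have len: "1 \<le> dist a b" "(dist p q)\<^sup>2 = 1 + x\<^sup>2"
    using dist_lower_upper_ge_1[of s] by (simp_all add: a_def b_def p_def q_def x_def dist_lower_upper)
  have arcs: "dist a p + dist a q \<le> lam - x" "dist b p + dist b q \<le> lam + x"
    using ap bq pb qa by (simp_all add: x_def dist_commute)
  note tri = near_equilateral_triangle[OF eps lam_pos lam perp[folded a_def b_def p_def q_def]
      foot[folded a_def b_def p_def q_def] len arcs]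
  have "0 < (dist p q)\<^sup>2" unfolding len(2) by (rule add_pos_nonneg) simp_all
  then have pq: "p \<noteq> q" by auto
  have near_right: "(dist p (lower \<tau>) + dist b (lower \<tau>))\<^sup>2 - (dist p b)\<^sup>2 \<le> 8 * \<epsilon>"
    "(dist p (upper \<tau>) + dist q (upper \<tau>))\<^sup>2 - (dist p q)\<^sup>2 \<le> 8 * \<epsilon>"
    if \<tau>: "t \<le> \<tau>" "\<tau> \<le> s + 2 * lam" for \<tau>
  proof -
    note arc = boundary_arc_lengths[OF \<tau>(1), folded p_def q_def]
      boundary_arc_lengths[OF \<tau>(2), unfolded ab' ends_glide]
    have r: "dist p (lower \<tau>) + dist b (lower \<tau>) \<le> top_end s + lam - bottom_end t"
      using arc by (simp add: dist_commute)
    show "(dist p (lower \<tau>) + dist b (lower \<tau>))\<^sup>2 - (dist p b)\<^sup>2 \<le> 8 * \<epsilon>"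
      by (rule square_gap_of_longer_arc[where B = "dist b q" and k = "lam + x",
            OF zero_le_dist zero_le_dist dist_triangle2 _ tri(2)[unfolded dist_commute[of b p]]])
        (use bq r in \<open>simp add: x_def\<close>)
    have "dist p (upper \<tau>) \<le> dist a p + dist a (upper \<tau>)"
      using dist_triangle3[of p "upper \<tau>" a] by simp
    then have "dist p (upper \<tau>) + dist q (upper \<tau>) \<le> lam - x"
      using arc ap by (simp add: dist_commute x_def)
    then show "(dist p (upper \<tau>) + dist q (upper \<tau>))\<^sup>2 - (dist p q)\<^sup>2 \<le> 8 * \<epsilon>"
      using tri(1)
      by (intro square_gap_of_longer_arc[where B = 0 and k = "lam - x", OF zero_le_dist _ dist_triangle2])
        simp_all
  qed
  have near_left: "(dist q (upper \<tau>) + dist b (upper \<tau>))\<^sup>2 - (dist q b)\<^sup>2 \<le> 8 * \<epsilon>"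
    "(dist q (lower \<tau>) + dist p (lower \<tau>))\<^sup>2 - (dist q p)\<^sup>2 \<le> 8 * \<epsilon>"
    if \<tau>: "s \<le> \<tau>" "\<tau> \<le> t" for \<tau>
  proof -
    note arc = boundary_arc_lengths[OF \<tau>(1), folded a_def b_def]
      boundary_arc_lengths[OF \<tau>(2), folded p_def q_def]
    have r: "dist q (upper \<tau>) + dist b (upper \<tau>) \<le> top_end t - top_end s"
      using arc by (simp add: dist_commute)
    show "(dist q (upper \<tau>) + dist b (upper \<tau>))\<^sup>2 - (dist q b)\<^sup>2 \<le> 8 * \<epsilon>"
      by (rule square_gap_of_longer_arc[where B = "dist b p" and k = "lam + x",
            OF zero_le_dist zero_le_dist dist_triangle2 _
              tri(2)[unfolded add.commute[of "dist b p"] dist_commute[of b q]]])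
        (use pb r in \<open>simp add: x_def dist_commute\<close>)
    have "dist q (lower \<tau>) \<le> dist a q + dist a (lower \<tau>)"
      using dist_triangle3[of q "lower \<tau>" a] by simp
    then have "dist q (lower \<tau>) + dist p (lower \<tau>) \<le> lam - x"
      using arc qa by (simp add: dist_commute x_def)
    then show "(dist q (lower \<tau>) + dist p (lower \<tau>))\<^sup>2 - (dist q p)\<^sup>2 \<le> 8 * \<epsilon>"
      using tri(1)[unfolded dist_commute[of p q]]
      by (intro square_gap_of_longer_arc[where B = 0 and k = "lam - x", OF zero_le_dist _ dist_triangle2])
        simp_all
  qed
  \<comment> \<open>large enough for \<open>8 * \<epsilon> \<le> 4 * \<eta>\<^sup>2\<close>, the bound that \<open>point_near_segment\<close> needs\<close>
  define \<eta> where "\<eta> = 3 / 2 * sqrt \<epsilon>"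
  have \<eta>: "0 \<le> \<eta>" "8 * \<epsilon> \<le> 4 * \<eta>\<^sup>2" using eps by (simp_all add: \<eta>_def power_mult_distrib power_divide)
  obtain P Q R where PQR: "dist P Q = 2 / sqrt 3" "dist Q R = 2 / sqrt 3" "dist R P = 2 / sqrt 3"
    and close: "dist P p \<le> 3 * sqrt \<epsilon>" "dist Q q \<le> 3 * sqrt \<epsilon>" "dist R b \<le> 3 * sqrt \<epsilon>"
    using tri(5) by blast
  define T where "T = convex hull {P, Q, R}"
  let ?H = "convex hull {p, q, b}"
  have T: "solid_equilateral_triangle (2 * sqrt 3) T"
    unfolding solid_equilateral_triangle_def
  proof (intro exI conjI)
    have "6 / sqrt 3 = 2 * sqrt 3" by (simp add: field_simps)
    then show "dist P Q + dist Q R + dist R P = 2 * sqrt 3" by (simp add: PQR)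
  qed (simp_all add: PQR T_def)
  have vertices: "p \<in> ?H" "q \<in> ?H" "b \<in> ?H" by (auto intro: hull_inc)
  have on_side: "\<exists>w\<in>?H. dist w z \<le> \<eta>"
    if "u \<noteq> v" "u \<in> ?H" "v \<in> ?H" "(dist u z + dist v z)\<^sup>2 - (dist u v)\<^sup>2 \<le> 8 * \<epsilon>" for u v z
  proof (rule bexI)
    show "dist ((1 - share u v z) *\<^sub>R u + share u v z *\<^sub>R v) z \<le> \<eta>"
      using that \<eta> by (intro point_near_segment) auto
    show "(1 - share u v z) *\<^sub>R u + share u v z *\<^sub>R v \<in> ?H"
      using that share_bounds[of u v z] by (intro convexD[OF convex_convex_hull]) auto
  qed
  have ends_near: "\<exists>w\<in>?H. dist w (lower \<tau>) \<le> \<eta>" "\<exists>w\<in>?H. dist w (upper \<tau>) \<le> \<eta>"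
    if \<tau>: "s \<le> \<tau>" "\<tau> \<le> s + 2 * lam" for \<tau>
  proof -
    have "(\<exists>w\<in>?H. dist w (lower \<tau>) \<le> \<eta>) \<and> (\<exists>w\<in>?H. dist w (upper \<tau>) \<le> \<eta>)"
    proof (cases "\<tau> \<le> t")
      case True
      then show ?thesis
        using on_side[OF _ _ _ near_left(1)[OF \<tau>(1) True]] on_side[OF _ _ _ near_left(2)[OF \<tau>(1) True]]
          vertices pq tri(3,4) by blast
    next
      case False
      then have "t \<le> \<tau>" by simp
      then show ?thesis
        using on_side[OF _ _ _ near_right(1)[OF _ \<tau>(2)]] on_side[OF _ _ _ near_right(2)[OF _ \<tau>(2)]]
          vertices pq tri(3,4) by blast
    qed
    then show "\<exists>w\<in>?H. dist w (lower \<tau>) \<le> \<eta>" "\<exists>w\<in>?H. dist w (upper \<tau>) \<le> \<eta>" by blast+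
  qed
  have first: "infdist z T \<le> 6 * sqrt \<epsilon>" if zX: "z \<in> X ` strip" for z
  proof -
    obtain \<tau> y where \<tau>: "s \<le> \<tau>" "\<tau> \<le> s + 2 * lam" and y: "0 \<le> y" "y \<le> 1"
      and z: "z = (1 - y) *\<^sub>R lower \<tau> + y *\<^sub>R upper \<tau>"
      using zX unfolding image_is_union_of_bends[of s] closed_segment_def by auto
    obtain w0 where w0: "w0 \<in> ?H" "dist w0 (lower \<tau>) \<le> \<eta>" using ends_near(1)[OF \<tau>] by blast
    obtain w1 where w1: "w1 \<in> ?H" "dist w1 (upper \<tau>) \<le> \<eta>" using ends_near(2)[OF \<tau>] by blast
    let ?w = "(1 - y) *\<^sub>R w0 + y *\<^sub>R w1"
    have "?w \<in> ?H" using w0 w1 y by (intro convexD[OF convex_convex_hull]) auto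
    then obtain w' where w': "w' \<in> T" "dist ?w w' \<le> 3 * sqrt \<epsilon>"
      unfolding T_def using nearby_triangles[of p P _ q Q b R] close by (metis dist_commute)
    have "infdist z T \<le> dist z w'" using w'(1) by (rule infdist_le)
    also have "\<dots> \<le> dist ?w z + dist ?w w'" by (rule dist_triangle3)
    also have "dist ?w z \<le> \<eta>" unfolding z by (rule convex_combination_near[OF w0(2) w1(2) y])
    finally have "infdist z T \<le> 3 / 2 * sqrt \<epsilon> + dist ?w w'" by (simp add: \<eta>_def)
    moreover have "0 \<le> sqrt \<epsilon>" using eps by simp
    ultimately show ?thesis using w'(2) by linarith
  qed
  have second: "infdist w (X ` strip) \<le> 18 * sqrt \<epsilon>" if small: "\<epsilon> < 1 / 384" and w: "w \<in> T" for w
  proof -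
    have "sqrt \<epsilon> < 1 / 3"
      using small eps by (intro real_less_lsqrt) (auto simp: power2_eq_square)
    then have apart: "2 * \<eta> < dist (lower \<tau>) (upper \<tau>)" for \<tau>
      using dist_lower_upper_ge_1[of \<tau>] by (simp add: \<eta>_def)
    obtain w' where w': "w' \<in> ?H" "dist w w' \<le> 3 * sqrt \<epsilon>"
      using nearby_triangles[of P p _ Q q R b] close w unfolding T_def by blast
    obtain u0 v u where uv: "0 \<le> u0" "0 \<le> v" "0 \<le> u" "u0 + v + u = 1" "w' = u0 *\<^sub>R p + v *\<^sub>R q + u *\<^sub>R b"
      using w'(1) unfolding convex_hull_3 by blast
    have u0: "u0 = 1 - u - v" using uv(4) by simp
    have v: "v = 1 - u - u0" using uv(4) by simp
    \<comment> \<open>The line from \<open>b\<close> to the point of \<open>p q\<close> with coordinate \<open>g\<close> separates the parts of the triangle swept by the two families of bends.\<close>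
    define g where "g = share p q a"
    have unit: "0 \<le> r * c \<and> r * c \<le> c" if "r \<in> {0..1}" "0 < c" for r c :: real
      using that by (simp add: mult_left_le_one_le)
    have "\<exists>\<tau> \<theta>. \<theta> \<in> {0..1} \<and> \<tau> \<in> {s..s + 2 * lam} \<and> dist w' ((1 - \<theta>) *\<^sub>R lower \<tau> + \<theta> *\<^sub>R upper \<tau>) \<le> \<eta>"
    proof (cases "u * g + v \<le> g")
      case True
      let ?\<tau> = "\<lambda>r. t + r * (s + 2 * lam - t)"
      have \<tau>: "t \<le> ?\<tau> r" "?\<tau> r \<le> s + 2 * lam" if "r \<in> {0..1}" for r
        using st unit[OF that, of "s + 2 * lam - t"] by linarith+
      have "\<exists>r\<in>{0..1}. \<exists>\<theta>\<in>{0..1}. dist (p + u *\<^sub>R (b - p) + v *\<^sub>R (q - p))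
        ((1 - \<theta>) *\<^sub>R lower (?\<tau> r) + \<theta> *\<^sub>R upper (?\<tau> r)) \<le> \<eta>"
      proof (rule moving_segment_sweeps_triangle[where a = a])
        show "continuous_on {0..1} (\<lambda>r. lower (?\<tau> r))" "continuous_on {0..1} (\<lambda>r. upper (?\<tau> r))"
          by (intro continuous_on_compose2[OF continuous_lower[of UNIV]]
              continuous_on_compose2[OF continuous_upper[of UNIV]] continuous_intros; simp)+
        fix r :: real assume r: "r \<in> {0..1}"
        show "(dist p (lower (?\<tau> r)) + dist b (lower (?\<tau> r)))\<^sup>2 - (dist p b)\<^sup>2 \<le> 4 * \<eta>\<^sup>2"
          "(dist p (upper (?\<tau> r)) + dist q (upper (?\<tau> r)))\<^sup>2 - (dist p q)\<^sup>2 \<le> 4 * \<eta>\<^sup>2"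
          using near_right[OF \<tau>[OF r]] \<eta>(2) by linarith+
      qed (use ab' pq tri(3) \<eta> apart uv u0 True in \<open>auto simp: p_def q_def g_def\<close>)
      then obtain r \<theta> where r: "r \<in> {0..1}" "\<theta> \<in> {0..1}" "dist (p + u *\<^sub>R (b - p) + v *\<^sub>R (q - p))
        ((1 - \<theta>) *\<^sub>R lower (?\<tau> r) + \<theta> *\<^sub>R upper (?\<tau> r)) \<le> \<eta>" by blast
      have "p + u *\<^sub>R (b - p) + v *\<^sub>R (q - p) = w'"
        unfolding uv(5) u0 by (simp add: algebra_simps)
      moreover have "?\<tau> r \<in> {s..s + 2 * lam}"
        unfolding atLeastAtMost_iff using \<tau>[OF r(1)] st by linarith
      ultimately show ?thesis using r(2,3) by metis
    next
      case False
      let ?\<tau> = "\<lambda>r. t + r * (s - t)"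
      have \<tau>: "s \<le> ?\<tau> r" "?\<tau> r \<le> t" if "r \<in> {0..1}" for r
        using st unit[OF that, of "t - s"] by (simp_all add: algebra_simps)
      have "\<exists>r\<in>{0..1}. \<exists>\<theta>\<in>{0..1}. dist (q + u *\<^sub>R (b - q) + u0 *\<^sub>R (p - q))
        ((1 - \<theta>) *\<^sub>R upper (?\<tau> r) + \<theta> *\<^sub>R lower (?\<tau> r)) \<le> \<eta>"
      proof (rule moving_segment_sweeps_triangle[where a = a])
        show "continuous_on {0..1} (\<lambda>r. lower (?\<tau> r))" "continuous_on {0..1} (\<lambda>r. upper (?\<tau> r))"
          by (intro continuous_on_compose2[OF continuous_lower[of UNIV]]
              continuous_on_compose2[OF continuous_upper[of UNIV]] continuous_intros; simp)+
        fix r :: real assume r: "r \<in> {0..1}"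
        show "(dist q (upper (?\<tau> r)) + dist b (upper (?\<tau> r)))\<^sup>2 - (dist q b)\<^sup>2 \<le> 4 * \<eta>\<^sup>2"
          "(dist q (lower (?\<tau> r)) + dist p (lower (?\<tau> r)))\<^sup>2 - (dist q p)\<^sup>2 \<le> 4 * \<eta>\<^sup>2"
          using near_left[OF \<tau>[OF r]] \<eta>(2) by linarith+
        show "2 * \<eta> < dist (upper (?\<tau> r)) (lower (?\<tau> r))" using apart by (simp add: dist_commute)
      next
        show "u * share q p a + u0 \<le> share q p a"
          unfolding share_swap[OF pq] g_def[symmetric] u0 using False by (simp add: algebra_simps)
      qed (use pq tri(4) \<eta> uv u0 in \<open>auto simp: p_def q_def a_def b_def\<close>)
      then obtain r \<theta> where r: "r \<in> {0..1}" "\<theta> \<in> {0..1}" "dist (q + u *\<^sub>R (b - q) + u0 *\<^sub>R (p - q))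
        ((1 - \<theta>) *\<^sub>R upper (?\<tau> r) + \<theta> *\<^sub>R lower (?\<tau> r)) \<le> \<eta>" by blast
      have "q + u *\<^sub>R (b - q) + u0 *\<^sub>R (p - q) = w'"
        unfolding uv(5) by (subst v) (simp add: algebra_simps)
      then have "dist w' ((1 - (1 - \<theta>)) *\<^sub>R lower (?\<tau> r) + (1 - \<theta>) *\<^sub>R upper (?\<tau> r)) \<le> \<eta>"
        using r(3) by (simp add: add.commute)
      moreover have "?\<tau> r \<in> {s..s + 2 * lam}"
        unfolding atLeastAtMost_iff using \<tau>[OF r(1)] st by linarith
      moreover have "1 - \<theta> \<in> {0..1}" using r(2) by simp
      ultimately show ?thesis by blast
    qed
    then obtain \<tau> \<theta> where *: "\<theta> \<in> {0..1}" "\<tau> \<in> {s..s + 2 * lam}"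
      "dist w' ((1 - \<theta>) *\<^sub>R lower \<tau> + \<theta> *\<^sub>R upper \<tau>) \<le> \<eta>" by blast
    let ?z = "(1 - \<theta>) *\<^sub>R lower \<tau> + \<theta> *\<^sub>R upper \<tau>"
    have "?z \<in> X ` strip"
      unfolding image_is_union_of_bends[of s] closed_segment_def using *(1,2) by fastforce
    then have "infdist w (X ` strip) \<le> dist w ?z" by (rule infdist_le)
    also have "\<dots> \<le> dist w w' + dist w' ?z" by (rule dist_triangle)
    finally have "infdist w (X ` strip) \<le> 3 * sqrt \<epsilon> + 3 / 2 * sqrt \<epsilon>"
      using w'(2) *(3) unfolding \<eta>_def by linarith
    moreover have "0 \<le> sqrt \<epsilon>" using eps by simp
    ultimately show ?thesis by linarith
  qed
  show ?thesis using T first second by blast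
qed

end

theorem theorem1p2:
  fixes lam \<epsilon> :: real
    and I :: "(real \<times> real) set \<Rightarrow> real ^ 3"
    and \<Omega> :: "(real ^ 3) set"
  assumes "lam > 0"
    and "\<epsilon> > 0"
    and "paper_moebius_band lam I"
    and "\<Omega> = I ` moebius_band lam"
    and "lam < sqrt 3 + \<epsilon>"
    and "\<epsilon> < 1 / 4"
  shows "\<exists>T. solid_equilateral_triangle (2 * sqrt 3) T \<and>
           (\<forall>p\<in>\<Omega>. infdist p T \<le> 6 * sqrt \<epsilon>) \<and>
           (\<epsilon> < 1 / 384 \<longrightarrow> (\<forall>p\<in>T. infdist p \<Omega> \<le> 18 * sqrt \<epsilon>))"
proof -
  note band = assms(3)[unfolded paper_moebius_band_def]
  have "embedded_paper_strip lam (I \<circ> moebius_proj lam)"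
  proof
    show "lam > 0" by (rule assms(1))
    show "smooth_on_open (I \<circ> moebius_proj lam) open_strip"
      using band by (intro smooth_map_on_imp_smooth_on_open[of _ strip])
        (auto simp: strip_def intro!: open_Times)
    show "\<exists>D. ((I \<circ> moebius_proj lam) has_derivative D) (at p within strip) \<and> (\<forall>u v. D u \<bullet> D v = u \<bullet> v)"
      if "p \<in> strip" for p
      using band that by blast
    show "(I \<circ> moebius_proj lam) (x + lam, 1 - y) = (I \<circ> moebius_proj lam) (x, y)"
      if "0 \<le> y" "y \<le> 1" for x y
    proof -
      have "((x, y), (x + lam, 1 - y)) \<in> glide_rel lam"
        using that unfolding glide_rel_def strip_def
        by (auto intro!: exI[of _ "1::nat"] simp: glide_def)
      then show ?thesis
        unfolding comp_apply moebius_proj_def using equiv_class_eq[OF equiv_glide_rel] by metis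
    qed
    show "\<exists>n. q = (glide lam ^^ n) p \<or> p = (glide lam ^^ n) q"
      if pq: "p \<in> strip" "q \<in> strip" and eq: "(I \<circ> moebius_proj lam) p = (I \<circ> moebius_proj lam) q" for p q
    proof -
      have "inj_on I (moebius_band lam)"
        using band homeomorphic_imp_injective_map unfolding embedding_map_def by fastforce
      then have "moebius_proj lam p = moebius_proj lam q"
        using eq pq by (simp add: inj_on_eq_iff)
      then have "(p, q) \<in> glide_rel lam"
        unfolding moebius_proj_def using eq_equiv_class[OF _ equiv_glide_rel] pq by metis
      then show ?thesis by (auto simp: glide_rel_def)
    qed
  qed
  then interpret embedded_paper_strip lam "I \<circ> moebius_proj lam" .
  have "\<Omega> = (I \<circ> moebius_proj lam) ` strip"
    unfolding assms(4) image_comp[symmetric] moebius_proj_image ..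
  then show ?thesis
    using close_to_equilateral_triangle[OF assms(2,6,5)] by simp
qed

end
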